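(* Let $\theta:[0,\bar T]\to\mathbb R^n$ be a (deterministic) function with $\int_0^{\bar T}|\theta_s|^2ds<\infty$ and let $\mathbb Q\sim\mathbb P$ be the probability measure on $(\Omega,\mathcal F_{\bar T})$ with density process $$Z_t=\left.\frac{d\mathbb Q}{d\mathbb P}\right|_{\mathcal F_t}=\exp\left(-\int_0^t\theta_s\cdot dW_s-\frac12\int_0^t|\theta_s|^2ds\right),\qquad t\in[0,\bar T].$$ Then the process $W^{\mathbb Q}_t:=W_t+\int_0^t\theta_s\,ds$, $t\in[0,\bar T]$, is a Brownian motion on $(\Omega,\mathcal F,(\mathcal F_t)_{t\in[0,\bar T]},\mathbb Q)$, and $$S_t=\int_0^tK(t,s)\cdot dW^{\mathbb Q}_s+\varphi_{\mathbb Q}(t),\qquad \varphi_{\mathbb Q}(t):=\varphi(t)-\int_0^tK(t,s)\cdot\theta_s\,ds .$$ Moreover, there is no arbitrage in the market, in the sense that $$F(t,T_j)=\mathbb E_{\mathbb Q}[S_{T_j}\mid\mathcal F_t],\qquad t\in[0,T_j],\ j=1,\dots,m,$$ if and only if, for every $j=1,\dots,m$, the dynamics of $F(\cdot,T_j)$ under $\mathbb Q$ is $$dF(t,T_j)=K(T_j,t)\cdot dW^{\mathbb Q}_t,\quad t\in[0,T_j],\qquad F(T_j,T_j)=S_{T_j},$$ and the dynamics of $F(\cdot,T_j)$ under $\mathbb P$ is $dF(t,T_j)=\mu(t,T_j)\,dt+\sigma(t,T_j)\cdot dW_t$ with $$\mu(t,T_j)=K(T_j,t)\cdot\theta_t\quad\text{and}\quad\sigma(t,T_j)=K(T_j,t)\qquad\text{for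 a.a. }t\le T_j.$$
   Context: $(\Omega,\mathcal F,\mathbb P)$ is a probability space with the filtration $(\mathcal F_t)_{t\ge0}$ generated by an $n$-dimensional standard Brownian motion $W=(W^1,\dots,W^n)$, completed with the $\mathbb P$-null sets; all processes are adapted to it. $\bar T<\infty$ is a fixed horizon. The spot price of electricity is $$S_t=\sum_{i=1}^n\int_0^tK_i(t,s)\,dW^i_s+\varphi(t)=\int_0^tK(t,s)\cdot dW_s+\varphi(t),\qquad t\in[0,\bar T],$$ where $K=(K_1,\dots,K_n)$, the $K_i:[0,\bar T]^2\to\mathbb R$ are deterministic Volterra kernels with $\int_0^tK_i^2(t,s)\,ds<\infty$ for all $t\in[0,\bar T]$, and $\varphi\in C^0([0,\bar T])$ is deterministic. The spot is not traded; the traded assets are $m$ forward contracts with maturities $0<T_1<\dots<T_m\le\bar T$ (together with a riskless asset of constant price $1$). The forward price with maturity $T_j$ evolves as $dF(t,T_j)=\mu(t,T_j)\,dt+\sigma(t,T_j)\cdot dW_t$ for $t<T_j$, with terminal condition $F(T_j,T_j)=S_{T_j}$, where $\mu(\cdot,T_j)$ ($\mathbb R$-valued, integrable on $[0,T_j]$) and $\sigma(\cdot,T_j)$ ($\mathbb R^n$-valued, square integrable on $[0,T_j]$) are deterministic functions. *)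

theory Defs
  imports "HOL-Probability.Probability"
begin

definition square_integrable_on ::
    "(real \<Rightarrow> 'b::{real_normed_vector, second_countable_topology}) \<Rightarrow> real set \<Rightarrow> bool" where
  "square_integrable_on f A \<longleftrightarrow>
     set_borel_measurable lebesgue A f \<and> set_integrable lebesgue A (\<lambda>s. (norm (f s))\<^sup>2)"

section \<open>Filtrations and Brownian motion\<close>

definition past_events ::
    "'a measure \<Rightarrow> (real \<Rightarrow> 'a \<Rightarrow> 'b::topological_space) \<Rightarrow> real \<Rightarrow> 'a set set" where
  "past_events M W t = {W r -` B \<inter> space M | r B. 0 \<le> r \<and> r \<le> t \<and> B \<in> sets borel}"

text \<open>Only the \<open>\<sigma>\<close>-algebras of the following two families of measures are used; the
  measure that \<open>sigma\<close> attaches to them is zero. Negative times yield the trivial, respectively the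
  null-set, \<open>\<sigma>\<close>-algebra, so that both families are filtrations indexed by all reals.\<close>

definition natural_filtration ::
    "'a measure \<Rightarrow> (real \<Rightarrow> 'a \<Rightarrow> 'b::topological_space) \<Rightarrow> real \<Rightarrow> 'a measure" where
  "natural_filtration M W t = sigma (space M) (past_events M W t)"

definition completed_filtration ::
    "'a measure \<Rightarrow> (real \<Rightarrow> 'a \<Rightarrow> 'b::topological_space) \<Rightarrow> real \<Rightarrow> 'a measure" where
  "completed_filtration M W t = sigma (space M) (past_events M W t \<union> null_sets M)"

text \<open>Standard Brownian motion with values in \<open>\<real>\<^sup>n\<close> and time set \<open>I\<close> (containing \<open>0\<close>), with respect to
  the filtration \<open>\<F>\<close>. An increment over \<open>[s, t]\<close> is independent of \<open>\<F> s\<close> and has law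
  \<open>N(0, (t - s) Id)\<close>, expressed as independent \<open>N(0, t - s)\<close> components.\<close>

definition brownian_motion ::
    "'a measure \<Rightarrow> (real \<Rightarrow> 'a measure) \<Rightarrow> real set \<Rightarrow> (real \<Rightarrow> 'a \<Rightarrow> real ^ 'n) \<Rightarrow> bool" where
  "brownian_motion M \<F> I W \<longleftrightarrow>
     prob_space M \<and>
     filtration (space M) \<F> \<and>
     (\<forall>t\<in>I. subalgebra M (\<F> t)) \<and>
     (\<forall>t\<in>I. W t \<in> borel_measurable (\<F> t)) \<and>
     (AE \<omega> in M. W 0 \<omega> = 0) \<and>
     (AE \<omega> in M. continuous_on I (\<lambda>t. W t \<omega>)) \<and>
     (\<forall>s\<in>I. \<forall>t\<in>I. s < t \<longrightarrow>
        prob_space.indep_set M (sets (\<F> s))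
          {(\<lambda>\<omega>. W t \<omega> - W s \<omega>) -` B \<inter> space M | B. B \<in> sets borel} \<and>
        prob_space.indep_vars M (\<lambda>_. borel) (\<lambda>i \<omega>. W t \<omega> $ i - W s \<omega> $ i) UNIV \<and>
        (\<forall>i. distributed M lborel (\<lambda>\<omega>. W t \<omega> $ i - W s \<omega> $ i)
               (\<lambda>x. ennreal (normal_density 0 (sqrt (t - s)) x))))"

section \<open>Wiener integrals of deterministic integrands\<close>

definition step_function :: "(nat \<Rightarrow> real) \<Rightarrow> (nat \<Rightarrow> real) \<Rightarrow> nat \<Rightarrow> real \<Rightarrow> real" where
  "step_function p c N s = (\<Sum>k<N. c k * indicator {p k<..p (Suc k)} s)"

definition step_integral ::
    "(real \<Rightarrow> 'a \<Rightarrow> real) \<Rightarrow> (nat \<Rightarrow> real) \<Rightarrow> (nat \<Rightarrow> real) \<Rightarrow> nat \<Rightarrow> 'a \<Rightarrow> real" where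
  "step_integral B p c N \<omega> = (\<Sum>k<N. c k * (B (p (Suc k)) \<omega> - B (p k) \<omega>))"

text \<open>\<open>X\<close> is a version of the integral of \<open>f\<close> over \<open>[0, t]\<close> against the scalar Brownian motion \<open>B\<close>:
  some step functions converge to \<open>f\<close> in \<open>L\<^sup>2[0, t]\<close> while their elementary integrals converge
  to \<open>X\<close> in \<open>L\<^sup>2(M)\<close>. By the isometry, \<open>X\<close> is unique up to almost sure equality.\<close>

definition has_wiener_integral ::
    "'a measure \<Rightarrow> (real \<Rightarrow> 'a \<Rightarrow> real) \<Rightarrow> (real \<Rightarrow> real) \<Rightarrow> real \<Rightarrow> ('a \<Rightarrow> real) \<Rightarrow> bool" where
  "has_wiener_integral M B f t X \<longleftrightarrow>
     square_integrable_on f {0..t} \<and> X \<in> borel_measurable M \<and>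
     (\<exists>p c N.
        (\<forall>m. (\<forall>k\<le>N m. p m k \<in> {0..t}) \<and> (\<forall>k<N m. p m k \<le> p m (Suc k))) \<and>
        (\<lambda>m. \<integral>\<^sup>+ s\<in>{0..t}. ennreal ((f s - step_function (p m) (c m) (N m) s)\<^sup>2) \<partial>lebesgue)
          \<longlonglongrightarrow> 0 \<and>
        (\<lambda>m. \<integral>\<^sup>+ \<omega>. ennreal ((X \<omega> - step_integral B (p m) (c m) (N m) \<omega>)\<^sup>2) \<partial>M)
          \<longlonglongrightarrow> 0)"

definition wiener_integral ::
    "'a measure \<Rightarrow> (real \<Rightarrow> 'a \<Rightarrow> real) \<Rightarrow> (real \<Rightarrow> real) \<Rightarrow> real \<Rightarrow> 'a \<Rightarrow> real" where
  "wiener_integral M B f t = (SOME X. has_wiener_integral M B f t X)"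

definition vector_wiener_integral ::
    "'a measure \<Rightarrow> (real \<Rightarrow> 'a \<Rightarrow> real ^ 'n) \<Rightarrow> (real \<Rightarrow> real ^ 'n) \<Rightarrow> real \<Rightarrow> 'a \<Rightarrow> real" where
  "vector_wiener_integral M W f t \<omega> =
     (\<Sum>i\<in>UNIV. wiener_integral M (\<lambda>s \<eta>. W s \<eta> $ i) (\<lambda>s. f s $ i) t \<omega>)"

text \<open>The dynamics \<open>dX\<^sub>t = b\<^sub>t dt + v\<^sub>t \<cdot> dW\<^sub>t\<close> for \<open>t \<in> I\<close>, with deterministic coefficients, in
  integrated form; each random variable is determined up to a null set, which may depend on \<open>t\<close>.\<close>

definition has_dynamics ::
    "'a measure \<Rightarrow> (real \<Rightarrow> 'a \<Rightarrow> real ^ 'n) \<Rightarrow> real set \<Rightarrow> (real \<Rightarrow> 'a \<Rightarrow> real) \<Rightarrow>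
      (real \<Rightarrow> real) \<Rightarrow> (real \<Rightarrow> real ^ 'n) \<Rightarrow> bool" where
  "has_dynamics M W I X b v \<longleftrightarrow>
     (\<forall>t\<in>I. AE \<omega> in M.
        X t \<omega> = X 0 \<omega> + (LINT s:{0..t}|lebesgue. b s) + vector_wiener_integral M W v t \<omega>)"

section \<open>Change of measure\<close>

definition girsanov_density ::
    "'a measure \<Rightarrow> (real \<Rightarrow> 'a \<Rightarrow> real ^ 'n) \<Rightarrow> (real \<Rightarrow> real ^ 'n) \<Rightarrow> real \<Rightarrow> 'a \<Rightarrow> real" where
  "girsanov_density M W \<theta> t \<omega> =
     exp (- vector_wiener_integral M W \<theta> t \<omega>
          - 1 / 2 * (LINT s:{0..t}|lebesgue. (norm (\<theta> s))\<^sup>2))"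

text \<open>A measure on the \<open>\<sigma>\<close>-algebra of the completed filtration at the horizon, not on \<open>sets M\<close>.\<close>

definition girsanov_measure ::
    "'a measure \<Rightarrow> (real \<Rightarrow> 'a \<Rightarrow> real ^ 'n) \<Rightarrow> (real \<Rightarrow> real ^ 'n) \<Rightarrow> real \<Rightarrow> 'a measure" where
  "girsanov_measure M W \<theta> Tbar =
     density (restr_to_subalg M (completed_filtration M W Tbar))
       (\<lambda>\<omega>. ennreal (girsanov_density M W \<theta> Tbar \<omega>))"

definition girsanov_process ::
    "(real \<Rightarrow> 'a \<Rightarrow> real ^ 'n) \<Rightarrow> (real \<Rightarrow> real ^ 'n) \<Rightarrow> real \<Rightarrow> 'a \<Rightarrow> real ^ 'n" where
  "girsanov_process W \<theta> t \<omega> = W t \<omega> + (LINT s:{0..t}|lebesgue. \<theta> s)"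

definition equivalent_measures :: "'a measure \<Rightarrow> 'a measure \<Rightarrow> bool" where
  "equivalent_measures M N \<longleftrightarrow>
     sets M = sets N \<and> absolutely_continuous M N \<and> absolutely_continuous N M"

section \<open>Absence of arbitrage\<close>

text \<open>Integrability of the spot is demanded because \<open>real_cond_exp\<close> is the conditional
  expectation only for integrable random variables. \<open>F t u\<close> is the forward price at time \<open>t\<close> for
  maturity \<open>u\<close>.\<close>

definition arbitrage_free ::
    "'a measure \<Rightarrow> (real \<Rightarrow> 'a measure) \<Rightarrow> (real \<Rightarrow> 'a \<Rightarrow> real) \<Rightarrow>
      real set \<Rightarrow> (real \<Rightarrow> real \<Rightarrow> 'a \<Rightarrow> real) \<Rightarrow> bool" where
  "arbitrage_free Q \<F> S maturities F \<longleftrightarrow>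
     (\<forall>u\<in>maturities. integrable Q (S u) \<and>
        (\<forall>t\<in>{0..u}. AE \<omega> in Q. F t u \<omega> = real_cond_exp Q (\<F> t) (S u) \<omega>))"

end

theory Submission
  imports Defs "HOL-Complex_Analysis.Conformal_Mappings"
begin

text \<open>
  Integrals of step functions are combinations of independent Gaussian increments, so their exponential
  moments, also conditionally on the past, are explicit. In the \<open>L\<^sup>2\<close>-limit this makes the exponential
  of a Wiener integral, divided by its mean, a martingale. For the integrand
  \<open>- \<theta> + u 1\<^bsub>(s,t]\<^esub>\<close> this martingale property says that under \<open>Q\<close> the increment of \<open>W\<^sup>Q\<close> over
  \<open>(s,t]\<close> has, on each event of \<open>\<F> s\<close>, the moment generating function of \<open>N(0, (t - s) Id)\<close>, which is
  Girsanov's theorem. The theory of Wiener integrals then applies to \<open>W\<^sup>Q\<close> under \<open>Q\<close> as well: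
  the conditional expectation of \<open>S\<^sub>u\<close> given \<open>\<F> t\<close> is \<open>\<phi>\<^sub>Q u + \<integral>\<^sub>0\<^sup>t K(u,s) dW\<^sup>Q\<^sub>s\<close>, and
  comparing this with the dynamics under the original measure identifies the coefficients, because a Wiener integral
  that is almost surely constant is zero.
\<close>


section \<open>Square integrable functions\<close>

text \<open>A Wiener integral is one version picked by \<open>SOME\<close>, separately for every
  time, coordinate and measure, so two of them are comparable only up to null sets. The work is
  therefore done with the relation \<open>wiener_limit\<close>, which pairs an integrand with any
  L2-limit of elementary integrals; null sets contained in the filtration keep every version
  adapted. Two limits resist a direct argument. Exponentials are not continuous from L2 to L1, but
  \<open>exp (G / 2)\<close> is Cauchy in L2 because the mean of
  \<open>exp ((G m + G l) / 2)\<close> is explicit. And the density of \<open>Q\<close> may be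
  unbounded, so L2-convergence under the original measure does not give L2-convergence under
  \<open>Q\<close>; each limit is taken by the isometry of its own Brownian motion, and the two are
  identified along an almost surely convergent subsequence, the null sets being common. Since
  forward dynamics are given only before maturity, coefficients are compared on [0, t] with t < u,
  and the dynamics at u is recovered from the martingale.\<close>

lemma tendsto_zero_squeeze:
  fixes f g :: "nat \<Rightarrow> real"
  assumes "g \<longlonglongrightarrow> 0" "\<And>m. 0 \<le> f m" "\<And>m. f m \<le> g m"
  shows "f \<longlonglongrightarrow> 0"
  by (rule tendsto_sandwich[OF _ _ tendsto_const assms(1)]) (use assms in auto)

definition L2 :: "'a measure \<Rightarrow> ('a \<Rightarrow> 'b::euclidean_space) \<Rightarrow> bool" where
  "L2 M f \<longleftrightarrow> f \<in> borel_measurable M \<and> integrable M (\<lambda>x. (norm (f x))\<^sup>2)"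

abbreviation msq :: "'a measure \<Rightarrow> ('a \<Rightarrow> 'b::real_normed_vector) \<Rightarrow> real" where
  "msq M f \<equiv> \<integral>x. (norm (f x))\<^sup>2 \<partial>M"

text \<open>Cutting an integrand off at \<open>t\<close> instead of changing its domain keeps all
  integrals, whatever their time, on the one space [0, T].\<close>

abbreviation trunc :: "real \<Rightarrow> (real \<Rightarrow> 'b::real_vector) \<Rightarrow> real \<Rightarrow> 'b" where
  "trunc t f \<equiv> \<lambda>x. indicator {0..t} x *\<^sub>R f x"

lemma L2_measurable: "L2 M f \<Longrightarrow> f \<in> borel_measurable M"
  by (simp add: L2_def)

lemma L2_norm_sq_integrable: "L2 M f \<Longrightarrow> integrable M (\<lambda>x. (norm (f x))\<^sup>2)"
  by (simp add: L2_def)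

lemma L2_inner_integrable:
  fixes f g :: "'a \<Rightarrow> 'b::euclidean_space"
  assumes "L2 M f" "L2 M g"
  shows "integrable M (\<lambda>x. f x \<bullet> g x)"
proof (rule Bochner_Integration.integrable_bound[where f="\<lambda>x. (norm (f x))\<^sup>2 + (norm (g x))\<^sup>2"])
  have "\<bar>a \<bullet> b\<bar> \<le> (norm a)\<^sup>2 + (norm b)\<^sup>2" for a b :: 'b
  proof -
    have "\<bar>a \<bullet> b\<bar> \<le> norm a * norm b" by (rule Cauchy_Schwarz_ineq2)
    also have "\<dots> \<le> (norm a)\<^sup>2 + (norm b)\<^sup>2"
      using sum_squares_bound[of "norm a" "norm b"] mult_nonneg_nonneg[OF norm_ge_zero[of a] norm_ge_zero[of b]]
      by linarith
    finally show ?thesis .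
  qed
  then show "AE x in M. norm (f x \<bullet> g x) \<le> norm ((norm (f x))\<^sup>2 + (norm (g x))\<^sup>2)" by simp
qed (use assms in \<open>auto simp: L2_def\<close>)

lemma norm_add_sq: "(norm (a + b))\<^sup>2 = (norm a)\<^sup>2 + 2 * (a \<bullet> b) + (norm b)\<^sup>2"
  for a b :: "'b::real_inner"
  by (simp add: power2_norm_eq_inner algebra_simps inner_commute)

lemma L2_add:
  fixes f g :: "'a \<Rightarrow> 'b::euclidean_space"
  assumes "L2 M f" "L2 M g"
  shows "L2 M (\<lambda>x. f x + g x)"
  using assms L2_inner_integrable[OF assms] by (auto simp: L2_def norm_add_sq)

lemma L2_scaleR: "L2 M f \<Longrightarrow> L2 M (\<lambda>x. c *\<^sub>R f x)"
  by (auto simp: L2_def power_mult_distrib)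

lemma L2_scaleR_const:
  fixes f :: "'a \<Rightarrow> real"
  shows "L2 M f \<Longrightarrow> L2 M (\<lambda>x. f x *\<^sub>R c)"
  by (auto simp: L2_def power_mult_distrib)

lemma L2_diff:
  fixes f g :: "'a \<Rightarrow> 'b::euclidean_space"
  assumes "L2 M f" "L2 M g"
  shows "L2 M (\<lambda>x. f x - g x)"
  using L2_add[OF assms(1) L2_scaleR[OF assms(2), of "-1"]] by simp

lemma L2_zero: "L2 M (\<lambda>x. 0)"
  by (simp add: L2_def)

lemma L2_sum: "(\<And>i. i \<in> I \<Longrightarrow> L2 M (f i)) \<Longrightarrow> L2 M (\<lambda>x. \<Sum>i\<in>I. f i x)"
  by (induction I rule: infinite_finite_induct) (auto intro: L2_zero L2_add)

lemma (in finite_measure) L2_bounded: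
  assumes "f \<in> borel_measurable M" "\<And>x. x \<in> space M \<Longrightarrow> norm (f x) \<le> B"
  shows "L2 M f"
proof -
  have "integrable M (\<lambda>x. (norm (f x))\<^sup>2)"
    by (rule integrable_const_bound[where B="B\<^sup>2"]) (use assms in \<open>auto intro!: power_mono\<close>)
  then show ?thesis using assms by (simp add: L2_def)
qed

lemma (in finite_measure) L2_integrable:
  fixes f :: "'a \<Rightarrow> 'b::euclidean_space"
  assumes "L2 M f"
  shows "integrable M f"
proof -
  have "integrable M (\<lambda>x. norm (f x))"
    by (rule square_integrable_imp_integrable) (use assms in \<open>auto simp: L2_def\<close>)
  then show ?thesis using assms by (simp add: L2_def integrable_norm_iff)
qed

text \<open>The squared norm of \<open>f + l g\<close> is a nonnegative quadratic in
  \<open>l\<close>, and its value at the minimiser \<open>l = - <f,g> / |g|^2\<close> is the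
  inequality. If \<open>g\<close> has norm zero, the inner product vanishes as well.\<close>

lemma L2_Cauchy_Schwarz:
  fixes f g :: "'a \<Rightarrow> 'b::euclidean_space"
  assumes f: "L2 M f" and g: "L2 M g"
  shows "(\<integral>x. f x \<bullet> g x \<partial>M)\<^sup>2 \<le> msq M f * msq M g"
proof -
  let ?a = "\<integral>x. (norm (f x))\<^sup>2 \<partial>M" and ?b = "\<integral>x. f x \<bullet> g x \<partial>M" and ?c = "\<integral>x. (norm (g x))\<^sup>2 \<partial>M"
  have q: "0 \<le> ?a + 2 * l * ?b + l\<^sup>2 * ?c" for l
  proof -
    have "0 \<le> msq M (\<lambda>x. f x + l *\<^sub>R g x)" by simp
    also have "\<dots> = (\<integral>x. (norm (f x))\<^sup>2 + 2 * l * (f x \<bullet> g x) + l\<^sup>2 * (norm (g x))\<^sup>2 \<partial>M)"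
      by (simp add: norm_add_sq power_mult_distrib mult.assoc)
    also have "\<dots> = ?a + 2 * l * ?b + l\<^sup>2 * ?c"
      using L2_inner_integrable[OF f g] f g by (simp add: L2_def)
    finally show ?thesis .
  qed
  show ?thesis
  proof (cases "?c = 0")
    case True
    then have "AE x in M. (norm (g x))\<^sup>2 = 0"
      using g integral_nonneg_eq_0_iff_AE[of M "\<lambda>x. (norm (g x))\<^sup>2"] by (simp add: L2_def)
    then have "AE x in M. f x \<bullet> g x = 0" by eventually_elim auto
    then have "?b = 0" by (rule integral_eq_zero_AE)
    then show ?thesis using True by simp
  next
    case False
    then have c: "?c > 0" by (smt (verit) Bochner_Integration.integral_nonneg zero_le_power2)
    have "0 \<le> ?a + 2 * (- ?b / ?c) * ?b + (- ?b / ?c)\<^sup>2 * ?c" by (rule q)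
    also have "\<dots> = ?a - ?b\<^sup>2 / ?c" using c by (simp add: power2_eq_square field_simps)
    finally show ?thesis using c by (simp add: field_simps)
  qed
qed

section \<open>Mean-square convergence and completeness\<close>

definition L2lim :: "'a measure \<Rightarrow> (nat \<Rightarrow> 'a \<Rightarrow> 'b::euclidean_space) \<Rightarrow> ('a \<Rightarrow> 'b) \<Rightarrow> bool" where
  "L2lim M fs f \<longleftrightarrow> (\<forall>m. L2 M (fs m)) \<and> L2 M f \<and> (\<lambda>m. \<integral>x. (norm (fs m x - f x))\<^sup>2 \<partial>M) \<longlonglongrightarrow> 0"

lemma L2limD: assumes "L2lim M fs f"
  shows "L2 M (fs m)" "L2 M f" "(\<lambda>m. \<integral>x. (norm (fs m x - f x))\<^sup>2 \<partial>M) \<longlonglongrightarrow> 0"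
  using assms by (auto simp: L2lim_def)

lemma L2lim_const: "L2 M f \<Longrightarrow> L2lim M (\<lambda>_. f) f"
  by (simp add: L2lim_def)

lemma norm_add_sq_le: "(norm (a + b))\<^sup>2 \<le> 2 * (norm a)\<^sup>2 + 2 * (norm b)\<^sup>2"
  for a b :: "'b::real_inner"
proof -
  have "2 * (a \<bullet> b) \<le> (norm a)\<^sup>2 + (norm b)\<^sup>2"
    using zero_le_power2[of "norm (a - b)"] unfolding power2_norm_eq_inner
    by (simp add: algebra_simps inner_commute)
  then show ?thesis by (simp add: norm_add_sq)
qed

lemma L2_dist_add_le:
  fixes f g :: "'a \<Rightarrow> 'b::euclidean_space"
  assumes "L2 M f" "L2 M g"
  shows "msq M (\<lambda>x. f x + g x) \<le> 2 * msq M f + 2 * msq M g"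
proof -
  have "msq M (\<lambda>x. f x + g x) \<le> (\<integral>x. 2 * (norm (f x))\<^sup>2 + 2 * (norm (g x))\<^sup>2 \<partial>M)"
    using assms L2_add[OF assms] by (intro integral_mono norm_add_sq_le) (auto simp: L2_def)
  also have "\<dots> = 2 * msq M f + 2 * msq M g"
    using assms by (simp add: L2_def)
  finally show ?thesis .
qed

lemma L2_dist_triangle:
  fixes f g h :: "'a \<Rightarrow> 'b::euclidean_space"
  assumes "L2 M f" "L2 M g" "L2 M h"
  shows "msq M (\<lambda>x. f x - h x)
    \<le> 2 * msq M (\<lambda>x. f x - g x) + 2 * msq M (\<lambda>x. g x - h x)"
  using L2_dist_add_le[OF L2_diff[OF assms(1,2)] L2_diff[OF assms(2,3)]] by simp

lemma L2lim_add:
  fixes f g :: "'a \<Rightarrow> 'b::euclidean_space"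
  assumes f: "L2lim M fs f" and g: "L2lim M gs g"
  shows "L2lim M (\<lambda>m x. fs m x + gs m x) (\<lambda>x. f x + g x)"
  unfolding L2lim_def
proof (intro conjI allI L2_add)
  let ?d = "\<lambda>m. 2 * msq M (\<lambda>x. fs m x - f x) + 2 * msq M (\<lambda>x. gs m x - g x)"
  have "?d \<longlonglongrightarrow> 2 * 0 + 2 * 0" by (intro tendsto_intros L2limD(3)[OF f] L2limD(3)[OF g])
  then have d: "?d \<longlonglongrightarrow> 0" by simp
  have le: "msq M (\<lambda>x. fs m x + gs m x - (f x + g x)) \<le> ?d m" for m
    using L2_dist_add_le[OF L2_diff[OF L2limD(1,2)[OF f]] L2_diff[OF L2limD(1,2)[OF g]]]
    by (simp add: algebra_simps)
  show "(\<lambda>m. \<integral>x. (norm (fs m x + gs m x - (f x + g x)))\<^sup>2 \<partial>M) \<longlonglongrightarrow> 0"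
    by (rule tendsto_zero_squeeze[OF d _ le]) simp
qed (use L2limD[OF f] L2limD[OF g] in auto)

lemma L2lim_scaleR:
  assumes f: "L2lim M fs f"
  shows "L2lim M (\<lambda>m x. c *\<^sub>R fs m x) (\<lambda>x. c *\<^sub>R f x)"
  unfolding L2lim_def
proof (intro conjI allI L2_scaleR)
  have "(\<lambda>m. c\<^sup>2 * msq M (\<lambda>x. fs m x - f x)) \<longlonglongrightarrow> c\<^sup>2 * 0"
    by (intro tendsto_intros L2limD(3)[OF f])
  then show "(\<lambda>m. \<integral>x. (norm (c *\<^sub>R fs m x - c *\<^sub>R f x))\<^sup>2 \<partial>M) \<longlonglongrightarrow> 0"
    by (simp add: scaleR_diff_right[symmetric] power_mult_distrib)
qed (use L2limD[OF f] in auto)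

lemma L2lim_scaleR_const:
  fixes f :: "'a \<Rightarrow> real"
  assumes f: "L2lim M fs f"
  shows "L2lim M (\<lambda>m x. fs m x *\<^sub>R c) (\<lambda>x. f x *\<^sub>R c)"
  unfolding L2lim_def
proof (intro conjI allI L2_scaleR_const)
  have "(\<lambda>m. msq M (\<lambda>x. fs m x - f x) * (norm c)\<^sup>2) \<longlonglongrightarrow> 0 * (norm c)\<^sup>2"
    by (intro tendsto_intros L2limD(3)[OF f])
  then show "(\<lambda>m. \<integral>x. (norm (fs m x *\<^sub>R c - f x *\<^sub>R c))\<^sup>2 \<partial>M) \<longlonglongrightarrow> 0"
    by (simp add: scaleR_diff_left[symmetric] power_mult_distrib)
qed (use L2limD[OF f] in auto)

lemma L2lim_inner:
  fixes f g :: "'a \<Rightarrow> 'b::euclidean_space"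
  assumes f: "L2lim M fs f" and g: "L2 M g"
  shows "(\<lambda>m. \<integral>x. fs m x \<bullet> g x \<partial>M) \<longlonglongrightarrow> (\<integral>x. f x \<bullet> g x \<partial>M)"
proof -
  let ?d = "\<lambda>m. sqrt (msq M (\<lambda>x. fs m x - f x) * msq M g)"
  have "?d \<longlonglongrightarrow> sqrt (0 * msq M g)" by (intro tendsto_intros L2limD(3)[OF f])
  then have d: "?d \<longlonglongrightarrow> 0" by simp
  have "norm ((\<integral>x. fs m x \<bullet> g x \<partial>M) - (\<integral>x. f x \<bullet> g x \<partial>M)) \<le> ?d m * 1" for m
  proof -
    have "(\<integral>x. fs m x \<bullet> g x \<partial>M) - (\<integral>x. f x \<bullet> g x \<partial>M) = (\<integral>x. (fs m x - f x) \<bullet> g x \<partial>M)"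
      by (subst Bochner_Integration.integral_diff[symmetric])
        (auto intro!: L2_inner_integrable g L2limD[OF f] simp: inner_diff_left)
    moreover have "\<bar>\<integral>x. (fs m x - f x) \<bullet> g x \<partial>M\<bar> \<le> ?d m"
      using L2_Cauchy_Schwarz[OF L2_diff[OF L2limD(1,2)[OF f]] g] by (intro real_le_rsqrt) auto
    ultimately show ?thesis by simp
  qed
  then show ?thesis by (intro LIM_zero_cancel[OF tendsto_0_le[OF d, where K=1]] always_eventually) auto
qed

text \<open>Expanding \<open>|f_m|^2 = |f_m - f|^2 + 2 f_m . f - |f|^2\<close> leaves a term tending
  to zero and an inner product with the fixed \<open>f\<close>.\<close>

lemma L2lim_norm_sq:
  fixes f :: "'a \<Rightarrow> 'b::euclidean_space"
  assumes f: "L2lim M fs f"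
  shows "(\<lambda>m. \<integral>x. (norm (fs m x))\<^sup>2 \<partial>M) \<longlonglongrightarrow> (msq M f)"
proof -
  have eq: "msq M (fs m) =
      msq M (\<lambda>x. fs m x - f x) + 2 * (\<integral>x. fs m x \<bullet> f x \<partial>M) - msq M f" for m
  proof -
    have "msq M (fs m) = (\<integral>x. (norm (fs m x - f x))\<^sup>2 + 2 * (fs m x \<bullet> f x) - (norm (f x))\<^sup>2 \<partial>M)"
      by (intro Bochner_Integration.integral_cong refl) (simp add: power2_norm_eq_inner algebra_simps inner_commute)
    also have "\<dots> = msq M (\<lambda>x. fs m x - f x) + 2 * (\<integral>x. fs m x \<bullet> f x \<partial>M) - msq M f"
      using L2_inner_integrable[OF L2limD(1,2)[OF f], of m] L2limD[OF f]
        L2_diff[OF L2limD(1,2)[OF f], of m] by (simp add: L2_def)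
    finally show ?thesis .
  qed
  have "(\<lambda>m. msq M (\<lambda>x. fs m x - f x) + 2 * (\<integral>x. fs m x \<bullet> f x \<partial>M) - msq M f)
     \<longlonglongrightarrow> 0 + 2 * (\<integral>x. f x \<bullet> f x \<partial>M) - msq M f"
    by (intro tendsto_intros L2lim_inner[OF f] L2limD[OF f])
  then show ?thesis unfolding eq by (simp add: power2_norm_eq_inner)
qed

lemma (in finite_measure) L1_le_L2:
  fixes f :: "'a \<Rightarrow> 'b::euclidean_space"
  assumes f: "L2 M f"
  shows "(\<integral>x. norm (f x) \<partial>M) \<le> sqrt (msq M f * measure M (space M))"
proof (rule real_le_rsqrt)
  have "L2 M (\<lambda>x. norm (f x))" using f measurable_compose[OF L2_measurable[OF f] borel_measurable_norm] by (simp add: L2_def)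
  moreover have "L2 M (\<lambda>x. 1::real)" by (simp add: L2_def)
  ultimately show "(\<integral>x. norm (f x) \<partial>M)\<^sup>2 \<le> msq M f * measure M (space M)"
    using L2_Cauchy_Schwarz[of M "\<lambda>x. norm (f x)" "\<lambda>x. 1"] by simp
qed

lemma (in finite_measure) L2lim_AE_subseq:
  fixes f :: "'a \<Rightarrow> 'b::euclidean_space"
  assumes f: "L2lim M fs f"
  obtains r :: "nat \<Rightarrow> nat" where "strict_mono r" "AE x in M. (\<lambda>m. fs (r m) x) \<longlonglongrightarrow> f x"
proof -
  have d: "L2 M (\<lambda>x. fs m x - f x)" for m by (rule L2_diff[OF L2limD(1,2)[OF f]])
  let ?d = "\<lambda>m. sqrt (msq M (\<lambda>x. fs m x - f x) * measure M (space M))"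
  have "?d \<longlonglongrightarrow> sqrt (0 * measure M (space M))" by (intro tendsto_intros L2limD(3)[OF f])
  then have "?d \<longlonglongrightarrow> 0" by simp
  then have "(\<lambda>m. \<integral>x. norm (fs m x - f x) \<partial>M) \<longlonglongrightarrow> 0"
    by (rule tendsto_zero_squeeze[OF _ _ L1_le_L2[OF d]]) simp_all
  then obtain r :: "nat \<Rightarrow> nat" where "strict_mono r" "AE x in M. (\<lambda>m. fs (r m) x - f x) \<longlonglongrightarrow> 0"
    using tendsto_L1_AE_subseq[of M "\<lambda>m x. fs m x - f x"] L2_integrable[OF d] by auto
  then show ?thesis using that[of r] by (auto simp: LIM_zero_iff)
qed

lemma L2lim_subseq: "L2lim M fs f \<Longrightarrow> strict_mono r \<Longrightarrow> L2lim M (\<lambda>m. fs (r m)) f"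
  unfolding L2lim_def using LIMSEQ_subseq_LIMSEQ[of "\<lambda>m. \<integral>x. (norm (fs m x - f x))\<^sup>2 \<partial>M" 0 r]
  by (auto simp: o_def)

text \<open>Fatou's lemma turns smallness of \<open>f m - f l\<close> for large \<open>m, l\<close> into \<open>L\<^sup>2\<close>-convergence to any
  almost sure limit.\<close>

lemma L2lim_of_Cauchy_AE:
  fixes f :: "'a \<Rightarrow> 'b::euclidean_space"
  assumes fs: "\<And>m. L2 M (fs m)" and [measurable]: "f \<in> borel_measurable M"
    and C: "\<And>e. e > 0 \<Longrightarrow> \<exists>N. \<forall>m\<ge>N. \<forall>l\<ge>N. msq M (\<lambda>x. fs m x - fs l x) < e"
    and r: "strict_mono r" and lim: "AE x in M. (\<lambda>m. fs (r m) x) \<longlonglongrightarrow> f x"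
  shows "L2lim M fs f"
proof -
  note [measurable] = L2_measurable[OF fs]
  have bnd: "(\<integral>\<^sup>+x. ennreal ((norm (fs m x - f x))\<^sup>2) \<partial>M) \<le> ennreal e"
    if N: "\<forall>m\<ge>N. \<forall>l\<ge>N. msq M (\<lambda>x. fs m x - fs l x) < e" "m \<ge> N" for m N e
  proof -
    have "(\<integral>\<^sup>+x. ennreal ((norm (fs m x - f x))\<^sup>2) \<partial>M)
        = (\<integral>\<^sup>+x. liminf (\<lambda>l. ennreal ((norm (fs m x - fs (r l) x))\<^sup>2)) \<partial>M)"
    proof (rule nn_integral_cong_AE, use lim in eventually_elim)
      fix x assume "(\<lambda>m. fs (r m) x) \<longlonglongrightarrow> f x"
      then have "(\<lambda>l. ennreal ((norm (fs m x - fs (r l) x))\<^sup>2)) \<longlonglongrightarrow> ennreal ((norm (fs m x - f x))\<^sup>2)"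
        by (intro tendsto_intros tendsto_ennrealI)
      then show "ennreal ((norm (fs m x - f x))\<^sup>2) = liminf (\<lambda>l. ennreal ((norm (fs m x - fs (r l) x))\<^sup>2))"
        using lim_imp_Liminf[OF sequentially_bot] by metis
    qed
    also have "\<dots> \<le> liminf (\<lambda>l. \<integral>\<^sup>+x. ennreal ((norm (fs m x - fs (r l) x))\<^sup>2) \<partial>M)"
      by (rule nn_integral_liminf) simp
    also have "\<dots> \<le> ennreal e"
    proof (rule order_trans[OF Liminf_mono[of _ "\<lambda>_. ennreal e"]],
        rule eventually_mono[OF eventually_ge_at_top[of N]])
      fix l assume "N \<le> l"
      then have "N \<le> r l" using seq_suble[OF r, of l] by linarith
      then have "msq M (\<lambda>x. fs m x - fs (r l) x) < e" using N by auto
      moreover have "integrable M (\<lambda>x. (norm (fs m x - fs (r l) x))\<^sup>2)"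
        using L2_diff[OF fs fs] by (auto simp: L2_def)
      ultimately show "(\<integral>\<^sup>+x. ennreal ((norm (fs m x - fs (r l) x))\<^sup>2) \<partial>M) \<le> ennreal e"
        by (subst nn_integral_eq_integral) (auto intro: ennreal_leI)
    qed (simp add: Liminf_const)
    finally show ?thesis .
  qed
  have d: "L2 M (\<lambda>x. fs m x - f x)" if N: "\<forall>m\<ge>N. \<forall>l\<ge>N. msq M (\<lambda>x. fs m x - fs l x) < e" "m \<ge> N" for m N e
    using bnd[OF N] unfolding L2_def
    by (auto simp: integrable_iff_bounded intro: le_less_trans ennreal_less_top)
  obtain N where N: "\<forall>m\<ge>N. \<forall>l\<ge>N. msq M (\<lambda>x. fs m x - fs l x) < 1" using C[of 1] by auto
  have f: "L2 M f" using L2_diff[OF fs[of N] d[OF N order_refl]] by simp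
  have "(\<lambda>m. \<integral>x. (norm (fs m x - f x))\<^sup>2 \<partial>M) \<longlonglongrightarrow> 0"
  proof (rule LIMSEQ_I)
    fix e :: real assume e: "0 < e"
    obtain N where N: "\<forall>m\<ge>N. \<forall>l\<ge>N. msq M (\<lambda>x. fs m x - fs l x) < e/2" using C[of "e/2"] e by auto
    have "norm (msq M (\<lambda>x. fs m x - f x) - 0) < e" if "m \<ge> N" for m
    proof -
      have "ennreal (msq M (\<lambda>x. fs m x - f x)) \<le> ennreal (e/2)"
        using bnd[OF N that] d[OF N that] by (subst (asm) nn_integral_eq_integral) (auto simp: L2_def)
      then show ?thesis using e by (simp add: ennreal_le_iff)
    qed
    then show "\<exists>N. \<forall>m\<ge>N. norm (msq M (\<lambda>x. fs m x - f x) - 0) < e" by blast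
  qed
  then show ?thesis using fs f by (simp add: L2lim_def)
qed

text \<open>Riesz-Fischer on a finite measure: an L2-Cauchy sequence is L1-Cauchy, so a subsequence
  converges almost everywhere, and Fatou upgrades this to L2-convergence of the whole
  sequence.\<close>

lemma (in finite_measure) L2_complete:
  fixes fs :: "nat \<Rightarrow> 'a \<Rightarrow> 'b::euclidean_space"
  assumes fs: "\<And>m. L2 M (fs m)"
    and C: "\<And>e. e > 0 \<Longrightarrow> \<exists>N. \<forall>m\<ge>N. \<forall>l\<ge>N. msq M (\<lambda>x. fs m x - fs l x) < e"
  obtains f where "L2lim M fs f"
proof -
  note [measurable] = L2_measurable[OF fs]
  have "\<exists>N. \<forall>i\<ge>N. \<forall>j\<ge>N. LINT x|M. norm (fs i x - fs j x) < e" if e: "e > 0" for e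
  proof -
    \<comment> \<open>One is added to the total mass so that division by it is safe for the zero
      measure too.\<close>
    define \<mu> where "\<mu> = measure M (space M) + 1"
    have \<mu>: "\<mu> > 0" "measure M (space M) < \<mu>" by (simp_all add: \<mu>_def add_nonneg_pos)
    obtain N where N: "\<forall>m\<ge>N. \<forall>l\<ge>N. msq M (\<lambda>x. fs m x - fs l x) < e\<^sup>2 / \<mu>"
      using C[of "e\<^sup>2 / \<mu>"] e \<mu> by auto
    have "LINT x|M. norm (fs i x - fs j x) < e" if "i \<ge> N" "j \<ge> N" for i j
    proof -
      have "LINT x|M. norm (fs i x - fs j x) \<le> sqrt (msq M (\<lambda>x. fs i x - fs j x) * measure M (space M))"
        by (rule L1_le_L2[OF L2_diff[OF fs fs]])
      also have "\<dots> \<le> sqrt (msq M (\<lambda>x. fs i x - fs j x) * \<mu>)"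
        using \<mu> by (intro real_sqrt_le_mono mult_left_mono) auto
      also have "\<dots> < sqrt (e\<^sup>2 / \<mu> * \<mu>)"
        using N that \<mu> by (intro real_sqrt_less_mono mult_strict_right_mono) auto
      also have "\<dots> = e" using e \<mu> by simp
      finally show ?thesis .
    qed
    then show ?thesis by blast
  qed
  then obtain r where r: "strict_mono r" "AE x in M. Cauchy (\<lambda>i. fs (r i) x)"
    using cauchy_L1_AE_cauchy_subseq[of M fs] L2_integrable[OF fs] by blast
  define f where "f x = lim (\<lambda>i. fs (r i) x)" for x
  have [measurable]: "f \<in> borel_measurable M" unfolding f_def[abs_def] by (rule borel_measurable_lim_metric) simp
  have "AE x in M. (\<lambda>i. fs (r i) x) \<longlonglongrightarrow> f x"
    using r(2) by eventually_elim (auto simp: f_def Cauchy_convergent_iff convergent_LIMSEQ_iff)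
  then show ?thesis using that[of f] L2lim_of_Cauchy_AE[OF fs _ C r(1)] by simp
qed

lemma L2lim_Cauchy:
  assumes f: "L2lim M fs f" and e: "e > 0"
  shows "\<exists>N. \<forall>m\<ge>N. \<forall>l\<ge>N. msq M (\<lambda>x. fs m x - fs l x) < e"
proof -
  obtain N where N: "\<And>m. m \<ge> N \<Longrightarrow> (msq M (\<lambda>x. fs m x - f x)) < e / 4"
    using order_tendstoD(2)[OF L2limD(3)[OF f], of "e/4"] e by (auto simp: eventually_sequentially)
  have "msq M (\<lambda>x. fs m x - fs l x) < e" if "m \<ge> N" "l \<ge> N" for m l
    using L2_dist_triangle[OF L2limD(1,2,1)[OF f], of m l] N[OF that(1)] N[OF that(2)]
    by (simp add: norm_minus_commute)
  then show ?thesis by blast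
qed

lemma L2lim_nn_iff:
  fixes f :: "'a \<Rightarrow> 'b::euclidean_space"
  assumes "\<And>m. L2 M (fs m)" "L2 M f"
  shows "L2lim M fs f \<longleftrightarrow> (\<lambda>m. \<integral>\<^sup>+x. ennreal ((norm (fs m x - f x))\<^sup>2) \<partial>M) \<longlonglongrightarrow> 0"
proof -
  have "(\<integral>\<^sup>+x. ennreal ((norm (fs m x - f x))\<^sup>2) \<partial>M) = ennreal (msq M (\<lambda>x. fs m x - f x))" for m
    using L2_diff[OF assms(1,2)] by (intro nn_integral_eq_integral) (auto simp: L2_def)
  then show ?thesis using assms tendsto_ennreal_iff[of "\<lambda>m. \<integral>x. (norm (fs m x - f x))\<^sup>2 \<partial>M" sequentially 0]
    by (simp add: L2lim_def)
qed

section \<open>Step functions are dense\<close>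

lemma lebesgue_on_finite: "finite_measure (lebesgue_on {0..t::real})"
  by (rule finite_measureI) (simp add: emeasure_restrict_space emeasure_lborel_Icc_eq)

lemma L2_lebesgue_on_iff: "L2 (lebesgue_on {0..t}) f \<longleftrightarrow> square_integrable_on f {0..t::real}"
  by (simp add: L2_def square_integrable_on_def set_borel_measurable_def set_integrable_def
      borel_measurable_restrict_space_iff integrable_restrict_space)

text \<open>Rounding \<open>s\<close> up to the grid: the cell (t k / N, t (k + 1) / N] carries the
  value of \<open>g\<close> at its right end. The point 0 lies in no cell, hence
  \<open>0 < s\<close>.\<close>

lemma step_function_at:
  fixes g :: "real \<Rightarrow> real"
  assumes t: "0 < t" and s: "0 < s" "s \<le> t"
  shows "step_function (\<lambda>k. t * real k / real (Suc n)) (\<lambda>k. g (t * real (Suc k) / real (Suc n))) (Suc n) s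
     = g (t * real_of_int \<lceil>s * real (Suc n) / t\<rceil> / real (Suc n))"
proof -
  define N where "N = Suc n"
  have N: "real N > 0" by (simp add: N_def)
  define k0 where "k0 = nat \<lceil>s * real N / t\<rceil> - 1"
  have pos: "\<lceil>s * real N / t\<rceil> > 0" using t s N by simp
  have k0: "real (Suc k0) = real_of_int \<lceil>s * real N / t\<rceil>" using pos by (simp add: k0_def)
  have "s * real N / t \<le> real N" using t s N by (simp add: field_simps)
  then have "\<lceil>s * real N / t\<rceil> \<le> int N" by (simp add: ceiling_le_iff)
  then have k0N: "k0 < N" using k0 by linarith
  have iff: "s \<in> {t * real k / real N <.. t * real (Suc k) / real N} \<longleftrightarrow> k = k0" for k
  proof -
    have "s \<in> {t * real k / real N <.. t * real (Suc k) / real N} \<longleftrightarrow>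
        real k < s * real N / t \<and> s * real N / t \<le> real (Suc k)"
      using t N by (auto simp: field_simps)
    also have "\<dots> \<longleftrightarrow> \<lceil>s * real N / t\<rceil> = int (Suc k)" by (auto simp: ceiling_eq_iff)
    also have "\<dots> \<longleftrightarrow> k = k0" using k0 by linarith
    finally show ?thesis .
  qed
  have "step_function (\<lambda>k. t * real k / real N) (\<lambda>k. g (t * real (Suc k) / real N)) N s
      = (\<Sum>k<N. if k = k0 then g (t * real (Suc k) / real N) else 0)"
    unfolding step_function_def using iff by (intro sum.cong refl) (auto simp: indicator_def)
  also have "\<dots> = g (t * real (Suc k0) / real N)" using k0N by simp
  finally show ?thesis by (simp only: k0 N_def)
qed

text \<open>The bound is on the squared distance. The nodes obey the same constraints as in
  \<open>has_wiener_integral\<close>, so that witnesses can be reused there.\<close>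

definition step_dist :: "real \<Rightarrow> (real \<Rightarrow> real) \<Rightarrow> real \<Rightarrow> bool" where
  "step_dist t f e \<longleftrightarrow> (\<exists>p c N. (\<forall>k\<le>N. p k \<in> {0..t}) \<and> (\<forall>k<N. p k \<le> p (Suc k)) \<and>
     msq (lebesgue_on {0..t}) (\<lambda>s. f s - step_function p c N s) < e)"

lemma step_function_measurable [measurable]: "step_function p c N \<in> borel_measurable borel"
  unfolding step_function_def[abs_def] by measurable

lemma borel_lebesgue_on: "f \<in> borel_measurable borel \<Longrightarrow> f \<in> borel_measurable (lebesgue_on A)"
  by (intro measurable_restrict_space1 measurable_completion) simp

lemma step_function_L2: "L2 (lebesgue_on {0..t}) (step_function p c N)"
proof (rule finite_measure.L2_bounded[OF lebesgue_on_finite borel_lebesgue_on])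
  show "norm (step_function p c N s) \<le> (\<Sum>k<N. \<bar>c k\<bar>)" for s
    unfolding step_function_def real_norm_def
    by (intro order_trans[OF sum_abs] sum_mono) (auto simp: indicator_def)
qed simp

lemma dominated_L2_approx:
  fixes f :: "'a \<Rightarrow> real"
  assumes f: "f \<in> borel_measurable M" and h: "\<And>n. h n \<in> borel_measurable M" and g: "integrable M g"
    and conv: "AE s in M. (\<lambda>n. h n s) \<longlonglongrightarrow> f s"
    and dom: "\<And>n. AE s in M. (f s - h n s)\<^sup>2 \<le> g s" and e: "0 < e"
  obtains n where "msq M (\<lambda>s. f s - h n s) < (e :: real)"
proof -
  have "(\<lambda>n. \<integral>s. (norm (f s - h n s))\<^sup>2 \<partial>M) \<longlonglongrightarrow> (\<integral>s. 0 \<partial>M)"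
  proof (rule integral_dominated_convergence[OF _ _ g])
    show "AE s in M. (\<lambda>n. (norm (f s - h n s))\<^sup>2) \<longlonglongrightarrow> 0"
      using conv
    proof eventually_elim
      case (elim s)
      have "(\<lambda>n. (norm (f s - h n s))\<^sup>2) \<longlonglongrightarrow> (norm (f s - f s))\<^sup>2" by (intro tendsto_intros elim)
      then show ?case by simp
    qed
  qed (use f h dom in simp_all)
  then have "eventually (\<lambda>n. msq M (\<lambda>s. f s - h n s) < e) sequentially"
    using e by (intro order_tendstoD(2)) auto
  then show ?thesis using that by (auto simp: eventually_sequentially)
qed

text \<open>Values on the uniform grid converge pointwise by continuity and stay below
  \<open>B\<close>, so dominated convergence applies.\<close>

lemma step_dist_continuous:
  assumes t: "0 < t" and g: "continuous_on UNIV g" and B: "\<And>s. \<bar>g s\<bar> \<le> B" and e: "e > 0"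
  shows "step_dist t g e"
proof -
  interpret finite_measure "lebesgue_on {0..t}" by (rule lebesgue_on_finite)
  let ?st = "\<lambda>n. step_function (\<lambda>k. t * real k / real (Suc n)) (\<lambda>k. g (t * real (Suc k) / real (Suc n))) (Suc n)"
  have gm: "g \<in> borel_measurable (lebesgue_on {0..t})"
    by (rule borel_lebesgue_on) (rule borel_measurable_continuous_onI[OF g])
  have sm: "?st n \<in> borel_measurable (lebesgue_on {0..t})" for n
    by (rule borel_lebesgue_on) simp
  have ae: "AE s in lebesgue_on {0..t}. s \<in> {0<..t}"
    using AE_lborel_singleton[of 0] by (auto simp: AE_restrict_space_iff elim!: eventually_mono intro!: AE_completion)
  have conv: "(\<lambda>n. ?st n s) \<longlonglongrightarrow> g s" if s: "s \<in> {0<..t}" for s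
  proof -
    have "(\<lambda>n. t * real_of_int \<lceil>s * real (Suc n) / t\<rceil> / real (Suc n) - s) \<longlonglongrightarrow> 0"
    proof (rule tendsto_zero_squeeze)
      have "(\<lambda>n. t * inverse (real (Suc n))) \<longlonglongrightarrow> t * 0"
        by (intro tendsto_intros LIMSEQ_inverse_real_of_nat)
      then show "(\<lambda>n. t / real (Suc n)) \<longlonglongrightarrow> 0" by (simp add: divide_inverse)
      fix n
      have "s * real (Suc n) / t \<le> real_of_int \<lceil>s * real (Suc n) / t\<rceil>" by (rule le_of_int_ceiling)
      then have "s * real (Suc n) \<le> t * real_of_int \<lceil>s * real (Suc n) / t\<rceil>"
        using mult_left_mono[OF le_of_int_ceiling[of "s * real (Suc n) / t"], of t] t by simp
      then show "0 \<le> t * real_of_int \<lceil>s * real (Suc n) / t\<rceil> / real (Suc n) - s"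
        by (simp add: pos_le_divide_eq)
      have "real_of_int \<lceil>s * real (Suc n) / t\<rceil> \<le> s * real (Suc n) / t + 1" by (rule of_int_ceiling_le_add_one)
      then have "t * real_of_int \<lceil>s * real (Suc n) / t\<rceil> \<le> t * (s * real (Suc n) / t + 1)"
        using t by (intro mult_left_mono) auto
      also have "\<dots> = s * real (Suc n) + t" using t by (simp add: field_simps)
      finally have "t * real_of_int \<lceil>s * real (Suc n) / t\<rceil> / real (Suc n) \<le> (s * real (Suc n) + t) / real (Suc n)"
        by (intro divide_right_mono) auto
      then show "t * real_of_int \<lceil>s * real (Suc n) / t\<rceil> / real (Suc n) - s \<le> t / real (Suc n)"
        by (simp add: add_divide_distrib)
    qed
    then have "(\<lambda>n. t * real_of_int \<lceil>s * real (Suc n) / t\<rceil> / real (Suc n)) \<longlonglongrightarrow> s"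
      by (rule LIM_zero_cancel)
    then have "(\<lambda>n. g (t * real_of_int \<lceil>s * real (Suc n) / t\<rceil> / real (Suc n))) \<longlonglongrightarrow> g s"
      by (rule isCont_tendsto_compose[rotated]) (use g in \<open>simp add: continuous_on_eq_continuous_at\<close>)
    then show ?thesis using step_function_at[OF t, where g=g and s=s] s by simp
  qed
  have bst: "\<bar>?st n s\<bar> \<le> B" if s: "s \<in> {0<..t}" for n s
    using step_function_at[OF t, where g=g and s=s] s B by simp
  obtain n where n: "msq (lebesgue_on {0..t}) (\<lambda>s. g s - ?st n s) < e"
  proof (rule dominated_L2_approx[OF gm sm _ _ _ e])
    show "integrable (lebesgue_on {0..t}) (\<lambda>s. (2 * B)\<^sup>2)" by simp
    show "AE s in lebesgue_on {0..t}. (\<lambda>n. ?st n s) \<longlonglongrightarrow> g s" using ae by eventually_elim (rule conv)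
    show "AE s in lebesgue_on {0..t}. (g s - ?st n s)\<^sup>2 \<le> (2 * B)\<^sup>2" for n
      using ae
    proof eventually_elim
      case (elim s)
      have "\<bar>g s - ?st n s\<bar> \<le> \<bar>2 * B\<bar>" using B[of s] bst[OF elim, of n] by linarith
      then show ?case by (simp only: abs_le_square_iff)
    qed
  qed (rule that)
  show ?thesis unfolding step_dist_def
  proof (intro exI conjI allI impI)
    show "t * real k / real (Suc n) \<in> {0..t}" if "k \<le> Suc n" for k
      using that t by (auto simp: pos_divide_le_eq)
    show "t * real k / real (Suc n) \<le> t * real (Suc k) / real (Suc n)" for k
      using t by (intro divide_right_mono mult_left_mono) auto
  qed (rule n)
qed

text \<open>Squared distances satisfy only \<open>|a + b|^2 <= 2 |a|^2 + 2 |b|^2\<close>, hence the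
  quarters.\<close>

lemma step_dist_L2_close:
  assumes f: "L2 (lebesgue_on {0..t}) f" and g: "L2 (lebesgue_on {0..t}) g"
    and d: "msq (lebesgue_on {0..t}) (\<lambda>s. f s - g s) < e / 4" and s: "step_dist t g (e / 4)"
  shows "step_dist t f e"
proof -
  obtain p c N where p: "\<forall>k\<le>N. p k \<in> {0..t}" "\<forall>k<N. p k \<le> p (Suc k)"
    "msq (lebesgue_on {0..t}) (\<lambda>s. g s - step_function p c N s) < e / 4"
    using s unfolding step_dist_def by auto
  have "msq (lebesgue_on {0..t}) (\<lambda>s. f s - step_function p c N s) < e"
    using L2_dist_triangle[OF f g step_function_L2, of p c N] d p(3) by linarith
  then show ?thesis using p unfolding step_dist_def by blast
qed

text \<open>A measurable function is an almost everywhere limit of continuous ones; clipping these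
  at the bound of \<open>f\<close> supplies a dominating constant without affecting the
  limit.\<close>

lemma step_dist_bounded:
  assumes t: "0 < t" and f: "f \<in> borel_measurable (lebesgue_on {0..t})" and B: "\<And>s. \<bar>f s\<bar> \<le> B" and e: "e > 0"
  shows "step_dist t f e"
proof -
  interpret finite_measure "lebesgue_on {0..t}" by (rule lebesgue_on_finite)
  have "f measurable_on {0..t}" using f by (simp add: measurable_on_iff_borel_measurable)
  then obtain N g where N: "negligible N" and g: "\<And>n. continuous_on UNIV (g n)"
    and conv: "\<And>x. x \<notin> N \<Longrightarrow> (\<lambda>n. g n x) \<longlonglongrightarrow> (if x \<in> {0..t} then f x else 0)"
    unfolding measurable_on_def by (auto intro: that)
  define h where "h n x = max (- B) (min B (g n x))" for n x
  have h: "continuous_on UNIV (h n)" for n unfolding h_def[abs_def] by (intro continuous_intros g)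
  have B0: "0 \<le> B" using B[of 0] by linarith
  have hB: "\<bar>h n s\<bar> \<le> B" for n s using B0 by (auto simp: h_def)
  have hm: "h n \<in> borel_measurable (lebesgue_on {0..t})" for n
    by (rule borel_lebesgue_on) (rule borel_measurable_continuous_onI[OF h])
  have "AE x in lebesgue. x \<notin> N" using N by (simp add: negligible_iff_null_sets AE_not_in)
  then have "AE x in lebesgue. x \<in> {0..t} \<longrightarrow> (\<lambda>n. h n x) \<longlonglongrightarrow> f x"
  proof (eventually_elim, intro impI)
    fix x assume "x \<notin> N" "x \<in> {0..t}"
    then have "(\<lambda>n. h n x) \<longlonglongrightarrow> max (- B) (min B (f x))"
      unfolding h_def using conv[of x] by (intro tendsto_intros) auto
    then show "(\<lambda>n. h n x) \<longlonglongrightarrow> f x" using B[of x] by (simp add: max_def min_def split: if_splits)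
  qed
  then have ae: "AE x in lebesgue_on {0..t}. (\<lambda>n. h n x) \<longlonglongrightarrow> f x" by (simp add: AE_restrict_space_iff)
  obtain n where n: "msq (lebesgue_on {0..t}) (\<lambda>s. f s - h n s) < e / 4"
  proof (rule dominated_L2_approx[where e="e / 4", OF f hm _ ae])
    show "integrable (lebesgue_on {0..t}) (\<lambda>s. (2 * B)\<^sup>2)" by simp
    show "AE s in lebesgue_on {0..t}. (f s - h n s)\<^sup>2 \<le> (2 * B)\<^sup>2" for n
    proof (intro AE_I2)
      fix s
      have "\<bar>f s - h n s\<bar> \<le> \<bar>2 * B\<bar>" using B[of s] hB[of n s] by linarith
      then show "(f s - h n s)\<^sup>2 \<le> (2 * B)\<^sup>2" by (simp only: abs_le_square_iff)
    qed
  qed (use e that in auto)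
  show ?thesis
    by (rule step_dist_L2_close[OF L2_bounded[OF f] L2_bounded[OF hm] n step_dist_continuous[OF t h hB]])
      (use B hB e in auto)
qed

text \<open>Clipping \<open>f\<close> at level \<open>n\<close> reduces to bounded functions, with
  \<open>|f|^2\<close> itself as dominating function.\<close>

lemma step_functions_dense:
  assumes t: "0 \<le> t" and f: "L2 (lebesgue_on {0..t}) f" and e: "e > 0"
  shows "step_dist t f e"
proof (cases "t = 0")
  case True
  \<comment> \<open>On a degenerate interval every function is null, so the empty step function will
    do.\<close>
  have "msq (lebesgue_on {0..t}) (\<lambda>s. f s - step_function (\<lambda>_. 0) (\<lambda>_. 0) 0 s) = 0"
    by (rule integral_eq_zero_null_sets) (simp_all add: True null_sets_def emeasure_restrict_space)
  then show ?thesis using e t unfolding step_dist_def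
    by (intro exI[of _ "\<lambda>_. 0"] exI[of _ "0::nat"]) auto
next
  case False
  interpret finite_measure "lebesgue_on {0..t}" by (rule lebesgue_on_finite)
  define h where "h n x = max (- real n) (min (real n) (f x))" for n x
  note fm = L2_measurable[OF f]
  have hm: "h n \<in> borel_measurable (lebesgue_on {0..t})" for n
    unfolding h_def[abs_def] using fm by measurable
  have hB: "\<bar>h n s\<bar> \<le> real n" for n s by (auto simp: h_def)
  obtain n where n: "msq (lebesgue_on {0..t}) (\<lambda>s. f s - h n s) < e / 4"
  proof (rule dominated_L2_approx[where e="e / 4", OF fm hm L2_norm_sq_integrable[OF f]])
    show "AE s in lebesgue_on {0..t}. (\<lambda>n. h n s) \<longlonglongrightarrow> f s"
    proof (intro AE_I2)
      fix s
      obtain N :: nat where N: "\<bar>f s\<bar> \<le> real N" using real_arch_simple by blast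
      show "(\<lambda>n. h n s) \<longlonglongrightarrow> f s"
      proof (rule tendsto_eventually, rule eventually_mono[OF eventually_ge_at_top[of N]])
        fix n assume "N \<le> n"
        then have "\<bar>f s\<bar> \<le> real n" using N by linarith
        then show "h n s = f s" by (auto simp: h_def max_def min_def)
      qed
    qed
    show "AE s in lebesgue_on {0..t}. (f s - h n s)\<^sup>2 \<le> (norm (f s))\<^sup>2" for n
    proof (intro AE_I2)
      fix s
      have "\<bar>f s - h n s\<bar> \<le> \<bar>f s\<bar>" by (auto simp: h_def max_def min_def)
      then show "(f s - h n s)\<^sup>2 \<le> (norm (f s))\<^sup>2" by (simp add: abs_le_square_iff)
    qed
  qed (use e that in auto)
  have "step_dist t (h n) (e/4)" using False t e hB by (intro step_dist_bounded[OF _ hm]) auto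
  moreover have "L2 (lebesgue_on {0..t}) (h n)" by (rule L2_bounded[OF hm, where B="real n"]) (simp add: hB)
  ultimately show ?thesis using step_dist_L2_close[OF f _ n] by blast
qed

section \<open>Moment generating functions of normal distributions\<close>

text \<open>Completing the square: tilting by \<open>exp (u x)\<close> moves the centre of the
  density to \<open>u \<sigma>^2\<close> and multiplies it by
  \<open>exp (u^2 \<sigma>^2 / 2)\<close>.\<close>

lemma mgf_normal:
  assumes \<sigma>: "0 < \<sigma>"
  shows "integrable lborel (\<lambda>x. normal_density 0 \<sigma> x * exp (u * x))"
    and "(\<integral>x. normal_density 0 \<sigma> x * exp (u * x) \<partial>lborel) = exp (u\<^sup>2 * \<sigma>\<^sup>2 / 2)"
proof -
  have eq: "normal_density 0 \<sigma> x * exp (u * x) = exp (u\<^sup>2 * \<sigma>\<^sup>2 / 2) * normal_density (u * \<sigma>\<^sup>2) \<sigma> x" for x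
  proof -
    have "- (x\<^sup>2) / (2 * \<sigma>\<^sup>2) + u * x = u\<^sup>2 * \<sigma>\<^sup>2 / 2 + - ((x - u * \<sigma>\<^sup>2)\<^sup>2) / (2 * \<sigma>\<^sup>2)"
      using \<sigma> by (simp add: field_simps power2_eq_square)
    then have "exp (- (x\<^sup>2) / (2 * \<sigma>\<^sup>2)) * exp (u * x) = exp (u\<^sup>2 * \<sigma>\<^sup>2 / 2) * exp (- ((x - u * \<sigma>\<^sup>2)\<^sup>2) / (2 * \<sigma>\<^sup>2))"
      by (simp only: exp_add[symmetric])
    then show ?thesis by (simp add: normal_density_def)
  qed
  show "integrable lborel (\<lambda>x. normal_density 0 \<sigma> x * exp (u * x))"
    unfolding eq using \<sigma> by (intro integrable_mult_right integrable_normal_density)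
  show "(\<integral>x. normal_density 0 \<sigma> x * exp (u * x) \<partial>lborel) = exp (u\<^sup>2 * \<sigma>\<^sup>2 / 2)"
    unfolding eq using \<sigma> by (simp add: integral_normal_density)
qed

text \<open>The moment generating function extends to an entire function, so its values on the real axis
  determine the characteristic function.\<close>

lemma char_of_gaussian_mgf:
  assumes "real_distribution \<nu>"
    and int: "\<And>u. integrable \<nu> (\<lambda>x. exp (u * x))"
    and mgf: "\<And>u. (\<integral>x. exp (u * x) \<partial>\<nu>) = exp (u\<^sup>2 * \<delta> / 2)"
  shows "char \<nu> t = exp (- complex_of_real (t\<^sup>2 * \<delta> / 2))"
proof -
  interpret real_distribution \<nu> by fact
  define f where "f z = (\<integral>x. exp (z * complex_of_real x) \<partial>\<nu>)" for z
  define a where "a n = (\<integral>x. complex_of_real x ^ n \<partial>\<nu>) / fact n" for n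
  \<comment> \<open>Taken at \<open>r = |z|\<close>, this function dominates the partial sums of the
    power series of \<open>exp (z x)\<close> for complex \<open>z\<close>.\<close>
  have exp_abs: "integrable \<nu> (\<lambda>x. exp (r * \<bar>x\<bar>))" for r :: real
  proof (rule Bochner_Integration.integrable_bound[OF Bochner_Integration.integrable_add[OF int[of r] int[of "- r"]]])
    show "AE x in \<nu>. norm (exp (r * \<bar>x\<bar>)) \<le> norm (exp (r * x) + exp (- r * x))"
    proof (intro AE_I2)
      fix x
      have "exp (r * \<bar>x\<bar>) \<le> exp (r * x) + exp (- r * x)" by (auto simp: abs_if)
      then show "norm (exp (r * \<bar>x\<bar>)) \<le> norm (exp (r * x) + exp (- r * x))"
        by (simp add: add_pos_pos order_less_imp_le)
    qed
  qed simp
  have sums: "(\<lambda>n. a n * z ^ n) sums f z" for z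
  proof -
    have terms: "norm ((z * complex_of_real x) ^ n /\<^sub>R fact n) = (norm z * \<bar>x\<bar>) ^ n /\<^sub>R fact n" for x n
      by (simp add: norm_mult norm_power)
    have le: "(norm z * \<bar>x\<bar>) ^ n /\<^sub>R fact n \<le> exp (norm z * \<bar>x\<bar>)" for x n
      using sum_le_suminf[of "\<lambda>n. (norm z * \<bar>x\<bar>) ^ n /\<^sub>R fact n" "{n}"] summable_exp_generic[of "norm z * \<bar>x\<bar>"]
      by (simp add: exp_def)
    have inti: "integrable \<nu> (\<lambda>x. (z * complex_of_real x) ^ n /\<^sub>R fact n)" for n
      by (rule Bochner_Integration.integrable_bound[OF exp_abs[of "norm z"]])
        (use le in \<open>auto simp: terms simp del: norm_scaleR norm_power norm_mult\<close>)
    have "(\<lambda>n. \<integral>x. (z * complex_of_real x) ^ n /\<^sub>R fact n \<partial>\<nu>) sums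
       (\<integral>x. (\<Sum>n. (z * complex_of_real x) ^ n /\<^sub>R fact n) \<partial>\<nu>)"
    proof (rule sums_integral[OF inti])
      show "AE x in \<nu>. summable (\<lambda>n. norm ((z * complex_of_real x) ^ n /\<^sub>R fact n))"
        unfolding terms using summable_exp_generic by (intro AE_I2) blast
      show "summable (\<lambda>n. \<integral>x. norm ((z * complex_of_real x) ^ n /\<^sub>R fact n) \<partial>\<nu>)"
      proof (rule summableI_nonneg_bounded)
        fix n
        have "(\<Sum>i<n. \<integral>x. norm ((z * complex_of_real x) ^ i /\<^sub>R fact i) \<partial>\<nu>)
           = (\<integral>x. (\<Sum>i<n. norm ((z * complex_of_real x) ^ i /\<^sub>R fact i)) \<partial>\<nu>)"
          by (rule Bochner_Integration.integral_sum[symmetric]) (intro integrable_norm inti)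
        also have "\<dots> \<le> (\<integral>x. exp (norm z * \<bar>x\<bar>) \<partial>\<nu>)"
        proof (rule integral_mono[OF _ exp_abs])
          show "integrable \<nu> (\<lambda>x. \<Sum>i<n. norm ((z * complex_of_real x) ^ i /\<^sub>R fact i))"
            by (intro Bochner_Integration.integrable_sum integrable_norm inti)
          show "(\<Sum>i<n. norm ((z * complex_of_real x) ^ i /\<^sub>R fact i)) \<le> exp (norm z * \<bar>x\<bar>)" for x
            unfolding terms exp_def by (rule sum_le_suminf[OF summable_exp_generic]) auto
        qed
        finally show "(\<Sum>i<n. \<integral>x. norm ((z * complex_of_real x) ^ i /\<^sub>R fact i) \<partial>\<nu>)
          \<le> (\<integral>x. exp (norm z * \<bar>x\<bar>) \<partial>\<nu>)" .
      qed simp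
    qed
    moreover have "(\<integral>x. (z * complex_of_real x) ^ n /\<^sub>R fact n \<partial>\<nu>) = a n * z ^ n" for n
      by (simp add: power_mult_distrib a_def scaleR_conv_of_real divide_inverse)
    ultimately show ?thesis by (simp add: f_def exp_def)
  qed
  \<comment> \<open>Any disc around 0 containing \<open>i t\<close> would do: it meets the real axis
    in a set accumulating at 0, on which the two analytic functions agree.\<close>
  define r where "r = \<bar>t\<bar> + 1"
  have r: "0 < r" "\<bar>t\<bar> < r" by (auto simp: r_def)
  have "f holomorphic_on ball 0 r" by (rule power_series_holomorphic[where a=a]) (simp add: sums)
  then have hol: "(\<lambda>z. f z - exp (z\<^sup>2 * of_real \<delta> / 2)) holomorphic_on ball 0 r"
    by (intro holomorphic_intros) auto
  have "f (\<i> * of_real t) - exp ((\<i> * of_real t)\<^sup>2 * of_real \<delta> / 2) = 0"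
  proof (rule analytic_continuation[OF hol, where U="of_real ` {-r<..<r}" and \<xi>=0])
    show "(0::complex) islimpt of_real ` {-r<..<r}"
    proof (unfold islimpt_approachable, intro allI impI)
      fix e :: real assume e: "0 < e"
      define x where "x = min (e / 2) (r / 2)"
      have "0 < x" "x < e" "x < r" using e r by (auto simp: x_def)
      then show "\<exists>x'\<in>of_real ` {-r<..<r}. x' \<noteq> 0 \<and> dist x' (0::complex) < e"
        by (intro bexI[of _ "of_real x"]) auto
    qed
    fix z :: complex assume "z \<in> of_real ` {-r<..<r}"
    then obtain u :: real where u: "z = of_real u" by auto
    have "f z = (\<integral>x. complex_of_real (exp (u * x)) \<partial>\<nu>)" by (simp add: f_def u exp_of_real[symmetric])
    also have "\<dots> = complex_of_real (exp (u\<^sup>2 * \<delta> / 2))" by (simp only: integral_complex_of_real mgf)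
    also have "\<dots> = exp (z\<^sup>2 * of_real \<delta> / 2)" by (simp add: u exp_of_real[symmetric])
    finally show "f z - exp (z\<^sup>2 * of_real \<delta> / 2) = 0" by simp
  qed (use r in \<open>auto simp: norm_mult\<close>)
  then show ?thesis by (simp add: char_def f_def power_mult_distrib mult.assoc)
qed

text \<open>The formula for the characteristic function applies to the normal law as well, so both
  laws share it and Levy's theorem concludes.\<close>

lemma gaussian_mgf_unique:
  assumes \<nu>: "real_distribution \<nu>" and \<delta>: "0 < \<delta>"
    and int: "\<And>u. integrable \<nu> (\<lambda>x. exp (u * x))"
    and mgf: "\<And>u. (\<integral>x. exp (u * x) \<partial>\<nu>) = exp (u\<^sup>2 * \<delta> / 2)"
  shows "\<nu> = density lborel (\<lambda>x. ennreal (normal_density 0 (sqrt \<delta>) x))" (is "_ = ?N")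
proof (rule Levy_uniqueness[OF \<nu>])
  have s: "0 < sqrt \<delta>" using \<delta> by simp
  show N: "real_distribution ?N"
    using prob_space_normal_density[OF s, of 0] by (auto simp: real_distribution_def real_distribution_axioms_def)
  have "integrable ?N (\<lambda>x. exp (u * x))" for u
    using mgf_normal(1)[OF s, of u] by (subst integrable_density) auto
  moreover have "(\<integral>x. exp (u * x) \<partial>?N) = exp (u\<^sup>2 * \<delta> / 2)" for u
    using mgf_normal(2)[OF s, of u] \<delta> by (subst integral_density) auto
  ultimately show "char \<nu> = char ?N"
    using char_of_gaussian_mgf[OF \<nu> int mgf] char_of_gaussian_mgf[OF N] by (intro ext) metis
qed

text \<open>Divided by its total mass \<open>C\<close> (the case \<open>u = 0\<close>), the weight
  \<open>Y\<close> becomes a probability density under which \<open>X\<close> has a Gaussian moment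
  generating function, hence a normal law. A weight of mass zero is treated apart.\<close>

lemma weighted_gaussian_mgf:
  assumes [measurable]: "X \<in> borel_measurable M" "Y \<in> borel_measurable M" "B \<in> sets borel"
    and Y: "\<And>x. 0 \<le> Y x" and \<delta>: "0 < \<delta>"
    and int: "\<And>u. integrable M (\<lambda>x. Y x * exp (u * X x))"
    and mgf: "\<And>u. (\<integral>x. Y x * exp (u * X x) \<partial>M) = C * exp (u\<^sup>2 * \<delta> / 2)"
  shows "(\<integral>x. Y x * indicator B (X x) \<partial>M)
    = C * measure (density lborel (\<lambda>x. ennreal (normal_density 0 (sqrt \<delta>) x))) B"
proof -
  have intY: "integrable M Y" and C: "C = (\<integral>x. Y x \<partial>M)" using int[of 0] mgf[of 0] by simp_all
  show ?thesis
  proof (cases "C = 0")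
    case True
    then have "AE x in M. Y x = 0" using C integral_nonneg_eq_0_iff_AE[OF intY] Y by simp
    then have "(\<integral>x. Y x * indicator B (X x) \<partial>M) = 0" by (intro integral_eq_zero_AE) (auto elim: eventually_mono)
    then show ?thesis using True by simp
  next
    case False
    then have Cpos: "C > 0" using C Y by (simp add: less_le)
    define D where "D = density M (\<lambda>x. ennreal (Y x / C))"
    have X[measurable]: "X \<in> borel_measurable D" by (simp add: D_def)
    have "emeasure D (space D) = (\<integral>\<^sup>+x. ennreal (Y x / C) \<partial>M)"
      unfolding D_def by (subst emeasure_density) (auto intro!: nn_integral_cong)
    also have "\<dots> = ennreal (\<integral>x. Y x / C \<partial>M)" using intY Y Cpos by (intro nn_integral_eq_integral) auto
    also have "\<dots> = 1" using False by (simp add: C[symmetric])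
    finally have D: "prob_space D" by (rule prob_spaceI)
    define \<nu> where "\<nu> = distr D borel X"
    have \<nu>: "real_distribution \<nu>"
      using prob_space.prob_space_distr[OF D X] by (simp add: \<nu>_def real_distribution_def real_distribution_axioms_def)
    have intg: "(\<integral>x. g x \<partial>\<nu>) = (\<integral>x. Y x * g (X x) \<partial>M) / C"
      if [measurable]: "g \<in> borel_measurable borel" for g :: "real \<Rightarrow> real"
      using Y Cpos unfolding \<nu>_def D_def by (simp add: integral_distr integral_density)
    have "integrable \<nu> (\<lambda>x. exp (u * x))" for u
      using int[of u] Y Cpos unfolding \<nu>_def D_def by (simp add: integrable_distr_eq integrable_density)
    then have "\<nu> = density lborel (\<lambda>x. ennreal (normal_density 0 (sqrt \<delta>) x))"
      using False by (intro gaussian_mgf_unique[OF \<nu> \<delta>]) (simp_all add: intg mgf)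
    moreover have "measure \<nu> B = (\<integral>x. Y x * indicator B (X x) \<partial>M) / C"
      using intg[of "indicator B"] by (simp add: \<nu>_def)
    ultimately show ?thesis using Cpos by (simp add: field_simps)
  qed
qed

section \<open>Exponential moments of elementary integrals\<close>

text \<open>Instantiated twice: with the original Brownian motion and with the shifted one under the
  new measure. Null sets belong to every \<open>\<F> t\<close> because integrals are fixed only up
  to null sets and an arbitrary version should still be adapted.\<close>

locale wiener_space = prob_space M for M :: "'a measure" +
  fixes \<F> :: "real \<Rightarrow> 'a measure" and T :: real and W :: "real \<Rightarrow> 'a \<Rightarrow> real ^ 'n"
  assumes bm: "brownian_motion M \<F> {0..T} W"
    and T_nonneg: "0 \<le> T"
    and null_sets_le: "\<And>t. t \<in> {0..T} \<Longrightarrow> null_sets M \<subseteq> sets (\<F> t)"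
begin

lemma subalg: "t \<in> {0..T} \<Longrightarrow> subalgebra M (\<F> t)"
  using bm by (auto simp: brownian_motion_def)

lemma filtration_F: "filtration (space M) \<F>"
  using bm by (simp add: brownian_motion_def)

lemma space_F [simp]: "space (\<F> t) = space M"
  by (rule filtration.space_F[OF filtration_F])

lemma F_mono: "s \<le> t \<Longrightarrow> sets (\<F> s) \<subseteq> sets (\<F> t)"
  by (rule filtration.sets_F_mono[OF filtration_F])

lemma F_sets: "t \<in> {0..T} \<Longrightarrow> A \<in> sets (\<F> t) \<Longrightarrow> A \<in> sets M"
  using subalg by (auto simp: subalgebra_def)

lemma F_measurable_mono: "f \<in> measurable (\<F> s) N \<Longrightarrow> s \<le> t \<Longrightarrow> f \<in> measurable (\<F> t) N"
  using measurable_mono[of N N "\<F> s" "\<F> t"] F_mono by auto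

lemma F_measurable_M: "f \<in> measurable (\<F> t) N \<Longrightarrow> t \<in> {0..T} \<Longrightarrow> f \<in> measurable M N"
  using measurable_from_subalg[OF subalg] by auto

lemma W_measurable: "t \<in> {0..T} \<Longrightarrow> W t \<in> borel_measurable (\<F> t)"
  using bm by (auto simp: brownian_motion_def)

lemma W_measurable': "s \<in> {0..T} \<Longrightarrow> s \<le> t \<Longrightarrow> W s \<in> borel_measurable (\<F> t)"
  by (rule F_measurable_mono[OF W_measurable])

lemma W_measurable_M: "t \<in> {0..T} \<Longrightarrow> W t \<in> borel_measurable M"
  using W_measurable F_measurable_M by blast

text \<open>The definition of Brownian motion speaks of families of events. Passing to the
  sigma-algebras generated by \<open>Y\<close> and by a function of the increment gives independent
  random variables, whose expectations multiply.\<close>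

lemma increment_indep:
  assumes st: "s \<in> {0..T}" "t \<in> {0..T}" "s < t"
    and Y: "Y \<in> borel_measurable (\<F> s)" "integrable M Y"
    and h: "h \<in> borel_measurable borel" "integrable M (\<lambda>w. h (W t w - W s w))"
  shows "integrable M (\<lambda>w. Y w * (h (W t w - W s w) :: real))"
    and "(\<integral>w. Y w * h (W t w - W s w) \<partial>M) = (\<integral>w. Y w \<partial>M) * (\<integral>w. h (W t w - W s w) \<partial>M)"
proof -
  let ?D = "\<lambda>w. W t w - W s w"
  have ind: "indep_set (sets (\<F> s)) {?D -` B \<inter> space M | B. B \<in> sets borel}"
    using bm st unfolding brownian_motion_def by blast
  have Dm: "?D \<in> borel_measurable M" using W_measurable_M st by auto
  have gen: "indep_set {Y -` A \<inter> space M | A. A \<in> sets borel} {(\<lambda>w. h (?D w)) -` A \<inter> space M | A. A \<in> sets borel}"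
  proof (rule indep_setI)
    have 1: "{Y -` A \<inter> space M | A. A \<in> sets borel} \<subseteq> sets (\<F> s)"
      using measurable_sets[OF Y(1)] by auto
    have 2: "{(\<lambda>w. h (?D w)) -` A \<inter> space M | A. A \<in> sets borel} \<subseteq> {?D -` B \<inter> space M | B. B \<in> sets borel}"
    proof clarify
      fix A :: "real set" assume "A \<in> sets borel"
      then have "h -` A \<in> sets borel" using measurable_sets[OF h(1), of A] by simp
      then show "\<exists>B. (\<lambda>w. h (?D w)) -` A \<inter> space M = ?D -` B \<inter> space M \<and> B \<in> sets borel"
        by (intro exI[of _ "h -` A"]) auto
    qed
    show "{Y -` A \<inter> space M | A. A \<in> sets borel} \<subseteq> events"
      using order_trans[OF 1] subalg[OF st(1)] by (simp add: subalgebra_def)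
    show "{(\<lambda>w. h (?D w)) -` A \<inter> space M | A. A \<in> sets borel} \<subseteq> events"
      by (rule order_trans[OF 2 indep_setD_ev2[OF ind]])
    show "prob (a \<inter> b) = prob a * prob b" if "a \<in> {Y -` A \<inter> space M | A. A \<in> sets borel}"
      "b \<in> {(\<lambda>w. h (?D w)) -` A \<inter> space M | A. A \<in> sets borel}" for a b
      by (rule indep_setD[OF ind subsetD[OF 1 that(1)] subsetD[OF 2 that(2)]])
  qed
  have stable: "Int_stable {X -` A \<inter> space M | A. A \<in> sets borel}" for X :: "'a \<Rightarrow> real"
  proof (rule Int_stableI, clarify)
    fix A B :: "real set" assume "A \<in> sets borel" "B \<in> sets borel"
    moreover have "X -` A \<inter> space M \<inter> (X -` B \<inter> space M) = X -` (A \<inter> B) \<inter> space M" by auto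
    ultimately show "\<exists>C. X -` A \<inter> space M \<inter> (X -` B \<inter> space M) = X -` C \<inter> space M \<and> C \<in> sets borel"
      by (metis sets.Int)
  qed
  have "indep_var borel Y borel (\<lambda>w. h (?D w))"
    unfolding indep_var_eq
    using F_measurable_M[OF Y(1) st(1)] measurable_compose[OF Dm h(1)]
      indep_set_sigma_sets[OF gen stable stable] by blast
  from indep_var_integrable[OF this Y(2) h(2)] indep_var_lebesgue_integral[OF this Y(2) h(2)]
  show "integrable M (\<lambda>w. Y w * h (?D w))"
    and "(\<integral>w. Y w * h (?D w) \<partial>M) = (\<integral>w. Y w \<partial>M) * (\<integral>w. h (?D w) \<partial>M)"
    by auto
qed

text \<open>The exponential of an inner product is a product over the independent
  coordinates.\<close>

lemma increment_exp:
  assumes st: "s \<in> {0..T}" "t \<in> {0..T}" "s < t"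
  shows "integrable M (\<lambda>w. exp (c \<bullet> (W t w - W s w)))"
    and "(\<integral>w. exp (c \<bullet> (W t w - W s w)) \<partial>M) = exp ((norm c)\<^sup>2 * (t - s) / 2)"
proof -
  let ?D = "\<lambda>i w. W t w $ i - W s w $ i" and ?N = "normal_density 0 (sqrt (t - s))"
  have ind: "indep_vars (\<lambda>_. borel) ?D UNIV"
    and dist: "\<And>i. distributed M lborel (?D i) (\<lambda>x. ennreal (?N x))"
    using bm st unfolding brownian_motion_def by blast+
  have pos: "0 < sqrt (t - s)" using st by simp
  have 1: "integrable M (\<lambda>w. exp (c $ i * ?D i w))"
    and 2: "(\<integral>w. exp (c $ i * ?D i w) \<partial>M) = exp ((c $ i)\<^sup>2 * (t - s) / 2)" for i
  proof -
    show "integrable M (\<lambda>w. exp (c $ i * ?D i w))"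
      using mgf_normal(1)[OF pos, of "c $ i"] distributed_integrable[OF dist, of "\<lambda>x. exp (c $ i * x)" i] by simp
    show "(\<integral>w. exp (c $ i * ?D i w) \<partial>M) = exp ((c $ i)\<^sup>2 * (t - s) / 2)"
      using mgf_normal(2)[OF pos, of "c $ i"] distributed_integral[OF dist, of "\<lambda>x. exp (c $ i * x)" i] st by simp
  qed
  have ind': "indep_vars (\<lambda>_. borel) (\<lambda>i w. exp (c $ i * ?D i w)) UNIV"
    by (rule indep_vars_compose2[OF ind]) simp
  have eq: "exp (c \<bullet> (W t w - W s w)) = (\<Prod>i\<in>UNIV. exp (c $ i * ?D i w))" for w
    by (simp add: inner_vec_def exp_sum)
  show "integrable M (\<lambda>w. exp (c \<bullet> (W t w - W s w)))"
    unfolding eq by (rule indep_vars_integrable[OF _ ind' 1]) simp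
  have "(\<integral>w. exp (c \<bullet> (W t w - W s w)) \<partial>M) = (\<Prod>i\<in>UNIV. exp ((c $ i)\<^sup>2 * (t - s) / 2))"
    unfolding eq by (subst indep_vars_lebesgue_integral[OF _ ind' 1]) (simp_all add: 2)
  also have "\<dots> = exp ((norm c)\<^sup>2 * (t - s) / 2)"
  proof -
    have "(norm c)\<^sup>2 = (\<Sum>i\<in>UNIV. (c $ i)\<^sup>2)"
      unfolding power2_norm_eq_inner inner_vec_def by (simp add: power2_eq_square)
    then show ?thesis by (simp add: exp_sum[symmetric] sum_distrib_right sum_divide_distrib)
  qed
  finally show "(\<integral>w. exp (c \<bullet> (W t w - W s w)) \<partial>M) = exp ((norm c)\<^sup>2 * (t - s) / 2)" .
qed

abbreviation \<Lambda> where "\<Lambda> \<equiv> lebesgue_on {0..T}"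

sublocale \<Lambda>: finite_measure \<Lambda>
  by (rule lebesgue_on_finite)

text \<open>For \<open>X\<close> the integral of \<open>f\<close> over [0, T] and \<open>Y\<close>
  the one over [0, s], this is the martingale property of
  \<open>exp (X_t - 1/2 int_0^t |f|^2)\<close> between \<open>s\<close> and \<open>T\<close>, tested
  on the event \<open>A\<close>.\<close>

abbreviation exp_balance :: "'a set \<Rightarrow> real \<Rightarrow> (real \<Rightarrow> real ^ 'n) \<Rightarrow> ('a \<Rightarrow> real) \<Rightarrow> ('a \<Rightarrow> real) \<Rightarrow> bool" where
  "exp_balance A s f X Y \<equiv> (\<integral>w. indicator A w * exp (X w) \<partial>M) * exp (- msq \<Lambda> f / 2)
     = (\<integral>w. indicator A w * exp (Y w) \<partial>M) * exp (- msq \<Lambda> (trunc s f) / 2)"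

abbreviation "wint \<equiv> vector_wiener_integral M W"

text \<open>A step function is written as a sum over intervals \<open>(0, p]\<close> instead of consecutive ones: such sums
  are closed under addition, and the largest point can be split off by moving its coefficient to its
  predecessor.\<close>

definition past_step :: "real set \<Rightarrow> (real \<Rightarrow> real ^ 'n) \<Rightarrow> real \<Rightarrow> real ^ 'n" where
  "past_step P c x = (\<Sum>p\<in>P. indicator {0<..p} x *\<^sub>R c p)"

text \<open>Capping the nodes at \<open>s\<close> stops the integral at time \<open>s\<close>. Since
  \<open>W 0\<close> vanishes only almost surely, it is subtracted so that identities between such
  sums hold at every sample point.\<close>

definition past_int :: "real set \<Rightarrow> (real \<Rightarrow> real ^ 'n) \<Rightarrow> real \<Rightarrow> 'a \<Rightarrow> real" where
  "past_int P c s w = (\<Sum>p\<in>P. c p \<bullet> (W (min p s) w - W 0 w))"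

lemma past_step_measurable: "past_step P c \<in> borel_measurable \<Lambda>"
  unfolding past_step_def[abs_def] by (rule borel_lebesgue_on) measurable

lemma past_step_L2: "L2 \<Lambda> (past_step P c)"
proof (rule \<Lambda>.L2_bounded[OF past_step_measurable])
  show "norm (past_step P c s) \<le> (\<Sum>p\<in>P. norm (c p))" for s
    unfolding past_step_def by (intro order_trans[OF norm_sum] sum_mono) (auto simp: indicator_def)
qed

lemma restrict_L2: "L2 \<Lambda> f \<Longrightarrow> L2 \<Lambda> (trunc s f)"
  unfolding L2_def
proof (elim conjE, intro conjI)
  assume f: "f \<in> borel_measurable \<Lambda>" "integrable \<Lambda> (\<lambda>x. (norm (f x))\<^sup>2)"
  have "(indicator {0..s} :: real \<Rightarrow> real) \<in> borel_measurable \<Lambda>" by (rule borel_lebesgue_on) simp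
  then show 1: "(trunc s f) \<in> borel_measurable \<Lambda>"
    using f(1) by (rule borel_measurable_scaleR)
  show "integrable \<Lambda> (\<lambda>x. (norm (indicator {0..s} x *\<^sub>R f x))\<^sup>2)"
    by (rule Bochner_Integration.integrable_bound[OF f(2)
          borel_measurable_power[OF measurable_compose[OF 1 borel_measurable_norm]]]) (auto simp: indicator_def)
qed

lemma past_int_measurable:
  assumes P: "P \<subseteq> {0..T}" and s: "s \<in> {0..T}"
  shows "past_int P c s \<in> borel_measurable (\<F> s)"
proof -
  have "(\<lambda>w. c p \<bullet> (W (min p s) w - W 0 w)) \<in> borel_measurable (\<F> s)" if "p \<in> P" for p
    using that P s by (intro borel_measurable_inner borel_measurable_diff borel_measurable_const W_measurable') auto
  then show ?thesis unfolding past_int_def[abs_def] by (rule borel_measurable_sum)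
qed

text \<open>Appending a node \<open>b\<close> after the old maximum \<open>r\<close> adds an
  increment over (r, b], independent of \<open>\<F> r\<close>. Its exponential has mean
  \<open>exp (|c b|^2 (b - r) / 2)\<close>, which the growth of the squared norm cancels exactly.
  The hypotheses range over all \<open>c\<close> because the coefficient at \<open>r\<close>
  changes.\<close>

lemma past_int_exp_insert:
  assumes P: "finite P" "P \<noteq> {}" "P \<subseteq> {0..T}" and b: "b \<in> {0..T}" "Max P < b" and s: "s \<in> {0..T}" "s \<le> Max P"
    and A: "A \<in> sets (\<F> s)"
    and int: "\<And>c. integrable M (\<lambda>w. indicator A w * exp (past_int P c T w))"
    and eq: "\<And>c. exp_balance A s (past_step P c) (past_int P c T) (past_int P c s)"
  shows "integrable M (\<lambda>w. indicator A w * exp (past_int (insert b P) c T w))"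
    and "exp_balance A s (past_step (insert b P) c) (past_int (insert b P) c T) (past_int (insert b P) c s)"
proof -
  define r where "r = Max P"
  have rP: "r \<in> P" using P by (simp add: r_def)
  then have r: "r \<in> {0..T}" "r < b" "s \<le> r" using P b s by (auto simp: r_def)
  have Pr: "\<And>p. p \<in> P \<Longrightarrow> p \<le> r" using P by (simp add: r_def)
  have bP: "b \<notin> P" using Pr r(2) by force
  define c' where "c' = c(r := c r + c b)"
  have I: "(\<Sum>p\<in>insert b P. c p \<bullet> f p) = (\<Sum>p\<in>P. c' p \<bullet> f p) + c b \<bullet> (f b - f r)" for f
  proof -
    have "(\<Sum>p\<in>P. c' p \<bullet> f p) = (c r + c b) \<bullet> f r + (\<Sum>p\<in>P - {r}. c p \<bullet> f p)"
      using P(1) rP by (subst sum.remove[of _ r]) (auto simp: c'_def intro!: sum.cong)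
    moreover have "(\<Sum>p\<in>P. c p \<bullet> f p) = c r \<bullet> f r + (\<Sum>p\<in>P - {r}. c p \<bullet> f p)"
      by (rule sum.remove[OF P(1) rP])
    ultimately show ?thesis using P(1) bP by (simp add: inner_add_left inner_diff_right)
  qed
  have IT: "past_int (insert b P) c T w = past_int P c' T w + c b \<bullet> (W b w - W r w)" for w
    unfolding past_int_def I using b r by simp
  have Is: "past_int (insert b P) c s w = past_int P c' s w" for w
    unfolding past_int_def I using b r by (simp add: min_absorb2)
  have V: "past_step (insert b P) c x = past_step P c' x + indicator {r<..b} x *\<^sub>R c b" for x
  proof -
    have "(\<Sum>p\<in>P. indicator {0<..p} x *\<^sub>R c' p) = indicator {0<..r} x *\<^sub>R (c r + c b) + (\<Sum>p\<in>P - {r}. indicator {0<..p} x *\<^sub>R c p)"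
      unfolding sum.remove[OF P(1) rP]
      by (intro arg_cong2[where f="(+)"] sum.cong refl) (auto simp: c'_def)
    moreover have "(\<Sum>p\<in>P. indicator {0<..p} x *\<^sub>R c p) = indicator {0<..r} x *\<^sub>R c r + (\<Sum>p\<in>P - {r}. indicator {0<..p} x *\<^sub>R c p)"
      by (rule sum.remove[OF P(1) rP])
    moreover have "indicator {0<..b} x *\<^sub>R c b = indicator {0<..r} x *\<^sub>R c b + indicator {r<..b} x *\<^sub>R c b"
      using r by (auto simp: indicator_def)
    ultimately show ?thesis unfolding past_step_def sum.insert[OF P(1) bP] by (simp only: scaleR_add_right add_ac)
  qed
  \<comment> \<open>The two pieces of the step function thus have disjoint supports, so their
    squared norms add.\<close>
  have V0: "past_step P c' x = 0" if "x > r" for x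
    unfolding past_step_def using Pr that by (intro sum.neutral) (force simp: indicator_def)
  have Vs: "indicator {0..s} x *\<^sub>R past_step (insert b P) c x = indicator {0..s} x *\<^sub>R past_step P c' x" for x
    unfolding V using r(3) by (auto simp: indicator_def)
  have "msq \<Lambda> (\<lambda>x. past_step (insert b P) c x)
     = (\<integral>x. (norm (past_step P c' x))\<^sup>2 + (norm (c b))\<^sup>2 * indicator {r<..b} x \<partial>\<Lambda>)"
    unfolding V using V0 by (intro Bochner_Integration.integral_cong refl) (auto simp: indicator_def)
  also have "\<dots> = msq \<Lambda> (\<lambda>x. past_step P c' x) + (norm (c b))\<^sup>2 * (b - r)"
  proof -
    have sub: "{r<..b} \<subseteq> {0..T}" "{r<..b} \<in> sets \<Lambda>" using r b by (auto simp: sets_restrict_space)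
    have "measure \<Lambda> {r<..b} = b - r"
      using r b sub by (simp add: measure_restrict_space)
    moreover have "integrable \<Lambda> (indicator {r<..b} :: real \<Rightarrow> real)"
      using sub by (simp add: \<Lambda>.emeasure_finite less_top[symmetric])
    moreover have "{r<..b} \<inter> space \<Lambda> = {r<..b}" using sub by auto
    ultimately show ?thesis using past_step_L2[of P c'] by (simp add: L2_def)
  qed
  finally have VT: "msq \<Lambda> (\<lambda>x. past_step (insert b P) c x)
     = msq \<Lambda> (\<lambda>x. past_step P c' x) + (norm (c b))\<^sup>2 * (b - r)" .
  \<comment> \<open>No old node lies beyond \<open>r\<close>, so the old integral is already known
    at time \<open>r\<close>.\<close>
  have Y: "(\<lambda>w. indicator A w * exp (past_int P c' T w)) \<in> borel_measurable (\<F> r)"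
  proof -
    have "past_int P c' T = past_int P c' r" using Pr P(3) by (auto simp: past_int_def fun_eq_iff intro!: sum.cong)
    then show ?thesis using past_int_measurable[OF P(3) r(1), of c'] A F_mono[OF r(3)] by auto
  qed
  note ind = increment_indep[where h="\<lambda>x. exp (c b \<bullet> x)", OF r(1) b(1) r(2) Y int _ increment_exp(1)[OF r(1) b(1) r(2)]]
  have e: "indicator A w * exp (past_int (insert b P) c T w) =
      indicator A w * exp (past_int P c' T w) * exp (c b \<bullet> (W b w - W r w))" for w
    by (simp add: IT exp_add)
  show "integrable M (\<lambda>w. indicator A w * exp (past_int (insert b P) c T w))"
    unfolding e by (rule ind(1)) simp
  have "(\<integral>w. indicator A w * exp (past_int (insert b P) c T w) \<partial>M)
     = (\<integral>w. indicator A w * exp (past_int P c' T w) \<partial>M) * exp ((norm (c b))\<^sup>2 * (b - r) / 2)"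
    unfolding e by (subst ind(2)) (simp_all add: increment_exp(2)[OF r(1) b(1) r(2)])
  then have "(\<integral>w. indicator A w * exp (past_int (insert b P) c T w) \<partial>M) * exp (- msq \<Lambda> (\<lambda>x. past_step (insert b P) c x) / 2)
     = (\<integral>w. indicator A w * exp (past_int P c' T w) \<partial>M) * exp (- msq \<Lambda> (\<lambda>x. past_step P c' x) / 2)"
    unfolding VT by (simp add: mult.assoc exp_add[symmetric] field_simps)
  then show "exp_balance A s (past_step (insert b P) c) (past_int (insert b P) c T) (past_int (insert b P) c s)"
    unfolding Is Vs eq .
qed

text \<open>The nodes after \<open>s\<close> are appended in increasing order. Having
  \<open>s\<close> among the initial nodes guarantees that every appended increment starts at or
  after \<open>s\<close>, hence is independent of \<open>A\<close>. Initially nothing happens after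
  \<open>s\<close> and the balance is an identity.\<close>

lemma past_int_exp_aux:
  assumes P: "finite P" "P \<subseteq> {0..s}" "s \<in> P" and s: "s \<in> {0..T}" and A: "A \<in> sets (\<F> s)"
    and int: "\<And>c. integrable M (\<lambda>w. indicator A w * exp (past_int P c T w))"
    and R: "finite R" "R \<subseteq> {s<..T}"
  shows "\<forall>c. integrable M (\<lambda>w. indicator A w * exp (past_int (R \<union> P) c T w)) \<and>
    exp_balance A s (past_step (R \<union> P) c) (past_int (R \<union> P) c T) (past_int (R \<union> P) c s)"
  using R
proof (induction R rule: finite_linorder_max_induct)
  case empty
  have "past_int P c T = past_int P c s" for c
    using P(2) s by (auto simp: past_int_def fun_eq_iff intro!: sum.cong)
  moreover have "indicator {0..s} x *\<^sub>R past_step P c x = past_step P c x" for c x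
  proof (cases "x \<in> {0..s}")
    case False
    then have "past_step P c x = 0" using P(2) unfolding past_step_def by (intro sum.neutral) (force simp: indicator_def)
    then show ?thesis by simp
  qed simp
  ultimately show ?case using int by simp
next
  case (insert b R)
  have fin: "finite (R \<union> P)" using insert P by simp
  have sM: "s \<le> Max (R \<union> P)" using P fin by (intro Max_ge) auto
  have Mb: "Max (R \<union> P) < b" using insert P fin by (subst Max_less_iff) force+
  show ?case
  proof
    fix c
    show "integrable M (\<lambda>w. indicator A w * exp (past_int (insert b R \<union> P) c T w)) \<and>
    exp_balance A s (past_step (insert b R \<union> P) c) (past_int (insert b R \<union> P) c T) (past_int (insert b R \<union> P) c s)"
      unfolding Un_insert_left
      by (intro conjI past_int_exp_insert[OF fin _ _ _ Mb s sM A]) (use insert P s in auto)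
  qed
qed

text \<open>Lets a prescribed time be assumed to be a node, at the price of a zero
  coefficient.\<close>

lemma past_step_insert_zero:
  assumes "finite P" "q \<notin> P"
  shows "past_step (insert q P) (c(q := 0)) = past_step P c" "past_int (insert q P) (c(q := 0)) = past_int P c"
proof -
  have c: "(c(q := 0)) p = c p" if "p \<in> P" for p using assms that by auto
  show "past_step (insert q P) (c(q := 0)) = past_step P c"
    unfolding past_step_def[abs_def] sum.insert[OF assms] using c
    by (simp only: fun_upd_same scaleR_zero_right add_0 cong: sum.cong)
  show "past_int (insert q P) (c(q := 0)) = past_int P c"
    unfolding past_int_def[abs_def] sum.insert[OF assms] using c
    by (simp only: fun_upd_same inner_zero_left add_0 cong: sum.cong)
qed

text \<open>The induction starts from the single node 0, whose contribution is zero, with the whole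
  space as event.\<close>

lemma past_int_exp_integrable:
  assumes P: "finite P" "P \<subseteq> {0..T}"
  shows "integrable M (\<lambda>w. exp (past_int P c T w))"
proof -
  have base: "integrable M (\<lambda>w. indicator (space M) w * exp (past_int {0} c T w))" for c
    using T_nonneg integrable_real_indicator[OF sets.top, of M]
    by (simp add: past_int_def min_absorb1 emeasure_space_1)
  have *: "integrable M (\<lambda>w. exp (past_int P c T w))" if "finite P" "P \<subseteq> {0..T}" "0 \<in> P" for P c
  proof -
    have "(P - {0}) \<union> {0} = P" using that by auto
    moreover have "integrable M (\<lambda>w. indicator (space M) w * exp (past_int ((P - {0}) \<union> {0}) c T w))"
      using past_int_exp_aux[OF _ _ _ _ _ base, where R="P - {0}"] that T_nonneg sets.top[of "\<F> 0"] by fastforce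
    ultimately show ?thesis
      by (simp add: Bochner_Integration.integrable_cong[of M M "\<lambda>w. indicator (space M) w * exp (past_int P c T w)" "\<lambda>w. exp (past_int P c T w)"])
  qed
  show ?thesis
  proof (cases "0 \<in> P")
    case True then show ?thesis using * P by blast
  next
    case False
    then show ?thesis using *[of "insert 0 P" "c(0 := 0)"] P T_nonneg past_step_insert_zero[OF P(1) False, of c] by simp
  qed
qed

text \<open>The nodes are split at \<open>s\<close>: those up to \<open>s\<close> form the initial
  configuration, the later ones are appended.\<close>

lemma past_int_exp:
  assumes P: "finite P" "P \<subseteq> {0..T}" and s: "s \<in> {0..T}" and A: "A \<in> sets (\<F> s)"
  shows "exp_balance A s (past_step P c) (past_int P c T) (past_int P c s)"
proof -
  have base: "integrable M (\<lambda>w. indicator A w * exp (past_int Q c T w))" if "finite Q" "Q \<subseteq> {0..T}" for Q c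
    using integrable_mult_indicator[OF F_sets[OF s A] past_int_exp_integrable[OF that, of c]] by simp
  have *: "exp_balance A s (past_step P c) (past_int P c T) (past_int P c s)"
    if P: "finite P" "P \<subseteq> {0..T}" "s \<in> P" for P c
  proof -
    have eq: "(P \<inter> {s<..T}) \<union> (P \<inter> {0..s}) = P" using P s by auto
    have "finite (P \<inter> {0..s})" "P \<inter> {0..s} \<subseteq> {0..s}" "s \<in> P \<inter> {0..s}" "P \<inter> {0..s} \<subseteq> {0..T}"
      "finite (P \<inter> {s<..T})" "P \<inter> {s<..T} \<subseteq> {s<..T}" using P s by auto
    from past_int_exp_aux[OF this(1-3) s A base[OF this(1,4)] this(5,6)] show ?thesis unfolding eq by blast
  qed
  show ?thesis
  proof (cases "s \<in> P")
    case True then show ?thesis using * P by blast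
  next
    case False
    then show ?thesis using *[of "insert s P" "c(s := 0)"] P s unfolding past_step_insert_zero[OF P(1) False] by simp
  qed
qed

end

text \<open>Lets two exponential moments dominate the second moment.\<close>

lemma sq_le_exp: "x\<^sup>2 \<le> 2 * (exp x + exp (- x))" for x :: real
proof -
  have *: "y\<^sup>2 \<le> 2 * (exp y + exp (- y))" if "0 \<le> y" for y :: real
    using exp_lower_Taylor_quadratic[OF that] exp_ge_add_one_self[of "- y"] by (simp add: power2_eq_square)
  show ?thesis using *[of x] *[of "- x"] by (cases "0 \<le> x") (auto simp: add.commute)
qed

lemma L2lim_cong_AE:
  assumes f: "L2lim M fs f" and ae: "AE x in M. f x = f' x" and f': "f' \<in> borel_measurable M"
  shows "L2lim M fs f'"
proof -
  note [measurable] = f' L2_measurable[OF L2limD(1)[OF f]] L2_measurable[OF L2limD(2)[OF f]]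
  have "integrable M (\<lambda>x. (norm (f' x))\<^sup>2)"
    using L2_norm_sq_integrable[OF L2limD(2)[OF f]]
    by (rule integrable_cong_AE_imp) (use ae in \<open>auto elim: eventually_mono\<close>)
  moreover have "msq M (\<lambda>x. fs m x - f' x) = msq M (\<lambda>x. fs m x - f x)" for m
    by (rule integral_cong_AE) (use ae in \<open>auto elim: eventually_mono\<close>)
  ultimately show ?thesis using f f' by (simp add: L2lim_def L2_def)
qed

lemma norm_midpoint_sq:
  "(norm ((1/2) *\<^sub>R (a + b)))\<^sup>2 = (norm a)\<^sup>2 / 2 + (norm b)\<^sup>2 / 2 - (norm (a - b))\<^sup>2 / 4"
  for a b :: "'b::real_inner"
  unfolding power2_norm_eq_inner
  by (simp add: inner_add_left inner_add_right inner_diff_left inner_diff_right inner_commute[of b a] field_simps)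

context wiener_space
begin

section \<open>Elementary integrals and their \<open>L\<^sup>2\<close>-limits\<close>

text \<open>A relation rather than a map: a step function has many representations by nodes, and no
  independence of the choice has to be shown.\<close>

definition elementary :: "(real \<Rightarrow> real ^ 'n) \<Rightarrow> ('a \<Rightarrow> real) \<Rightarrow> bool" where
  "elementary g G \<longleftrightarrow> (\<exists>P c. finite P \<and> P \<subseteq> {0..T} \<and> g = past_step P c \<and> G = past_int P c T)"

lemma past_step_extend:
  assumes "finite Q" "P \<subseteq> Q"
  shows "past_step P c = past_step Q (\<lambda>p. if p \<in> P then c p else 0)"
    "past_int P c = past_int Q (\<lambda>p. if p \<in> P then c p else 0)"
proof -
  show "past_step P c = past_step Q (\<lambda>p. if p \<in> P then c p else 0)"
    unfolding past_step_def[abs_def] by (intro ext, rule sum.mono_neutral_cong_left) (use assms in auto)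
  show "past_int P c = past_int Q (\<lambda>p. if p \<in> P then c p else 0)"
    unfolding past_int_def[abs_def] by (intro ext, rule sum.mono_neutral_cong_left) (use assms in auto)
qed

text \<open>Both sums are rewritten over the union of their nodes, with zero coefficients at the
  foreign ones.\<close>

lemma elementary_add:
  assumes "elementary g G" "elementary h H"
  shows "elementary (\<lambda>x. g x + h x) (\<lambda>w. G w + H w)"
proof -
  obtain P c where P: "finite P" "P \<subseteq> {0..T}" "g = past_step P c" "G = past_int P c T" using assms(1) by (auto simp: elementary_def)
  obtain R d where R: "finite R" "R \<subseteq> {0..T}" "h = past_step R d" "H = past_int R d T" using assms(2) by (auto simp: elementary_def)
  define Q where "Q = P \<union> R"
  define c' where "c' p = (if p \<in> P then c p else 0)" for p
  define d' where "d' p = (if p \<in> R then d p else 0)" for p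
  have Q: "finite Q" "Q \<subseteq> {0..T}" "P \<subseteq> Q" "R \<subseteq> Q" using P R by (auto simp: Q_def)
  have "g = past_step Q c'" "G = past_int Q c' T" "h = past_step Q d'" "H = past_int Q d' T"
    using past_step_extend[OF Q(1,3), of c] past_step_extend[OF Q(1,4), of d] P R by (simp_all add: c'_def[abs_def] d'_def[abs_def])
  then have "(\<lambda>x. g x + h x) = past_step Q (\<lambda>p. c' p + d' p)" "(\<lambda>w. G w + H w) = past_int Q (\<lambda>p. c' p + d' p) T"
    by (simp_all only: past_step_def past_int_def fun_eq_iff sum.distrib scaleR_add_right inner_add_left simp_thms)
  then show ?thesis using Q unfolding elementary_def by blast
qed

lemma elementary_scaleR:
  assumes "elementary g G"
  shows "elementary (\<lambda>x. a *\<^sub>R g x) (\<lambda>w. a * G w)"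
proof -
  obtain P c where P: "finite P" "P \<subseteq> {0..T}" "g = past_step P c" "G = past_int P c T" using assms(1) by (auto simp: elementary_def)
  have "(\<lambda>x. a *\<^sub>R g x) = past_step P (\<lambda>p. a *\<^sub>R c p)" "(\<lambda>w. a * G w) = past_int P (\<lambda>p. a *\<^sub>R c p) T"
    unfolding P by (simp_all only: past_step_def past_int_def fun_eq_iff scaleR_sum_right sum_distrib_left
        scaleR_scaleR mult.commute inner_scaleR_left simp_thms)
  then show ?thesis using P unfolding elementary_def by blast
qed

lemma elementary_diff:
  assumes "elementary g G" "elementary h H"
  shows "elementary (\<lambda>x. g x - h x) (\<lambda>w. G w - H w)"
  using elementary_add[OF assms(1) elementary_scaleR[OF assms(2), of "-1"]] by simp

lemma elementary_zero: "elementary (\<lambda>x. 0) (\<lambda>w. 0)"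
  unfolding elementary_def by (intro exI[of _ "{}"]) (simp add: past_step_def past_int_def fun_eq_iff)

lemma elementary_sum:
  "(\<And>i. i \<in> I \<Longrightarrow> elementary (g i) (G i)) \<Longrightarrow> elementary (\<lambda>x. \<Sum>i\<in>I. g i x) (\<lambda>w. \<Sum>i\<in>I. G i w)"
  by (induction I rule: infinite_finite_induct) (simp_all add: elementary_zero elementary_add)

lemma elementary_single:
  assumes "p \<in> {0..T}"
  shows "elementary (\<lambda>x. indicator {0<..p} x *\<^sub>R v) (\<lambda>w. v \<bullet> (W p w - W 0 w))"
proof -
  have single: "sum f {p} = f p" for f :: "real \<Rightarrow> 'z::comm_monoid_add" by simp
  have "past_step {p} (\<lambda>_. v) = (\<lambda>x. indicator {0<..p} x *\<^sub>R v)"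
    unfolding past_step_def[abs_def] single ..
  moreover have "past_int {p} (\<lambda>_. v) T = (\<lambda>w. v \<bullet> (W p w - W 0 w))"
    unfolding past_int_def[abs_def] using assms by (simp add: min_absorb1)
  ultimately show ?thesis
    unfolding elementary_def using assms by (intro exI[of _ "{p}"] exI[of _ "\<lambda>_. v"]) simp
qed

lemma elementary_L2: "elementary g G \<Longrightarrow> L2 \<Lambda> g"
  using past_step_L2 by (auto simp: elementary_def)

lemma elementary_measurable: "elementary g G \<Longrightarrow> G \<in> borel_measurable M"
proof -
  assume "elementary g G"
  then obtain P c where P: "finite P" "P \<subseteq> {0..T}" "G = past_int P c T" by (auto simp: elementary_def)
  show ?thesis unfolding P(3) by (rule F_measurable_M[OF past_int_measurable[OF P(2)]]) (use T_nonneg in auto)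
qed

text \<open>Truncation moves each node \<open>p\<close> to \<open>min p s\<close>. Several nodes may
  collapse onto \<open>s\<close>, so the result is assembled from single intervals rather than from
  a new node set.\<close>

lemma past_int_elem:
  assumes P: "finite P" "P \<subseteq> {0..T}" and s: "s \<in> {0..T}"
  shows "elementary (trunc s (past_step P c)) (past_int P c s)"
proof -
  have "(trunc s (past_step P c)) = (\<lambda>x. \<Sum>p\<in>P. indicator {0<..min p s} x *\<^sub>R c p)"
    unfolding past_step_def scaleR_sum_right by (intro ext sum.cong refl) (auto simp: indicator_def)
  moreover have "elementary (\<lambda>x. \<Sum>p\<in>P. indicator {0<..min p s} x *\<^sub>R c p) (\<lambda>w. \<Sum>p\<in>P. c p \<bullet> (W (min p s) w - W 0 w))"
    by (intro elementary_sum elementary_single) (use P s in auto)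
  ultimately show ?thesis by (simp add: past_int_def[abs_def])
qed

text \<open>The balance at \<open>s = 0\<close> on the whole space: the stopped integral is
  identically zero, and so is the truncated step function because its intervals exclude 0.\<close>

lemma elementary_exp:
  assumes "elementary g G"
  shows "integrable M (\<lambda>w. exp (G w))" "(\<integral>w. exp (G w) \<partial>M) = exp (msq \<Lambda> g / 2)"
proof -
  obtain P c where P: "finite P" "P \<subseteq> {0..T}" and g: "g = past_step P c" "G = past_int P c T" using assms(1) by (auto simp: elementary_def)
  show "integrable M (\<lambda>w. exp (G w))" unfolding g by (rule past_int_exp_integrable[OF P])
  have 0: "0 \<in> {0..T}" "space M \<in> sets (\<F> 0)" using T_nonneg sets.top[of "\<F> 0"] by auto
  have z: "indicator {0..0} x *\<^sub>R past_step P c x = 0" for x by (auto simp: past_step_def indicator_def intro!: sum.neutral)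
  have z': "past_int P c 0 = (\<lambda>w. 0)" using P by (auto simp: past_int_def fun_eq_iff min_absorb2 intro!: sum.neutral)
  have ind: "(\<integral>w. indicator (space M) w * f w \<partial>M) = (\<integral>w. f w \<partial>M)" for f :: "'a \<Rightarrow> real"
    by (rule Bochner_Integration.integral_cong) auto
  have "(\<integral>w. exp (G w) \<partial>M) * exp (- msq \<Lambda> g / 2) = 1"
    using past_int_exp[OF P 0, of c] unfolding g z z' ind by (simp add: prob_space)
  then show "(\<integral>w. exp (G w) \<partial>M) = exp (msq \<Lambda> g / 2)"
    by (simp add: exp_minus field_simps)
qed

text \<open>The isometry follows since the moment generating function identifies the law as normal.\<close>

lemma elementary_normal:
  assumes e: "elementary g G"
  shows "L2 M G" "(\<integral>w. (G w)\<^sup>2 \<partial>M) = msq \<Lambda> g" "(\<integral>w. G w \<partial>M) = 0"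
proof -
  define v where "v = msq \<Lambda> g"
  have v0: "0 \<le> v" by (simp add: v_def)
  note [measurable] = elementary_measurable[OF e]
  have int: "integrable M (\<lambda>w. exp (u * G w))" and mgf: "(\<integral>w. exp (u * G w) \<partial>M) = exp (u\<^sup>2 * v / 2)" for u
    using elementary_exp[OF elementary_scaleR[OF e, of u]] by (simp_all add: v_def power_mult_distrib)
  have "integrable M (\<lambda>w. (G w)\<^sup>2)"
  proof (rule Bochner_Integration.integrable_bound)
    show "integrable M (\<lambda>w. 2 * (exp (G w) + exp (- G w)))" using int[of 1] int[of "-1"] by simp
    show "AE w in M. norm ((G w)\<^sup>2) \<le> norm (2 * (exp (G w) + exp (- G w)))"
      using sq_le_exp by (intro AE_I2) (simp add: abs_of_pos add_pos_pos)
  qed simp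
  then show L2: "L2 M G" by (simp add: L2_def)
  have "(\<integral>w. (G w)\<^sup>2 \<partial>M) = v \<and> (\<integral>w. G w \<partial>M) = 0"
  proof (cases "v = 0")
    case True
    \<comment> \<open>With variance zero there is no density. Instead \<open>exp (G / 2) - 1\<close>
      has second moment 1 - 2 + 1 = 0, which forces \<open>G = 0\<close> almost surely.\<close>
    have i2: "integrable M (\<lambda>w. (exp (1/2 * G w) - 1)\<^sup>2)" and "(\<integral>w. (exp (1/2 * G w) - 1)\<^sup>2 \<partial>M) = 0"
    proof -
      have eq: "(exp (1/2 * G w) - 1)\<^sup>2 = exp (1 * G w) - 2 * exp (1/2 * G w) + 1" for w
        by (simp add: power2_eq_square algebra_simps exp_add[symmetric])
      show "integrable M (\<lambda>w. (exp (1/2 * G w) - 1)\<^sup>2)"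
        unfolding eq by (intro Bochner_Integration.integrable_add Bochner_Integration.integrable_diff integrable_mult_right int) simp
      have "(\<integral>w. exp (1 * G w) - 2 * exp (1/2 * G w) + 1 \<partial>M) = (\<integral>w. exp (1 * G w) \<partial>M) - 2 * (\<integral>w. exp (1/2 * G w) \<partial>M) + 1"
        using int[of 1] int[of "1/2"] by (simp add: prob_space)
      then show "(\<integral>w. (exp (1/2 * G w) - 1)\<^sup>2 \<partial>M) = 0" unfolding eq mgf True by simp
    qed
    then have "AE w in M. (exp (1/2 * G w) - 1)\<^sup>2 = 0" using integral_nonneg_eq_0_iff_AE[OF i2] by simp
    then have G0: "AE w in M. G w = 0" by eventually_elim simp
    have "(\<integral>w. (G w)\<^sup>2 \<partial>M) = 0" "(\<integral>w. G w \<partial>M) = 0"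
      by (rule integral_eq_zero_AE, use G0 in \<open>eventually_elim, simp\<close>)+
    then show ?thesis using True by simp
  next
    case False
    then have v: "0 < v" "0 < sqrt v" using v0 by auto
    have "real_distribution (distr M borel G)"
      using prob_space_distr[of G borel] by (simp add: real_distribution_def real_distribution_axioms_def)
    then have "distr M borel G = density lborel (\<lambda>x. ennreal (normal_density 0 (sqrt v) x))"
      by (rule gaussian_mgf_unique[OF _ v(1)]) (use int mgf in \<open>simp_all add: integrable_distr_eq integral_distr\<close>)
    moreover have "distr M lborel G = distr M borel G" by (rule distr_cong) auto
    ultimately have d: "distributed M lborel G (\<lambda>x. ennreal (normal_density 0 (sqrt v) x))"
      by (simp add: distributed_def)
    show ?thesis using normal_distributed_variance[OF v(2) d] normal_distributed_expectation[OF v(2) d] v0 by simp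
  qed
  then show "(\<integral>w. (G w)\<^sup>2 \<partial>M) = msq \<Lambda> g" "(\<integral>w. G w \<partial>M) = 0"
    by (simp_all add: v_def)
qed

text \<open>By linearity it suffices to treat one node; if it lies after \<open>s\<close>, the
  increment beyond \<open>s\<close> is centred and independent of \<open>A\<close>.\<close>

lemma past_int_martingale:
  assumes P: "finite P" "P \<subseteq> {0..T}" and s: "s \<in> {0..T}" and A: "A \<in> sets (\<F> s)"
  shows "(\<integral>w. indicator A w * past_int P c T w \<partial>M) = (\<integral>w. indicator A w * past_int P c s w \<partial>M)"
proof -
  have AM: "A \<in> sets M" by (rule F_sets[OF s A])
  have int: "integrable M (\<lambda>w. indicator A w * (c p \<bullet> (W q w - W 0 w)))" if "q \<in> {0..T}" for p q
    using integrable_mult_indicator[OF AM L2_integrable[OF elementary_normal(1)[OF elementary_single[OF that, of "c p"]]]] by simp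
  have eq: "(\<integral>w. indicator A w * (c p \<bullet> (W p w - W 0 w)) \<partial>M)
      = (\<integral>w. indicator A w * (c p \<bullet> (W (min p s) w - W 0 w)) \<partial>M)" if p: "p \<in> P" for p
  proof (cases "p \<le> s")
    case True then show ?thesis by simp
  next
    case False
    have pT: "p \<in> {0..T}" "s < p" using P p False by auto
    have e: "elementary (\<lambda>x. indicator {0<..p} x *\<^sub>R c p - indicator {0<..s} x *\<^sub>R c p) (\<lambda>w. c p \<bullet> (W p w - W s w))"
      using elementary_diff[OF elementary_single[OF pT(1), of "c p"] elementary_single[OF s, of "c p"]]
      by (simp add: inner_diff_right)
    have "(\<integral>w. indicator A w * (c p \<bullet> (W p w - W 0 w)) \<partial>M) - (\<integral>w. indicator A w * (c p \<bullet> (W s w - W 0 w)) \<partial>M)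
       = (\<integral>w. indicator A w * (c p \<bullet> (W p w - W s w)) \<partial>M)"
      by (subst Bochner_Integration.integral_diff[OF int[OF pT(1)] int[OF s], symmetric])
        (simp add: inner_diff_right algebra_simps)
    also have "\<dots> = (\<integral>w. indicator A w \<partial>M) * (\<integral>w. c p \<bullet> (W p w - W s w) \<partial>M)"
      using A AM by (intro increment_indep(2)[where h="\<lambda>x. c p \<bullet> x", OF s pT])
        (auto intro!: integrable_real_indicator L2_integrable[OF elementary_normal(1)[OF e]] simp: emeasure_eq_measure)
    also have "\<dots> = 0" using elementary_normal(3)[OF e] by simp
    finally show ?thesis using pT by simp
  qed
  have "(\<integral>w. indicator A w * past_int P c T w \<partial>M) = (\<Sum>p\<in>P. \<integral>w. indicator A w * (c p \<bullet> (W p w - W 0 w)) \<partial>M)"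
  proof -
    have "past_int P c T w = (\<Sum>p\<in>P. c p \<bullet> (W p w - W 0 w))" for w
      unfolding past_int_def using P by (intro sum.cong) auto
    then show ?thesis unfolding sum_distrib_left using P
      by (simp only: sum_distrib_left, subst Bochner_Integration.integral_sum) (auto intro!: int)
  qed
  also have "\<dots> = (\<Sum>p\<in>P. \<integral>w. indicator A w * (c p \<bullet> (W (min p s) w - W 0 w)) \<partial>M)" by (intro sum.cong refl eq)
  also have "\<dots> = (\<integral>w. indicator A w * past_int P c s w \<partial>M)"
    unfolding past_int_def sum_distrib_left using P s
    by (subst Bochner_Integration.integral_sum) (auto intro!: int)
  finally show ?thesis .
qed

text \<open>Collects what relates \<open>X\<close>, with integrand \<open>f\<close>, to its value
  \<open>Y\<close> at time \<open>s\<close>: adaptedness, the martingale property and the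
  exponential one. They are bundled so that a single approximating sequence, hence a single
  \<open>Y\<close>, serves all three.\<close>

definition truncated_to :: "real \<Rightarrow> (real \<Rightarrow> real ^ 'n) \<Rightarrow> ('a \<Rightarrow> real) \<Rightarrow> ('a \<Rightarrow> real) \<Rightarrow> bool" where
  "truncated_to s f X Y \<longleftrightarrow> Y \<in> borel_measurable (\<F> s) \<and>
    (\<forall>A\<in>sets (\<F> s). (\<integral>w. indicator A w * X w \<partial>M) = (\<integral>w. indicator A w * Y w \<partial>M)) \<and>
    (\<forall>A\<in>sets (\<F> s).
      exp_balance A s f X Y)"

lemma elementary_truncate:
  assumes e: "elementary g G" and s: "s \<in> {0..T}"
  shows "\<exists>G'. elementary (trunc s g) G' \<and> truncated_to s g G G'"
proof -
  obtain P c where P: "finite P" "P \<subseteq> {0..T}" and g: "g = past_step P c" "G = past_int P c T" using e by (auto simp: elementary_def)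
  have "truncated_to s g G (past_int P c s)"
    using past_int_measurable[OF P(2) s, of c] past_int_martingale[OF P s, of _ c] past_int_exp[OF P s, of _ c]
    unfolding truncated_to_def g by blast
  then show ?thesis using past_int_elem[OF P s, of c] unfolding g by blast
qed

text \<open>Integrands live on all of [0, T]; an integral up to \<open>t\<close> is the case of a
  truncated integrand. \<open>X\<close> is determined by \<open>f\<close> only up to null sets, so
  no version is preferred.\<close>

definition wiener_limit :: "(real \<Rightarrow> real ^ 'n) \<Rightarrow> ('a \<Rightarrow> real) \<Rightarrow> bool" where
  "wiener_limit f X \<longleftrightarrow> (\<exists>g G. (\<forall>m. elementary (g m) (G m)) \<and> L2lim \<Lambda> g f \<and> L2lim M G X)"

lemma wiener_limitE:
  assumes "wiener_limit f X"
  obtains g G where "\<And>m. elementary (g m) (G m)" "L2lim \<Lambda> g f" "L2lim M G X"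
  using assms by (auto simp: wiener_limit_def)

lemma wiener_limit_L2: assumes "wiener_limit f X" shows "L2 \<Lambda> f" "L2 M X"
  using assms by (auto simp: wiener_limit_def L2lim_def)

lemma wiener_limitI: "(\<And>m. elementary (g m) (G m)) \<Longrightarrow> L2lim \<Lambda> g f \<Longrightarrow> L2lim M G X \<Longrightarrow> wiener_limit f X"
  unfolding wiener_limit_def by (intro exI[of _ g] exI[of _ G]) simp

lemma wiener_limit_add:
  assumes "wiener_limit f X" "wiener_limit h Y"
  shows "wiener_limit (\<lambda>x. f x + h x) (\<lambda>w. X w + Y w)"
proof -
  obtain g G where G: "\<And>m. elementary (g m) (G m)" "L2lim \<Lambda> g f" "L2lim M G X" by (rule wiener_limitE[OF assms(1)]) (rule that)
  obtain k K where K: "\<And>m. elementary (k m) (K m)" "L2lim \<Lambda> k h" "L2lim M K Y" by (rule wiener_limitE[OF assms(2)]) (rule that)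
  show ?thesis by (rule wiener_limitI[OF elementary_add[OF G(1) K(1)] L2lim_add[OF G(2) K(2)] L2lim_add[OF G(3) K(3)]])
qed

lemma wiener_limit_scaleR:
  assumes "wiener_limit f X"
  shows "wiener_limit (\<lambda>x. a *\<^sub>R f x) (\<lambda>w. a * X w)"
proof -
  obtain g G where G: "\<And>m. elementary (g m) (G m)" "L2lim \<Lambda> g f" "L2lim M G X" by (rule wiener_limitE[OF assms(1)]) (rule that)
  have "L2lim M (\<lambda>m w. a * G m w) (\<lambda>w. a * X w)" using L2lim_scaleR[OF G(3), of a] by simp
  then show ?thesis by (rule wiener_limitI[OF elementary_scaleR[OF G(1)] L2lim_scaleR[OF G(2)]])
qed

lemma wiener_limit_diff: "wiener_limit f X \<Longrightarrow> wiener_limit h Y \<Longrightarrow> wiener_limit (\<lambda>x. f x - h x) (\<lambda>w. X w - Y w)"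
  using wiener_limit_add[OF _ wiener_limit_scaleR[of h Y "-1"], of f X] by simp

lemma elementary_vint: "elementary g G \<Longrightarrow> wiener_limit g G"
  by (rule wiener_limitI[OF _ L2lim_const[OF elementary_L2] L2lim_const[OF elementary_normal(1)]])

lemma wiener_limit_sum:
  "(\<And>i. i \<in> I \<Longrightarrow> wiener_limit (f i) (X i)) \<Longrightarrow> wiener_limit (\<lambda>x. \<Sum>i\<in>I. f i x) (\<lambda>w. \<Sum>i\<in>I. X i w)"
  by (induction I rule: infinite_finite_induct) (simp_all add: elementary_vint elementary_zero wiener_limit_add)

lemma wiener_limit_isometry: assumes "wiener_limit f X" shows "(\<integral>w. (X w)\<^sup>2 \<partial>M) = msq \<Lambda> f"
  using assms
proof (rule wiener_limitE)
  fix g G assume e: "\<And>m. elementary (g m) (G m)" and g: "L2lim \<Lambda> g f" and G: "L2lim M G X"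
  show ?thesis
    using LIMSEQ_unique[OF L2lim_norm_sq[OF G]] L2lim_norm_sq[OF g] elementary_normal(2)[OF e] by simp
qed

lemma wiener_limit_mean: assumes "wiener_limit f X" shows "(\<integral>w. X w \<partial>M) = 0"
  using assms
proof (rule wiener_limitE)
  fix g G assume e: "\<And>m. elementary (g m) (G m)" and G: "L2lim M G X"
  have "L2 M (\<lambda>w. 1::real)" by (simp add: L2_def)
  from L2lim_inner[OF G this] show ?thesis by (simp add: elementary_normal(3)[OF e] LIMSEQ_const_iff)
qed

text \<open>Both sides say that a squared norm vanishes, and the isometry equates the two
  norms.\<close>

lemma wiener_limit_zero_iff:
  assumes f: "wiener_limit f X"
  shows "(AE w in M. X w = 0) \<longleftrightarrow> (AE x in \<Lambda>. f x = 0)"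
proof -
  have "(AE w in M. X w = 0) \<longleftrightarrow> (\<integral>w. (X w)\<^sup>2 \<partial>M) = 0"
    using wiener_limit_L2(2)[OF f] by (subst integral_nonneg_eq_0_iff_AE) (auto simp: L2_def)
  also have "\<dots> \<longleftrightarrow> msq \<Lambda> f = 0" by (simp add: wiener_limit_isometry[OF f])
  also have "\<dots> \<longleftrightarrow> (AE x in \<Lambda>. f x = 0)"
    using wiener_limit_L2(1)[OF f] by (subst integral_nonneg_eq_0_iff_AE) (auto simp: L2_def)
  finally show ?thesis .
qed

lemma wiener_limit_unique:
  assumes "wiener_limit f X" "wiener_limit h Y"
  shows "(AE w in M. X w = Y w) \<longleftrightarrow> (AE x in \<Lambda>. f x = h x)"
  using wiener_limit_zero_iff[OF wiener_limit_diff[OF assms]] by simp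

text \<open>The isometry transports the Cauchy property from integrands to integrals.\<close>

lemma elementary_seq_converges:
  assumes e: "\<And>m. elementary (g m) (G m)" and g: "L2lim \<Lambda> g f"
  obtains X where "L2lim M G X"
proof (rule L2_complete[OF elementary_normal(1)[OF e]])
  fix \<epsilon> :: real assume "\<epsilon> > 0"
  then show "\<exists>N. \<forall>m\<ge>N. \<forall>l\<ge>N. msq M (\<lambda>w. G m w - G l w) < \<epsilon>"
    using L2lim_Cauchy[OF g] elementary_normal(2)[OF elementary_diff[OF e e]] by simp
qed

text \<open>The preimages under \<open>X\<close> and \<open>Y\<close> differ only inside the null
  set where the variables disagree. The part of a preimage of \<open>X\<close> in that set is
  measurable for \<open>M\<close>, hence a null set and an event of \<open>\<F> s\<close>.\<close>

lemma F_measurable_AE_eq: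
  fixes X Y :: "'a \<Rightarrow> real"
  assumes s: "s \<in> {0..T}" and X: "X \<in> borel_measurable M" and Y: "Y \<in> borel_measurable (\<F> s)"
    and ae: "AE w in M. X w = Y w"
  shows "X \<in> borel_measurable (\<F> s)"
proof (rule measurableI)
  fix B :: "real set" assume B: "B \<in> sets borel"
  have YM: "Y \<in> borel_measurable M" by (rule F_measurable_M[OF Y s])
  define N where "N = {w \<in> space M. X w \<noteq> Y w}"
  have N: "N \<in> null_sets M" using ae X YM by (auto simp: N_def AE_iff_null)
  have "X -` B \<inter> N \<in> null_sets M"
  proof (rule null_sets_subset[OF N])
    have "X -` B \<inter> space M \<inter> N \<in> sets M" using measurable_sets[OF X B] N by auto
    moreover have "X -` B \<inter> space M \<inter> N = X -` B \<inter> N" by (auto simp: N_def)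
    ultimately show "X -` B \<inter> N \<in> sets M" by simp
  qed auto
  then have "(Y -` B \<inter> space M) - N \<union> (X -` B \<inter> N) \<in> sets (\<F> s)"
    using null_sets_le[OF s] N measurable_sets[OF Y B] by auto
  moreover have "X -` B \<inter> space (\<F> s) = (Y -` B \<inter> space M) - N \<union> (X -` B \<inter> N)" by (auto simp: N_def)
  ultimately show "X -` B \<inter> space (\<F> s) \<in> sets (\<F> s)" by simp
qed simp

lemma L2lim_F_measurable:
  assumes s: "s \<in> {0..T}" and G: "L2lim M G X" and m: "\<And>m. G m \<in> borel_measurable (\<F> s)"
  shows "(X :: 'a \<Rightarrow> real) \<in> borel_measurable (\<F> s)"
proof -
  obtain r :: "nat \<Rightarrow> nat" where r: "AE w in M. (\<lambda>m. G (r m) w) \<longlonglongrightarrow> X w" using L2lim_AE_subseq[OF G] by metis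
  have "(\<lambda>w. lim (\<lambda>i. G (r i) w)) \<in> borel_measurable (\<F> s)" by (rule borel_measurable_lim_metric) (rule m)
  then show ?thesis
    by (rule F_measurable_AE_eq[OF s L2_measurable[OF L2limD(2)[OF G]]]) (use r in eventually_elim, simp add: limI)
qed

text \<open>Expanding the square gives the means of \<open>exp (G m)\<close>, of
  \<open>exp (G l)\<close> and of the exponential of the midpoint \<open>(G m + G l) / 2\<close>,
  all explicit. The parallelogram law expresses the variance of the midpoint by
  \<open>|g m|^2\<close>, \<open>|g l|^2\<close> and \<open>|g m - g l|^2\<close>, and in the limit
  the terms cancel. The exponent is halved because the square of \<open>exp (G / 2)\<close> is the
  exponential whose mean is known.\<close>

lemma exp_half_Cauchy:
  assumes e: "\<And>m. elementary (g m) (G m)" and g: "L2lim \<Lambda> g f" and \<epsilon>: "\<epsilon> > 0"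
  shows "\<exists>N. \<forall>m\<ge>N. \<forall>l\<ge>N. msq M (\<lambda>w. exp (G m w / 2) - exp (G l w / 2)) < \<epsilon>"
proof -
  define v where "v m = msq \<Lambda> (g m)" for m
  define d where "d m l = msq \<Lambda> (\<lambda>x. g m x - g l x)" for m l
  have w: "msq \<Lambda> (\<lambda>x. (1/2) *\<^sub>R (g m x + g l x)) = v m / 2 + v l / 2 - d m l / 4" for m l
  proof -
    have "msq \<Lambda> (\<lambda>x. (1/2) *\<^sub>R (g m x + g l x))
        = (\<integral>x. (norm (g m x))\<^sup>2 / 2 + (norm (g l x))\<^sup>2 / 2 - (norm (g m x - g l x))\<^sup>2 / 4 \<partial>\<Lambda>)"
      by (intro Bochner_Integration.integral_cong refl norm_midpoint_sq)
    also have "\<dots> = v m / 2 + v l / 2 - d m l / 4"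
      using L2_norm_sq_integrable[OF elementary_L2[OF e]] L2_norm_sq_integrable[OF L2_diff[OF elementary_L2[OF e[of m]] elementary_L2[OF e[of l]]]]
      by (simp add: v_def d_def)
    finally show ?thesis .
  qed
  have eq: "msq M (\<lambda>w. exp (G m w / 2) - exp (G l w / 2))
      = exp (v m / 2) + exp (v l / 2) - 2 * exp ((v m / 2 + v l / 2 - d m l / 4) / 2)" for m l
  proof -
    have ee: "elementary (\<lambda>x. (1/2) *\<^sub>R (g m x + g l x)) (\<lambda>w. 1/2 * (G m w + G l w))"
      by (rule elementary_scaleR[OF elementary_add[OF e e]])
    have "(norm (exp (G m w / 2) - exp (G l w / 2)))\<^sup>2
        = exp (G m w) + exp (G l w) - 2 * exp (1/2 * (G m w + G l w))" for w
      by (simp add: power2_eq_square algebra_simps exp_add[symmetric] add_divide_distrib)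
    then have "msq M (\<lambda>w. exp (G m w / 2) - exp (G l w / 2))
        = (\<integral>w. exp (G m w) \<partial>M) + (\<integral>w. exp (G l w) \<partial>M) - 2 * (\<integral>w. exp (1/2 * (G m w + G l w)) \<partial>M)"
      using elementary_exp(1)[OF e] elementary_exp(1)[OF ee] by simp
    then show ?thesis unfolding elementary_exp(2)[OF e] elementary_exp(2)[OF ee] w by (simp add: v_def)
  qed
  define V where "V = msq \<Lambda> f"
  \<comment> \<open>A joint limit: what holds eventually for this filter holds for all
    \<open>m\<close>, \<open>l\<close> beyond a common \<open>N\<close>.\<close>
  let ?F = "sequentially \<times>\<^sub>F sequentially"
  have vlim: "v \<longlonglongrightarrow> V" unfolding v_def[abs_def] V_def by (rule L2lim_norm_sq[OF g])
  have v1: "((\<lambda>z. v (fst z)) \<longlongrightarrow> V) ?F" by (rule filterlim_compose[OF vlim filterlim_fst])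
  have v2: "((\<lambda>z. v (snd z)) \<longlongrightarrow> V) ?F" by (rule filterlim_compose[OF vlim filterlim_snd])
  have dlim: "((\<lambda>z. d (fst z) (snd z)) \<longlongrightarrow> 0) ?F"
  proof (rule tendstoI)
    fix \<epsilon> :: real assume "\<epsilon> > 0"
    then obtain N where "\<forall>m\<ge>N. \<forall>l\<ge>N. d m l < \<epsilon>" using L2lim_Cauchy[OF g] unfolding d_def by blast
    then show "\<forall>\<^sub>F z in ?F. dist (d (fst z) (snd z)) 0 < \<epsilon>"
      unfolding eventually_prod_sequentially by (intro exI[of _ N]) (auto simp: d_def)
  qed
  have "((\<lambda>z. exp (v (fst z) / 2) + exp (v (snd z) / 2) - 2 * exp ((v (fst z) / 2 + v (snd z) / 2 - d (fst z) (snd z) / 4) / 2))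
     \<longlongrightarrow> exp (V / 2) + exp (V / 2) - 2 * exp ((V / 2 + V / 2 - 0 / 4) / 2)) ?F"
    by (intro tendsto_intros v1 v2 dlim) simp_all
  then have "((\<lambda>z. exp (v (fst z) / 2) + exp (v (snd z) / 2) - 2 * exp ((v (fst z) / 2 + v (snd z) / 2 - d (fst z) (snd z) / 4) / 2))
     \<longlongrightarrow> 0) ?F" by simp
  from order_tendstoD(2)[OF this \<epsilon>] show ?thesis
    unfolding eventually_prod_sequentially eq by auto
qed

text \<open>An almost sure limit along a subsequence identifies the L2-limit of
  \<open>exp (G / 2)\<close> as \<open>exp (X / 2)\<close>. Convergence of squared norms then gives
  convergence of the integrals of \<open>exp G\<close> over any event, an indicator being its own
  square.\<close>

lemma elementary_exp_converges:
  assumes e: "\<And>m. elementary (g m) (G m)" and g: "L2lim \<Lambda> g f" and G: "L2lim M G X"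
  shows "integrable M (\<lambda>w. exp (X w))"
    and "A \<in> sets M \<Longrightarrow> (\<lambda>m. \<integral>w. indicator A w * exp (G m w) \<partial>M) \<longlonglongrightarrow> (\<integral>w. indicator A w * exp (X w) \<partial>M)"
proof -
  obtain r :: "nat \<Rightarrow> nat" where r: "strict_mono r" "AE w in M. (\<lambda>m. G (r m) w) \<longlonglongrightarrow> X w"
    using L2lim_AE_subseq[OF G] by metis
  note [measurable] = elementary_measurable[OF e] L2_measurable[OF L2limD(2)[OF G]]
  have sq: "(exp (x / 2))\<^sup>2 = exp x" for x :: real by (simp add: power2_eq_square exp_add[symmetric])
  have lim: "L2lim M (\<lambda>m w. exp (G m w / 2)) (\<lambda>w. exp (X w / 2))"
  proof (rule L2lim_of_Cauchy_AE[OF _ _ exp_half_Cauchy[OF e g] r(1)])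
    show "L2 M (\<lambda>w. exp (G m w / 2))" for m using elementary_exp(1)[OF e] by (simp add: L2_def sq)
    show "AE w in M. (\<lambda>m. exp (G (r m) w / 2)) \<longlonglongrightarrow> exp (X w / 2)"
      using r(2) by eventually_elim (intro tendsto_intros; simp)
  qed simp_all
  from L2limD(2)[OF lim] show "integrable M (\<lambda>w. exp (X w))" by (simp add: L2_def sq)
  show "(\<lambda>m. \<integral>w. indicator A w * exp (G m w) \<partial>M) \<longlonglongrightarrow> (\<integral>w. indicator A w * exp (X w) \<partial>M)" if A: "A \<in> sets M"
  proof -
    have L: "L2 M (\<lambda>w. indicator A w * h w)" if "L2 M h" for h :: "'a \<Rightarrow> real"
    proof -
      note [measurable] = L2_measurable[OF that] A
      have "integrable M (\<lambda>w. (norm (indicator A w * h w))\<^sup>2)"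
        by (rule Bochner_Integration.integrable_bound[OF L2_norm_sq_integrable[OF that]]) (auto simp: indicator_def)
      then show ?thesis by (simp add: L2_def)
    qed
    have "L2lim M (\<lambda>m w. indicator A w * exp (G m w / 2)) (\<lambda>w. indicator A w * exp (X w / 2))"
      unfolding L2lim_def
    proof (intro conjI allI L L2limD[OF lim])
      show "(\<lambda>m. \<integral>w. (norm (indicator A w * exp (G m w / 2) - indicator A w * exp (X w / 2)))\<^sup>2 \<partial>M) \<longlonglongrightarrow> 0"
      proof (rule tendsto_zero_squeeze[OF L2limD(3)[OF lim]])
        fix m
        have d: "L2 M (\<lambda>w. exp (G m w / 2) - exp (X w / 2))" by (rule L2_diff[OF L2limD(1,2)[OF lim]])
        show "msq M (\<lambda>w. indicator A w * exp (G m w / 2) - indicator A w * exp (X w / 2))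
            \<le> msq M (\<lambda>w. exp (G m w / 2) - exp (X w / 2))"
          using L2_norm_sq_integrable[OF L[OF d]] L2_norm_sq_integrable[OF d]
          by (intro integral_mono) (auto simp: right_diff_distrib[symmetric] indicator_def)
      qed simp
    qed
    moreover have "(indicator A w)\<^sup>2 = (indicator A w :: real)" for w by (simp add: indicator_def)
    ultimately show ?thesis using L2lim_norm_sq by (fastforce simp: power_mult_distrib sq)
  qed
qed

text \<open>Truncation does not increase L2-norms, so truncated approximations converge and the
  isometry yields a limit \<open>Y\<close> of their integrals. Adaptedness survives along a
  subsequence, the means by continuity of the inner product with an indicator, the balance by
  convergence of exponentials.\<close>

lemma wiener_limit_truncate:
  assumes f: "wiener_limit f X" and s: "s \<in> {0..T}"
  shows "\<exists>Y. wiener_limit (trunc s f) Y \<and> truncated_to s f X Y"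
proof -
  obtain g G where e: "\<And>m. elementary (g m) (G m)" and g: "L2lim \<Lambda> g f" and G: "L2lim M G X" by (rule wiener_limitE[OF f]) (rule that)
  obtain G' where e': "\<And>m. elementary (\<lambda>x. indicator {0..s} x *\<^sub>R g m x) (G' m)"
    and G': "\<And>m. truncated_to s (g m) (G m) (G' m)"
    using elementary_truncate[OF e s] by metis
  have g': "L2lim \<Lambda> (\<lambda>m x. indicator {0..s} x *\<^sub>R g m x) (trunc s f)"
    unfolding L2lim_def
  proof (intro conjI allI restrict_L2 L2limD[OF g])
    show "(\<lambda>m. \<integral>x. (norm (indicator {0..s} x *\<^sub>R g m x - indicator {0..s} x *\<^sub>R f x))\<^sup>2 \<partial>\<Lambda>) \<longlonglongrightarrow> 0"
    proof (rule tendsto_zero_squeeze[OF L2limD(3)[OF g]])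
      fix m
      have d: "L2 \<Lambda> (\<lambda>x. g m x - f x)" by (rule L2_diff[OF L2limD(1,2)[OF g]])
      show "msq \<Lambda> (\<lambda>x. indicator {0..s} x *\<^sub>R g m x - indicator {0..s} x *\<^sub>R f x)
          \<le> msq \<Lambda> (\<lambda>x. g m x - f x)"
        using L2_norm_sq_integrable[OF restrict_L2[OF d, of s]] L2_norm_sq_integrable[OF d]
        by (intro integral_mono) (auto simp: scaleR_diff_right[symmetric] indicator_def)
    qed simp
  qed
  obtain Y where Y: "L2lim M G' Y" using elementary_seq_converges[OF e' g'] .
  have "truncated_to s f X Y"
    unfolding truncated_to_def
  proof (intro conjI ballI)
    show "Y \<in> borel_measurable (\<F> s)"
      by (rule L2lim_F_measurable[OF s Y]) (use G' in \<open>simp add: truncated_to_def\<close>)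
    fix A assume A: "A \<in> sets (\<F> s)"
    have AM: "A \<in> sets M" by (rule F_sets[OF s A])
    have ind: "L2 M (indicator A :: 'a \<Rightarrow> real)" using AM by (intro L2_bounded[where B=1]) (auto simp: indicator_def)
    have m1: "(\<integral>w. indicator A w * G m w \<partial>M) = (\<integral>w. indicator A w * G' m w \<partial>M)" for m
      using G'[of m] A by (simp add: truncated_to_def)
    have m2: "(\<integral>w. indicator A w * exp (G m w) \<partial>M) * exp (- msq \<Lambda> (g m) / 2)
     = (\<integral>w. indicator A w * exp (G' m w) \<partial>M)
         * exp (- msq \<Lambda> (\<lambda>x. indicator {0..s} x *\<^sub>R g m x) / 2)" for m
      using G'[of m] A unfolding truncated_to_def by blast
    have "(\<lambda>m. \<integral>w. indicator A w * G m w \<partial>M) \<longlonglongrightarrow> (\<integral>w. indicator A w * Y w \<partial>M)"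
      unfolding m1 using L2lim_inner[OF Y ind] by (simp add: mult.commute)
    moreover have "(\<lambda>m. \<integral>w. indicator A w * G m w \<partial>M) \<longlonglongrightarrow> (\<integral>w. indicator A w * X w \<partial>M)"
      using L2lim_inner[OF G ind] by (simp add: mult.commute)
    ultimately show "(\<integral>w. indicator A w * X w \<partial>M) = (\<integral>w. indicator A w * Y w \<partial>M)"
      using LIMSEQ_unique by metis
    have "(\<lambda>m. (\<integral>w. indicator A w * exp (G m w) \<partial>M) * exp (- msq \<Lambda> (g m) / 2))
      \<longlonglongrightarrow> (\<integral>w. indicator A w * exp (X w) \<partial>M) * exp (- msq \<Lambda> f / 2)"
      by (rule tendsto_mult[OF elementary_exp_converges(2)[OF e g G AM]
            tendsto_exp[OF tendsto_divide[OF tendsto_minus[OF L2lim_norm_sq[OF g]] tendsto_const]]]) simp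
    moreover have "(\<lambda>m. (\<integral>w. indicator A w * exp (G m w) \<partial>M) * exp (- msq \<Lambda> (g m) / 2))
      \<longlonglongrightarrow> (\<integral>w. indicator A w * exp (Y w) \<partial>M)
        * exp (- msq \<Lambda> (trunc s f) / 2)"
      unfolding m2
      by (rule tendsto_mult[OF elementary_exp_converges(2)[OF e' g' Y AM]
            tendsto_exp[OF tendsto_divide[OF tendsto_minus[OF L2lim_norm_sq[OF g']] tendsto_const]]]) simp
    ultimately show "exp_balance A s f X Y"
      by (rule LIMSEQ_unique)
  qed
  then show ?thesis using wiener_limitI[OF e' g' Y] by blast
qed

lemma wiener_limit_exp_integrable: "wiener_limit f X \<Longrightarrow> integrable M (\<lambda>w. exp (X w))"
  by (erule wiener_limitE) (rule elementary_exp_converges(1))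

end

context wiener_space
begin

section \<open>Wiener integrals as \<open>L\<^sup>2\<close>-limits\<close>

text \<open>An integral up to \<open>t\<close> is defined with Lebesgue measure on [0, t], whereas
  \<open>wiener_limit\<close> always refers to [0, T]; extension by zero translates between the
  two.\<close>

lemma lebesgue_on_subinterval:
  assumes "t \<in> {0..T}"
  shows "lebesgue_on {0..t} = restrict_space \<Lambda> {0..t}" "{0..t} \<inter> space \<Lambda> \<in> sets \<Lambda>"
proof -
  have "{0..T} \<inter> {0..t} = {0..t}" using assms by auto
  then show "lebesgue_on {0..t} = restrict_space \<Lambda> {0..t}" by (subst restrict_restrict_space) auto
  show "{0..t} \<inter> space \<Lambda> \<in> sets \<Lambda>" by (auto simp: sets_restrict_space)
qed

lemma integral_subinterval:
  fixes f :: "real \<Rightarrow> 'b::{banach, second_countable_topology}"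
  assumes "t \<in> {0..T}"
  shows "(\<integral>x. f x \<partial>lebesgue_on {0..t}) = (\<integral>x. indicator {0..t} x *\<^sub>R f x \<partial>\<Lambda>)"
  unfolding lebesgue_on_subinterval(1)[OF assms] by (rule integral_restrict_space[OF lebesgue_on_subinterval(2)[OF assms]])

lemma set_integral_lebesgue:
  fixes f :: "real \<Rightarrow> 'b::{banach, second_countable_topology}"
  assumes "t \<in> {0..T}"
  shows "(LINT x:{0..t}|lebesgue. f x) = (\<integral>x. indicator {0..t} x *\<^sub>R f x \<partial>\<Lambda>)"
  unfolding integral_subinterval[OF assms, symmetric] set_lebesgue_integral_def
  by (subst integral_restrict_space) auto

lemma norm_indicator_sq: "(norm (indicator A x *\<^sub>R a))\<^sup>2 = indicator A x *\<^sub>R (norm a)\<^sup>2"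
  for a :: "'b::real_normed_vector"
  by (auto simp: indicator_def)

lemma L2_subinterval:
  fixes f :: "real \<Rightarrow> 'b::euclidean_space"
  assumes "t \<in> {0..T}"
  shows "L2 (lebesgue_on {0..t}) f \<longleftrightarrow> L2 \<Lambda> (trunc t f)"
  unfolding L2_def lebesgue_on_subinterval(1)[OF assms] norm_indicator_sq
    borel_measurable_restrict_space_iff[OF lebesgue_on_subinterval(2)[OF assms]]
    integrable_restrict_space[OF lebesgue_on_subinterval(2)[OF assms]] ..

lemma L2lim_subinterval:
  fixes f :: "real \<Rightarrow> 'b::euclidean_space"
  assumes "t \<in> {0..T}"
  shows "L2lim (lebesgue_on {0..t}) fs f \<longleftrightarrow>
    L2lim \<Lambda> (\<lambda>m x. indicator {0..t} x *\<^sub>R fs m x) (trunc t f)"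
  unfolding L2lim_def L2_subinterval[OF assms] integral_subinterval[OF assms] scaleR_diff_right[symmetric]
    norm_indicator_sq ..

text \<open>The \<open>i\<close>-th component is integrated through vector integrands along
  \<open>axis i 1\<close>. Since the nodes increase, the indicator of a cell is a difference of two
  intervals starting at 0, and \<open>W 0\<close> cancels.\<close>

lemma step_elem:
  assumes t: "t \<in> {0..T}" and p: "\<forall>k\<le>N. p k \<in> {0..t}" "\<forall>k<N. p k \<le> p (Suc k)"
  shows "elementary (\<lambda>x. step_function p c N x *\<^sub>R axis i 1) (step_integral (\<lambda>s w. W s w $ i) p c N)"
    and "indicator {0..t} x *\<^sub>R (step_function p c N x *\<^sub>R (axis i 1 :: real ^ 'n)) = step_function p c N x *\<^sub>R axis i 1"
proof -
  have pT: "p k \<in> {0..T}" if "k \<le> N" for k using p(1) t that by force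
  have "elementary (\<lambda>x. \<Sum>k<N. c k *\<^sub>R (indicator {0<..p (Suc k)} x *\<^sub>R axis i 1 - indicator {0<..p k} x *\<^sub>R axis i 1))
     (\<lambda>w. \<Sum>k<N. c k * (axis i 1 \<bullet> (W (p (Suc k)) w - W 0 w) - axis i 1 \<bullet> (W (p k) w - W 0 w)))"
    by (intro elementary_sum elementary_scaleR elementary_diff elementary_single pT) auto
  moreover have "(\<lambda>x. \<Sum>k<N. c k *\<^sub>R (indicator {0<..p (Suc k)} x *\<^sub>R axis i 1 - indicator {0<..p k} x *\<^sub>R axis i 1))
     = (\<lambda>x. step_function p c N x *\<^sub>R (axis i 1 :: real ^ 'n))"
    unfolding step_function_def scaleR_sum_left
  proof (intro ext sum.cong refl)
    fix x k assume "k \<in> {..<N}"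
    then have "p k \<le> p (Suc k)" "0 \<le> p k" using p by auto
    then have "indicator {0<..p (Suc k)} x - indicator {0<..p k} x = (indicator {p k<..p (Suc k)} x :: real)"
      by (auto simp: indicator_def)
    then show "c k *\<^sub>R (indicator {0<..p (Suc k)} x *\<^sub>R axis i 1 - indicator {0<..p k} x *\<^sub>R axis i 1)
       = (c k * indicator {p k<..p (Suc k)} x) *\<^sub>R (axis i 1 :: real ^ 'n)"
      by (simp only: scaleR_diff_left[symmetric] scaleR_scaleR)
  qed
  moreover have "(\<lambda>w. \<Sum>k<N. c k * (axis i 1 \<bullet> (W (p (Suc k)) w - W 0 w) - axis i 1 \<bullet> (W (p k) w - W 0 w)))
     = step_integral (\<lambda>s w. W s w $ i) p c N"
    by (simp add: step_integral_def fun_eq_iff inner_axis' algebra_simps)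
  ultimately show "elementary (\<lambda>x. step_function p c N x *\<^sub>R axis i 1) (step_integral (\<lambda>s w. W s w $ i) p c N)" by simp
  have "step_function p c N x = 0" if "x \<notin> {0..t}"
    unfolding step_function_def
  proof (intro sum.neutral ballI)
    fix k assume "k \<in> {..<N}"
    then have "p k \<in> {0..t}" "p (Suc k) \<in> {0..t}" using p by auto
    then show "c k * indicator {p k<..p (Suc k)} x = 0" using that by (auto simp: indicator_def)
  qed
  then show "indicator {0..t} x *\<^sub>R (step_function p c N x *\<^sub>R (axis i 1 :: real ^ 'n)) = step_function p c N x *\<^sub>R axis i 1"
    by (cases "x \<in> {0..t}") auto
qed

lemma L2lim_step_axis:
  assumes t: "t \<in> {0..T}"
    and p: "\<And>m. \<forall>k\<le>N m. p m k \<in> {0..t}" "\<And>m. \<forall>k<N m. p m k \<le> p m (Suc k)"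
    and lim: "L2lim (lebesgue_on {0..t}) (\<lambda>m. step_function (p m) (c m) (N m)) f"
  shows "L2lim \<Lambda> (\<lambda>m x. step_function (p m) (c m) (N m) x *\<^sub>R axis i 1)
    (\<lambda>x. indicator {0..t} x *\<^sub>R (f x *\<^sub>R (axis i 1 :: real ^ 'n)))"
  using L2lim_scaleR_const[OF lim, of "axis i 1 :: real ^ 'n"]
  unfolding L2lim_subinterval[OF t] step_elem(2)[OF t p] .

lemma nn_set_integral_lebesgue:
  "(\<integral>\<^sup>+ s\<in>{0..t}. f s \<partial>lebesgue) = (\<integral>\<^sup>+ s. f s \<partial>lebesgue_on {0..t::real})"
  by (subst nn_integral_restrict_space) auto

lemma L2lim_step_iff:
  assumes "L2 (lebesgue_on {0..t}) f"
  shows "L2lim (lebesgue_on {0..t}) (\<lambda>m. step_function (p m) (c m) (N m)) f \<longleftrightarrow>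
    (\<lambda>m. \<integral>\<^sup>+ s\<in>{0..t}. ennreal ((f s - step_function (p m) (c m) (N m) s)\<^sup>2) \<partial>lebesgue) \<longlonglongrightarrow> 0"
  by (simp add: L2lim_nn_iff[OF step_function_L2 assms] nn_set_integral_lebesgue power2_commute)

lemma has_wiener_integral_vint:
  assumes t: "t \<in> {0..T}" and X: "has_wiener_integral M (\<lambda>s w. W s w $ i) f t X"
  shows "wiener_limit (\<lambda>x. indicator {0..t} x *\<^sub>R (f x *\<^sub>R axis i 1)) X"
proof -
  have f: "L2 (lebesgue_on {0..t}) f" and Xm[measurable]: "X \<in> borel_measurable M"
    using X by (auto simp: has_wiener_integral_def L2_lebesgue_on_iff)
  obtain p c N where p: "\<And>m. \<forall>k\<le>N m. p m k \<in> {0..t}" "\<And>m. \<forall>k<N m. p m k \<le> p m (Suc k)"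
    and 1: "(\<lambda>m. \<integral>\<^sup>+ s\<in>{0..t}. ennreal ((f s - step_function (p m) (c m) (N m) s)\<^sup>2) \<partial>lebesgue) \<longlonglongrightarrow> 0"
    and 2: "(\<lambda>m. \<integral>\<^sup>+ w. ennreal ((X w - step_integral (\<lambda>s w. W s w $ i) (p m) (c m) (N m) w)\<^sup>2) \<partial>M) \<longlonglongrightarrow> 0"
    using X unfolding has_wiener_integral_def by blast
  let ?G = "\<lambda>m. step_integral (\<lambda>s w. W s w $ i) (p m) (c m) (N m)"
  have e: "elementary (\<lambda>x. step_function (p m) (c m) (N m) x *\<^sub>R axis i 1)
      (step_integral (\<lambda>s w. W s w $ i) (p m) (c m) (N m))" for m
    by (rule step_elem(1)[OF t p])
  note G = elementary_normal(1)[OF e]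
  have lim: "L2lim (lebesgue_on {0..t}) (\<lambda>m. step_function (p m) (c m) (N m)) f"
    unfolding L2lim_step_iff[OF f] by (rule 1)
  \<comment> \<open>Square integrability of \<open>X\<close> is not part of
    \<open>has_wiener_integral\<close>; it follows since \<open>X\<close> has finite distance to
    some elementary integral.\<close>
  have "L2 M X"
  proof -
    obtain m where "(\<integral>\<^sup>+ w. ennreal ((X w - ?G m w)\<^sup>2) \<partial>M) < 1"
      using order_tendstoD(2)[OF 2, of 1] by (auto simp: eventually_sequentially)
    then have "L2 M (\<lambda>w. X w - ?G m w)"
      using L2_measurable[OF G[of m]] by (auto simp: L2_def integrable_iff_bounded intro: less_trans[OF _ ennreal_one_less_top])
    from L2_add[OF this G[of m]] show ?thesis by simp
  qed
  then have "L2lim M ?G X" using 2 by (simp add: L2lim_nn_iff[OF G] power2_commute)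
  then show ?thesis by (rule wiener_limitI[OF e L2lim_step_axis[OF t p lim]])
qed

text \<open>Density supplies step functions at squared distance below 1 / (m + 1), and the isometry
  a limit of their integrals. This makes the choice by \<open>SOME\<close> meaningful.\<close>

lemma has_wiener_integral_exists:
  assumes t: "t \<in> {0..T}" and f: "square_integrable_on f {0..t}"
  shows "\<exists>X. has_wiener_integral M (\<lambda>s w. W s w $ i) f t X"
proof -
  have f2: "L2 (lebesgue_on {0..t}) f" using f by (simp add: L2_lebesgue_on_iff)
  have "\<forall>m. \<exists>p c N. (\<forall>k\<le>N. p k \<in> {0..t}) \<and> (\<forall>k<N. p k \<le> p (Suc k)) \<and>
     msq (lebesgue_on {0..t}) (\<lambda>s. f s - step_function p c N s) < inverse (real (Suc m))"
    using step_functions_dense[OF _ f2] t unfolding step_dist_def by simp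
  from this[unfolded choice_iff]
  obtain p c N where "\<forall>m. (\<forall>k\<le>N m. p m k \<in> {0..t}) \<and> (\<forall>k<N m. p m k \<le> p m (Suc k)) \<and>
     msq (lebesgue_on {0..t}) (\<lambda>s. f s - step_function (p m) (c m) (N m) s) < inverse (real (Suc m))"
    by (elim exE) (rule that)
  then have p: "\<And>m. \<forall>k\<le>N m. p m k \<in> {0..t}" "\<And>m. \<forall>k<N m. p m k \<le> p m (Suc k)"
    and d: "\<And>m. msq (lebesgue_on {0..t}) (\<lambda>s. f s - step_function (p m) (c m) (N m) s) < inverse (real (Suc m))"
    by simp_all
  have lim: "L2lim (lebesgue_on {0..t}) (\<lambda>m. step_function (p m) (c m) (N m)) f"
    unfolding L2lim_def
  proof (intro conjI allI step_function_L2 f2)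
    show "(\<lambda>m. \<integral>s. (norm (step_function (p m) (c m) (N m) s - f s))\<^sup>2 \<partial>lebesgue_on {0..t}) \<longlonglongrightarrow> 0"
    proof (rule tendsto_zero_squeeze[OF LIMSEQ_inverse_real_of_nat])
      fix m
      have "msq (lebesgue_on {0..t}) (\<lambda>s. step_function (p m) (c m) (N m) s - f s)
         = msq (lebesgue_on {0..t}) (\<lambda>s. f s - step_function (p m) (c m) (N m) s)"
        by (intro Bochner_Integration.integral_cong refl arg_cong[where f="\<lambda>x. x\<^sup>2"] norm_minus_commute)
      then show "msq (lebesgue_on {0..t}) (\<lambda>s. step_function (p m) (c m) (N m) s - f s) \<le> inverse (real (Suc m))"
        using d[of m] by linarith
    qed simp
  qed
  have e: "elementary (\<lambda>x. step_function (p m) (c m) (N m) x *\<^sub>R axis i 1)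
      (step_integral (\<lambda>s w. W s w $ i) (p m) (c m) (N m))" for m
    by (rule step_elem(1)[OF t p])
  obtain X where X: "L2lim M (\<lambda>m. step_integral (\<lambda>s w. W s w $ i) (p m) (c m) (N m)) X"
    using elementary_seq_converges[OF e L2lim_step_axis[OF t p lim]] .
  have "(\<lambda>m. \<integral>\<^sup>+ w. ennreal ((X w - step_integral (\<lambda>s w. W s w $ i) (p m) (c m) (N m) w)\<^sup>2) \<partial>M) \<longlonglongrightarrow> 0"
    using X by (simp add: L2lim_nn_iff[OF L2limD(1,2)[OF X]] power2_commute)
  moreover have "(\<lambda>m. \<integral>\<^sup>+ s\<in>{0..t}. ennreal ((f s - step_function (p m) (c m) (N m) s)\<^sup>2) \<partial>lebesgue) \<longlonglongrightarrow> 0"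
    using lim by (simp only: L2lim_step_iff[OF f2])
  ultimately show ?thesis
    unfolding has_wiener_integral_def using f L2_measurable[OF L2limD(2)[OF X]] p by blast
qed

text \<open>The only place where the version chosen by \<open>SOME\<close> is examined: whichever it
  is, it is a limit of elementary integrals, and the components add up.\<close>

lemma wiener_integral_vint:
  fixes f :: "real \<Rightarrow> real ^ 'n"
  assumes t: "t \<in> {0..T}" and f: "\<And>i. square_integrable_on (\<lambda>s. f s $ i) {0..t}"
  shows "wiener_limit (trunc t f) (wint f t)"
proof -
  have "wiener_limit (\<lambda>x. indicator {0..t} x *\<^sub>R (f x $ i *\<^sub>R axis i 1)) (wiener_integral M (\<lambda>s \<eta>. W s \<eta> $ i) (\<lambda>s. f s $ i) t)" for i
    unfolding wiener_integral_def
    by (rule has_wiener_integral_vint[OF t someI_ex[OF has_wiener_integral_exists[OF t f]]])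
  from wiener_limit_sum[of UNIV, OF this]
  have "wiener_limit (\<lambda>x. \<Sum>i\<in>UNIV. indicator {0..t} x *\<^sub>R (f x $ i *\<^sub>R axis i 1)) (wint f t)"
    by (simp add: vector_wiener_integral_def[abs_def])
  moreover have "(\<Sum>i\<in>UNIV. indicator {0..t} x *\<^sub>R (f x $ i *\<^sub>R axis i 1)) = indicator {0..t} x *\<^sub>R f x" for x
    by (simp add: vec_eq_iff scaleR_sum_right[symmetric] axis_def if_distrib cong: if_cong)
  ultimately show ?thesis by simp
qed

end

lemma square_integrable_on_nth:
  fixes f :: "real \<Rightarrow> real ^ 'n"
  assumes "square_integrable_on f {0..t}"
  shows "square_integrable_on (\<lambda>s. f s $ i) {0..t}"
proof -
  have f: "L2 (lebesgue_on {0..t}) f" using assms by (simp add: L2_lebesgue_on_iff)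
  then have m: "(\<lambda>s. f s $ i) \<in> borel_measurable (lebesgue_on {0..t})"
    by (intro measurable_compose[OF L2_measurable[OF f]]) simp
  have "integrable (lebesgue_on {0..t}) (\<lambda>s. (norm (f s $ i))\<^sup>2)"
    by (rule Bochner_Integration.integrable_bound[OF L2_norm_sq_integrable[OF f]])
      (use m component_le_norm_cart[of "f _" i] in \<open>auto simp: abs_le_square_iff[symmetric]\<close>)
  then show ?thesis using m by (simp add: L2_lebesgue_on_iff[symmetric] L2_def)
qed

text \<open>Kernels are square integrable coordinate by coordinate, whereas inner products with
  \<open>\<theta>\<close> call for the whole vector.\<close>

lemma square_integrable_on_vec:
  fixes f :: "real \<Rightarrow> real ^ 'n"
  assumes "\<And>i. square_integrable_on (\<lambda>s. f s $ i) {0..t}"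
  shows "square_integrable_on f {0..t}"
proof -
  have "L2 (lebesgue_on {0..t}) (\<lambda>s. \<Sum>i\<in>UNIV. f s $ i *\<^sub>R (axis i 1 :: real ^ 'n))"
    using assms by (intro L2_sum L2_scaleR_const) (simp add: L2_lebesgue_on_iff)
  moreover have "(\<Sum>i\<in>UNIV. f s $ i *\<^sub>R (axis i 1 :: real ^ 'n)) = f s" for s
    by (simp add: vec_eq_iff axis_def if_distrib cong: if_cong)
  ultimately show ?thesis by (simp add: L2_lebesgue_on_iff)
qed

lemma square_integrable_on_subset:
  fixes f :: "real \<Rightarrow> 'b::euclidean_space"
  assumes "square_integrable_on f {0..t}" "s \<le> t"
  shows "square_integrable_on f {0..s}"
proof -
  have "set_borel_measurable lebesgue {0..s} f"
    by (rule set_borel_measurable_subset[of lebesgue "{0..t}" f]) (use assms in \<open>auto simp: square_integrable_on_def\<close>)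
  moreover have "set_integrable lebesgue {0..s} (\<lambda>x. (norm (f x))\<^sup>2)"
    by (rule set_integrable_subset[of lebesgue "{0..t}"]) (use assms in \<open>auto simp: square_integrable_on_def\<close>)
  ultimately show ?thesis by (simp add: square_integrable_on_def)
qed

section \<open>Independent Gaussian increments from exponential moments\<close>

context prob_space
begin

text \<open>The exponential factors are replaced by indicators one coordinate at a time: all the other
  factors form a nonnegative weight, under which the coordinate has a Gaussian moment generating
  function.\<close>

lemma gaussian_vector_product:
  fixes X :: "'a \<Rightarrow> real ^ 'n"
  assumes X: "X \<in> borel_measurable M" and A: "A \<in> events" and \<delta>: "0 < \<delta>"
    and int: "\<And>u. integrable M (\<lambda>\<omega>. indicator A \<omega> * exp (u \<bullet> X \<omega>))"
    and mgf: "\<And>u. (\<integral>\<omega>. indicator A \<omega> * exp (u \<bullet> X \<omega>) \<partial>M) = prob A * exp ((norm u)\<^sup>2 * \<delta> / 2)"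
    and B: "\<And>j. B j \<in> sets borel"
  defines "\<gamma> \<equiv> density lborel (\<lambda>x. ennreal (normal_density 0 (sqrt \<delta>) x))"
  shows "prob (A \<inter> (\<Inter>j. X -` {x. x $ j \<in> B j})) = prob A * (\<Prod>j\<in>UNIV. measure \<gamma> (B j))"
proof -
  have Xj[measurable]: "(\<lambda>\<omega>. X \<omega> $ j) \<in> borel_measurable M" for j
    by (rule measurable_compose[OF X]) simp
  note [measurable] = A B
  define Y where "Y J u \<omega> = indicator A \<omega> * (\<Prod>j\<in>J. indicator (B j) (X \<omega> $ j)) * exp (\<Sum>j\<in>-J. u $ j * X \<omega> $ j)"
    for J and u :: "real ^ 'n" and \<omega>
  have Ym[measurable]: "Y J u \<in> borel_measurable M" for J u unfolding Y_def[abs_def] by measurable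
  have Y0: "0 \<le> Y J u \<omega>" for J u \<omega> unfolding Y_def by (intro mult_nonneg_nonneg prod_nonneg) auto
  have main: "\<forall>u. integrable M (Y J u) \<and>
      (\<integral>\<omega>. Y J u \<omega> \<partial>M) = prob A * (\<Prod>j\<in>J. measure \<gamma> (B j)) * exp ((\<Sum>j\<in>-J. (u $ j)\<^sup>2) * \<delta> / 2)"
    if "finite J" for J :: "'n set"
    using that
  proof induction
    case empty
    have "exp (\<Sum>j\<in>UNIV. u $ j * X \<omega> $ j) = exp (u \<bullet> X \<omega>)" for u \<omega> by (simp add: inner_vec_def)
    moreover have "(\<Sum>j\<in>UNIV. (u $ j)\<^sup>2) = (norm u)\<^sup>2" for u :: "real ^ 'n"
      unfolding power2_norm_eq_inner inner_vec_def by (simp add: power2_eq_square)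
    ultimately show ?case using int mgf by (simp add: Y_def[abs_def])
  next
    case (insert k J)
    show ?case
    proof
      fix u :: "real ^ 'n"
      define w where "w \<omega> = indicator A \<omega> * (\<Prod>j\<in>J. indicator (B j) (X \<omega> $ j)) * exp (\<Sum>j\<in>- insert k J. u $ j * X \<omega> $ j)" for \<omega>
      define C where "C = prob A * (\<Prod>j\<in>J. measure \<gamma> (B j)) * exp ((\<Sum>j\<in>- insert k J. (u $ j)\<^sup>2) * \<delta> / 2)"
      have wm[measurable]: "w \<in> borel_measurable M" unfolding w_def[abs_def] by measurable
      have w0: "0 \<le> w \<omega>" for \<omega> unfolding w_def by (intro mult_nonneg_nonneg prod_nonneg) auto
      \<comment> \<open>Only the \<open>k\<close>-th exponent varies; as \<open>v\<close> ranges
        over the reals, the formula for \<open>J\<close> becomes the moment generating function of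
        the \<open>k\<close>-th coordinate under the weight \<open>w\<close>.\<close>
      define u' where "u' v = (\<chi> j. if j = k then v else u $ j)" for v
      have split: "(\<Sum>j\<in>- J. f j) = f k + (\<Sum>j\<in>- insert k J. f j)" for f :: "'n \<Rightarrow> real"
      proof -
        have "- J = insert k (- insert k J)" using insert.hyps by auto
        then show ?thesis by simp
      qed
      have Yw: "Y J (u' v) = (\<lambda>\<omega>. w \<omega> * exp (v * X \<omega> $ k))" for v
      proof
        fix \<omega>
        have "(\<Sum>j\<in>- insert k J. u' v $ j * X \<omega> $ j) = (\<Sum>j\<in>- insert k J. u $ j * X \<omega> $ j)"
          by (rule sum.cong) (auto simp: u'_def)
        then show "Y J (u' v) \<omega> = w \<omega> * exp (v * X \<omega> $ k)" by (simp add: Y_def w_def split exp_add u'_def)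
      qed
      have Cv: "prob A * (\<Prod>j\<in>J. measure \<gamma> (B j)) * exp ((\<Sum>j\<in>-J. (u' v $ j)\<^sup>2) * \<delta> / 2) = C * exp (v\<^sup>2 * \<delta> / 2)" for v
      proof -
        have "(\<Sum>j\<in>- insert k J. (u' v $ j)\<^sup>2) = (\<Sum>j\<in>- insert k J. (u $ j)\<^sup>2)"
          by (rule sum.cong) (auto simp: u'_def)
        then show ?thesis by (simp add: C_def split u'_def distrib_right add_divide_distrib exp_add)
      qed
      have wi: "integrable M (\<lambda>\<omega>. w \<omega> * exp (v * X \<omega> $ k))"
        and wint: "(\<integral>\<omega>. w \<omega> * exp (v * X \<omega> $ k) \<partial>M) = C * exp (v\<^sup>2 * \<delta> / 2)" for v
        using insert.IH[rule_format, of "u' v"] unfolding Yw Cv by blast+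
      have eq: "Y (insert k J) u \<omega> = w \<omega> * indicator (B k) (X \<omega> $ k)" for \<omega>
        using insert.hyps by (simp add: Y_def w_def)
      have "integrable M (Y (insert k J) u)"
      proof (rule Bochner_Integration.integrable_bound)
        show "integrable M w" using wi[of 0] by simp
        show "AE \<omega> in M. norm (Y (insert k J) u \<omega>) \<le> norm (w \<omega>)"
          unfolding eq using w0 by (intro AE_I2) (auto simp: indicator_def)
      qed simp
      moreover have "(\<integral>\<omega>. Y (insert k J) u \<omega> \<partial>M) = C * measure \<gamma> (B k)"
        unfolding eq \<gamma>_def by (rule weighted_gaussian_mgf[OF Xj wm B w0 \<delta> wi wint])
      ultimately show "integrable M (Y (insert k J) u) \<and> (\<integral>\<omega>. Y (insert k J) u \<omega> \<partial>M) =
          prob A * (\<Prod>j\<in>insert k J. measure \<gamma> (B j)) * exp ((\<Sum>j\<in>- insert k J. (u $ j)\<^sup>2) * \<delta> / 2)"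
        using insert.hyps by (simp add: C_def)
    qed
  qed
  have meas: "A \<inter> (\<Inter>j. X -` {x. x $ j \<in> B j}) \<in> events"
  proof -
    have "A \<inter> (\<Inter>j. X -` {x. x $ j \<in> B j}) = A \<inter> {\<omega> \<in> space M. \<forall>j. X \<omega> $ j \<in> B j}"
      using sets.sets_into_space[OF A] by auto
    also have "\<dots> \<in> events" by measurable
    finally show ?thesis .
  qed
  have "Y UNIV 0 \<omega> = indicator (A \<inter> (\<Inter>j. X -` {x. x $ j \<in> B j})) \<omega>" for \<omega>
  proof (cases "\<forall>j. X \<omega> $ j \<in> B j")
    case True
    then show ?thesis by (simp add: Y_def indicator_def)
  next
    case False
    then have "(\<Prod>j\<in>UNIV. indicator (B j) (X \<omega> $ j)) = (0::real)" by (auto simp: indicator_def)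
    then show ?thesis using False by (auto simp: Y_def indicator_def)
  qed
  then have "(\<integral>\<omega>. Y UNIV 0 \<omega> \<partial>M) = (\<integral>\<omega>. indicator (A \<inter> (\<Inter>j. X -` {x. x $ j \<in> B j})) \<omega> \<partial>M)"
    by presburger
  also have "\<dots> = prob (A \<inter> (\<Inter>j. X -` {x. x $ j \<in> B j}))"
    using sets.sets_into_space[OF meas] by (simp only: Bochner_Integration.integral_indicator Int_absorb2)
  finally show ?thesis using main[of UNIV] by simp
qed

text \<open>On the whole space the product formula gives the marginal laws and their independence.
  On an event of \<open>G\<close>, with half-lines as coordinate sets, it gives independence from
  lower orthants, an intersection-stable generator of the Borel sets.\<close>

lemma gaussian_increment:
  fixes X :: "'a \<Rightarrow> real ^ 'n"
  assumes X: "X \<in> borel_measurable M" and G: "subalgebra M G" and \<delta>: "0 < \<delta>"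
    and int: "\<And>A u. A \<in> sets G \<Longrightarrow> integrable M (\<lambda>\<omega>. indicator A \<omega> * exp (u \<bullet> X \<omega>))"
    and mgf: "\<And>A u. A \<in> sets G \<Longrightarrow>
      (\<integral>\<omega>. indicator A \<omega> * exp (u \<bullet> X \<omega>) \<partial>M) = prob A * exp ((norm u)\<^sup>2 * \<delta> / 2)"
  shows "indep_set (sets G) {X -` B \<inter> space M | B. B \<in> sets borel}"
    and "indep_vars (\<lambda>_. borel) (\<lambda>i \<omega>. X \<omega> $ i) UNIV"
    and "distributed M lborel (\<lambda>\<omega>. X \<omega> $ i) (\<lambda>x. ennreal (normal_density 0 (sqrt \<delta>) x))"
proof -
  define \<gamma> where "\<gamma> = density lborel (\<lambda>x. ennreal (normal_density 0 (sqrt \<delta>) x))"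
  have "prob_space \<gamma>" using \<delta> by (simp add: \<gamma>_def prob_space_normal_density)
  then interpret \<gamma>: prob_space \<gamma> .
  have \<gamma>1: "measure \<gamma> UNIV = 1" using \<gamma>.prob_space by (simp add: \<gamma>_def)
  have GM: "A \<in> sets G \<Longrightarrow> A \<in> events" for A using G by (auto simp: subalgebra_def)
  have sp: "space M \<in> sets G" using G sets.top[of G] by (simp add: subalgebra_def)
  have prod: "prob (A \<inter> (\<Inter>j. X -` {x. x $ j \<in> B j})) = prob A * (\<Prod>j\<in>UNIV. measure \<gamma> (B j))"
    if "A \<in> sets G" "\<And>j. B j \<in> sets borel" for A B
    unfolding \<gamma>_def by (rule gaussian_vector_product[OF X GM[OF that(1)] \<delta> int[OF that(1)] mgf[OF that(1)] that(2)])
  have Xj: "(\<lambda>\<omega>. X \<omega> $ j) \<in> borel_measurable M" for j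
    by (rule measurable_compose[OF X]) simp
  have marg: "prob (\<Inter>j\<in>J. (\<lambda>\<omega>. X \<omega> $ j) -` B j \<inter> space M) = (\<Prod>j\<in>J. measure \<gamma> (B j))"
    if J: "J \<noteq> {}" and B: "\<And>j. j \<in> J \<Longrightarrow> B j \<in> sets borel" for J B
  proof -
    \<comment> \<open>Coordinates outside \<open>J\<close> are left unconstrained; the whole line
      has mass one.\<close>
    define B' where "B' j = (if j \<in> J then B j else UNIV)" for j
    have "(\<Inter>j\<in>J. (\<lambda>\<omega>. X \<omega> $ j) -` B j \<inter> space M) = space M \<inter> (\<Inter>j. X -` {x. x $ j \<in> B' j})"
      using J by (auto simp: B'_def split: if_splits)
    also have "prob \<dots> = prob (space M) * (\<Prod>j\<in>UNIV. measure \<gamma> (B' j))"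
      by (rule prod[OF sp]) (simp add: B'_def B)
    also have "\<dots> = (\<Prod>j\<in>UNIV. if j \<in> J then measure \<gamma> (B j) else 1)"
      by (simp add: prob_space B'_def if_distrib \<gamma>1 cong: if_cong)
    also have "\<dots> = (\<Prod>j\<in>J. measure \<gamma> (B j))"
      by (rule prod.mono_neutral_cong_right) auto
    finally show ?thesis .
  qed
  have marg1: "prob ((\<lambda>\<omega>. X \<omega> $ i) -` B \<inter> space M) = measure \<gamma> B" if "B \<in> sets borel" for i B
    using marg[of "{i}" "\<lambda>_. B"] that by simp
  have "distr M lborel (\<lambda>\<omega>. X \<omega> $ i) = \<gamma>"
  proof (rule measure_eqI)
    fix B assume "B \<in> sets (distr M lborel (\<lambda>\<omega>. X \<omega> $ i))"
    then have B: "B \<in> sets borel" by simp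
    then show "emeasure (distr M lborel (\<lambda>\<omega>. X \<omega> $ i)) B = emeasure \<gamma> B"
      using marg1[OF B] Xj by (simp add: emeasure_distr emeasure_eq_measure \<gamma>.emeasure_eq_measure)
  qed (simp add: \<gamma>_def)
  then show "distributed M lborel (\<lambda>\<omega>. X \<omega> $ i) (\<lambda>x. ennreal (normal_density 0 (sqrt \<delta>) x))"
    using Xj by (simp add: distributed_def \<gamma>_def)
  show "indep_vars (\<lambda>_. borel) (\<lambda>i \<omega>. X \<omega> $ i) UNIV"
    unfolding indep_vars_def2
  proof (intro conjI ballI Xj indep_setsI)
    show "{(\<lambda>\<omega>. X \<omega> $ i) -` A \<inter> space M | A. A \<in> sets borel} \<subseteq> events" for i
      using measurable_sets[OF Xj[of i]] by blast
    fix A :: "'n \<Rightarrow> 'a set" and J :: "'n set"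
    assume J: "J \<noteq> {}" "finite J" and A: "\<forall>j\<in>J. A j \<in> {(\<lambda>\<omega>. X \<omega> $ j) -` A \<inter> space M | A. A \<in> sets borel}"
    then have "\<forall>j\<in>J. \<exists>B. A j = (\<lambda>\<omega>. X \<omega> $ j) -` B \<inter> space M \<and> B \<in> sets borel" by blast
    then obtain B where B: "\<And>j. j \<in> J \<Longrightarrow> A j = (\<lambda>\<omega>. X \<omega> $ j) -` B j \<inter> space M" "\<And>j. j \<in> J \<Longrightarrow> B j \<in> sets borel"
      unfolding bchoice_iff by blast
    have "(\<Inter>j\<in>J. A j) = (\<Inter>j\<in>J. (\<lambda>\<omega>. X \<omega> $ j) -` B j \<inter> space M)" using B(1) by (intro INF_cong refl)
    then have "prob (\<Inter>j\<in>J. A j) = (\<Prod>j\<in>J. measure \<gamma> (B j))" using marg[OF J(1) B(2)] by simp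
    also have "\<dots> = (\<Prod>j\<in>J. prob (A j))" using B by (intro prod.cong refl) (simp add: marg1)
    finally show "prob (\<Inter>j\<in>J. A j) = (\<Prod>j\<in>J. prob (A j))" .
  qed
  have borel: "sets borel = sigma_sets UNIV (range (\<lambda>a. {..a :: real ^ 'n}))"
    by (subst borel_eq_atMost) simp
  have pre: "X -` {..a} \<inter> space M = space M \<inter> (\<Inter>j. X -` {x. x $ j \<in> {..a $ j}})" for a
    by (auto simp: less_eq_vec_def)
  have ind: "indep_set (sets G) {X -` B \<inter> space M | B. B \<in> range (\<lambda>a. {..a :: real ^ 'n})}"
  proof (rule indep_setI)
    show "sets G \<subseteq> events" using GM by blast
    show "{X -` B \<inter> space M | B. B \<in> range (\<lambda>a. {..a :: real ^ 'n})} \<subseteq> events"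
      using measurable_sets[OF X] by auto
    fix A b assume A: "A \<in> sets G" and "b \<in> {X -` B \<inter> space M | B. B \<in> range (\<lambda>a. {..a :: real ^ 'n})}"
    then obtain a where b: "b = X -` {..a} \<inter> space M" by auto
    have "A \<inter> b = A \<inter> (\<Inter>j. X -` {x. x $ j \<in> {..a $ j}})"
      unfolding b pre using sets.sets_into_space[OF GM[OF A]] by auto
    then have "prob (A \<inter> b) = prob A * (\<Prod>j\<in>UNIV. measure \<gamma> {..a $ j})"
      using prod[OF A, of "\<lambda>j. {..a $ j}"] by simp
    moreover have "prob b = (\<Prod>j\<in>UNIV. measure \<gamma> {..a $ j})"
      unfolding b pre using prod[OF sp, of "\<lambda>j. {..a $ j}"] by (simp add: prob_space)
    ultimately show "prob (A \<inter> b) = prob A * prob b" by simp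
  qed
  have st: "Int_stable {X -` B \<inter> space M | B. B \<in> range (\<lambda>a. {..a :: real ^ 'n})}"
  proof (rule Int_stableI, clarify)
    fix a b :: "real ^ 'n"
    have "X -` {..a} \<inter> space M \<inter> (X -` {..b} \<inter> space M) = X -` {..inf a b} \<inter> space M" by auto
    then show "\<exists>B. X -` {..a} \<inter> space M \<inter> (X -` {..b} \<inter> space M) = X -` B \<inter> space M \<and> B \<in> range (\<lambda>a. {..a})"
      by blast
  qed
  have "indep_set (sigma_sets (space M) (sets G))
      (sigma_sets (space M) {X -` B \<inter> space M | B. B \<in> range (\<lambda>a. {..a :: real ^ 'n})})"
    by (rule indep_set_sigma_sets[OF ind sets.Int_stable st])
  moreover have "sigma_sets (space M) (sets G) = sets G"
    using G sets.sigma_sets_eq[of G] by (simp add: subalgebra_def)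
  moreover have "sigma_sets (space M) {X -` B \<inter> space M | B. B \<in> range (\<lambda>a. {..a :: real ^ 'n})}
      = {X -` B \<inter> space M | B. B \<in> sets borel}"
    unfolding borel by (rule sigma_sets_vimage_commute[symmetric]) simp
  ultimately show "indep_set (sets G) {X -` B \<inter> space M | B. B \<in> sets borel}" by simp
qed

end

text \<open>By Lebesgue's differentiation theorem \<open>h x\<close> is almost everywhere a limit of
  averages over [x, x + k], and these are zero as differences of vanishing integrals.\<close>

lemma AE_zero_of_integrals_zero:
  fixes h :: "real \<Rightarrow> real"
  assumes h: "set_integrable lebesgue {0..u} h"
    and 0: "\<And>t. t \<in> {0..<u} \<Longrightarrow> (LINT x:{0..t}|lebesgue. h x) = 0"
  shows "AE x in lebesgue. x \<in> {0..u} \<longrightarrow> h x = 0"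
proof -
  define H where "H x = (if x \<in> {0..u} then h x else 0)" for x
  have int_h: "h integrable_on {0..u}" by (rule set_lebesgue_integral_eq_integral(1)[OF h])
  have H: "H integrable_on cbox a b" for a b
  proof (rule integrable_on_subcbox[of _ UNIV])
    show "H integrable_on UNIV" using int_h integrable_restrict_UNIV[of "{0..u}" h] by (simp add: H_def[abs_def])
  qed simp
  have H0: "integral {0..t} H = 0" if t: "t \<in> {0..<u}" for t
  proof -
    have "set_integrable lebesgue {0..t} h" by (rule set_integrable_subset[OF h]) (use t in auto)
    then have "integral {0..t} h = 0" using 0[OF t] set_lebesgue_integral_eq_integral(2) by metis
    moreover have "integral {0..t} H = integral {0..t} h" by (rule integral_cong) (use t in \<open>auto simp: H_def\<close>)
    ultimately show ?thesis by simp
  qed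
  obtain N where N: "negligible N" and lim: "\<And>x e. \<lbrakk>x \<notin> N; 0 < e\<rbrakk> \<Longrightarrow>
     \<exists>d>0. \<forall>h. 0 < h \<and> h < d \<longrightarrow> norm (integral (cbox x (x + h *\<^sub>R One)) H /\<^sub>R h ^ DIM(real) - H x) < e"
    using integrable_ccontinuous_explicit[OF H] by metis
  have zero: "H x = 0" if x: "x \<notin> N" "x \<in> {0..<u}" for x
  proof (rule ccontr)
    assume "H x \<noteq> 0"
    then obtain d where d: "d > 0" "\<And>k. 0 < k \<Longrightarrow> k < d \<Longrightarrow> norm (integral {x..x + k} H /\<^sub>R k - H x) < \<bar>H x\<bar>"
      using lim[OF x(1), of "\<bar>H x\<bar>"] by auto
    \<comment> \<open>Small enough for the averaging estimate, and with \<open>x + k < u\<close>,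
      since integrals are known to vanish only before \<open>u\<close>.\<close>
    define k where "k = min (d / 2) ((u - x) / 2)"
    have k: "0 < k" "k < d" "x + k < u" using d(1) x(2) by (auto simp: k_def min_def field_simps)
    have "integral {0..x} H + integral {x..x + k} H = integral {0..x + k} H"
      using H[of 0 "x + k"] x k by (intro Henstock_Kurzweil_Integration.integral_combine) auto
    then have "integral {x..x + k} H = 0" using H0[of x] H0[of "x + k"] x k by auto
    then show False using d(2)[OF k(1,2)] by simp
  qed
  have "N \<union> {u} \<in> null_sets lebesgue"
    using N negligible_Un[OF N negligible_sing[of u]] by (simp add: negligible_iff_null_sets)
  then have "AE x in lebesgue. x \<notin> N \<union> {u}" by (rule AE_not_in)
  then show ?thesis by eventually_elim (use zero in \<open>force simp: H_def\<close>)
qed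

lemma AE_lebesgue_on_ne: "AE x in lebesgue_on A. x \<noteq> (a::real)" if "A \<in> sets lebesgue"
proof -
  have "AE x in lborel. x \<noteq> a" by (rule AE_lborel_singleton)
  then have "AE x in lebesgue. x \<noteq> a" by (rule AE_completion)
  then show ?thesis using that by (subst AE_restrict_space_iff) (auto elim: eventually_mono)
qed

context wiener_space
begin

section \<open>Conditional expectations and identification of integrands\<close>

text \<open>The integrals up to \<open>u\<close> and up to \<open>t\<close> come from unrelated
  choices. Uniqueness identifies the truncation of the former with the latter almost surely, and the
  null sets in the filtration make the chosen version adapted.\<close>

lemma wiener_truncate:
  fixes k :: "real \<Rightarrow> real ^ 'n"
  assumes tu: "0 \<le> t" "t \<le> u" "u \<le> T" and k: "\<And>i. square_integrable_on (\<lambda>s. k s $ i) {0..u}"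
  shows "truncated_to t (trunc u k) (wint k u) (wint k t)"
proof -
  have t: "t \<in> {0..T}" and u: "u \<in> {0..T}" using tu by auto
  have kt: "square_integrable_on (\<lambda>s. k s $ i) {0..t}" for i by (rule square_integrable_on_subset[OF k tu(2)])
  note It = wiener_integral_vint[OF t kt] and Iu = wiener_integral_vint[OF u k]
  obtain Y where Y: "wiener_limit (\<lambda>x. indicator {0..t} x *\<^sub>R (indicator {0..u} x *\<^sub>R k x)) Y"
    and tr: "truncated_to t (trunc u k) (wint k u) Y"
    using wiener_limit_truncate[OF Iu t] by blast
  have "(\<lambda>x. indicator {0..t} x *\<^sub>R (indicator {0..u} x *\<^sub>R k x)) = (trunc t k)"
    using tu by (auto simp: indicator_def fun_eq_iff)
  from wiener_limit_unique[OF It Y[unfolded this]]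
  have ae: "AE \<omega> in M. wint k t \<omega> = Y \<omega>" by simp
  have Im: "wint k t \<in> borel_measurable M" by (rule L2_measurable[OF wiener_limit_L2(2)[OF It]])
  have Ym: "Y \<in> borel_measurable (\<F> t)" using tr by (simp add: truncated_to_def)
  have IF: "wint k t \<in> borel_measurable (\<F> t)" by (rule F_measurable_AE_eq[OF t Im Ym ae])
  have YM: "Y \<in> borel_measurable M" by (rule F_measurable_M[OF Ym t])
  have "(\<integral>\<omega>. indicator A \<omega> * Y \<omega> \<partial>M) = (\<integral>\<omega>. indicator A \<omega> * wint k t \<omega> \<partial>M)"
    "(\<integral>\<omega>. indicator A \<omega> * exp (Y \<omega>) \<partial>M) = (\<integral>\<omega>. indicator A \<omega> * exp (wint k t \<omega>) \<partial>M)"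
    if "A \<in> sets (\<F> t)" for A
    by (rule integral_cong_AE, use F_sets[OF t that] YM Im ae in \<open>auto elim: eventually_mono\<close>)+
  then show ?thesis using tr IF unfolding truncated_to_def by simp
qed

lemma wiener_integral_F_measurable:
  fixes k :: "real \<Rightarrow> real ^ 'n"
  assumes "t \<in> {0..T}" "\<And>i. square_integrable_on (\<lambda>s. k s $ i) {0..t}"
  shows "wint k t \<in> borel_measurable (\<F> t)"
  using wiener_truncate[of t t k] assms by (simp add: truncated_to_def)

lemma wiener_integral_0:
  fixes k :: "real \<Rightarrow> real ^ 'n"
  assumes "\<And>i. square_integrable_on (\<lambda>s. k s $ i) {0..0}"
  shows "AE \<omega> in M. wint k 0 \<omega> = 0"
proof -
  have "0 \<in> {0..T}" using T_nonneg by simp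
  from wiener_limit_zero_iff[OF wiener_integral_vint[OF this assms]] show ?thesis
    using AE_lebesgue_on_ne[of "{0..T}" 0] by (auto elim!: eventually_mono)
qed

text \<open>The martingale property of Wiener integrals verifies the averages over events of
  \<open>\<F> t\<close> that characterise the conditional expectation.\<close>

lemma cond_exp_wiener_integral:
  fixes k :: "real \<Rightarrow> real ^ 'n"
  assumes tu: "0 \<le> t" "t \<le> u" "u \<le> T" and k: "\<And>i. square_integrable_on (\<lambda>s. k s $ i) {0..u}"
    and S: "S \<in> borel_measurable M" "AE \<omega> in M. S \<omega> = wint k u \<omega> + c"
  shows "integrable M S"
    and "AE \<omega> in M. real_cond_exp M (\<F> t) S \<omega> = wint k t \<omega> + c"
proof -
  have t: "t \<in> {0..T}" and u: "u \<in> {0..T}" using tu by auto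
  have kt: "square_integrable_on (\<lambda>s. k s $ i) {0..t}" for i by (rule square_integrable_on_subset[OF k tu(2)])
  have Iu: "integrable M (wint k u)"
    by (rule L2_integrable[OF wiener_limit_L2(2)[OF wiener_integral_vint[OF u k]]])
  have It: "integrable M (wint k t)"
    by (rule L2_integrable[OF wiener_limit_L2(2)[OF wiener_integral_vint[OF t kt]]])
  have Iuc: "integrable M (\<lambda>\<omega>. wint k u \<omega> + c)" using Iu by simp
  show Si: "integrable M S"
    by (rule integrable_cong_AE_imp[OF Iuc S(1)]) (use S(2) in \<open>auto elim: eventually_mono\<close>)
  interpret sub: finite_measure "restr_to_subalg M (\<F> t)"
    by (rule finite_measure_restr_to_subalg[OF subalg[OF t]]) (rule finite_measure_axioms)
  interpret sigma_finite_subalgebra M "\<F> t"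
    by (intro sigma_finite_subalgebra.intro subalg[OF t]) (rule sub.sigma_finite_measure_axioms)
  show "AE \<omega> in M. real_cond_exp M (\<F> t) S \<omega> = wint k t \<omega> + c"
  proof (rule real_cond_exp_charact)
    fix A assume A: "A \<in> sets (\<F> t)"
    have AM: "A \<in> sets M" by (rule F_sets[OF t A])
    have i: "integrable M (\<lambda>\<omega>. indicator A \<omega> * X \<omega>)" if "integrable M X" for X :: "'a \<Rightarrow> real"
      using integrable_mult_indicator[OF AM that] by simp
    have "(\<integral>\<omega>\<in>A. S \<omega> \<partial>M) = (\<integral>\<omega>. indicator A \<omega> * wint k u \<omega> + indicator A \<omega> * c \<partial>M)"
      unfolding set_lebesgue_integral_def
      by (rule integral_cong_AE) (use AM S Iu in \<open>auto elim!: eventually_mono simp: distrib_left\<close>)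
    also have "\<dots> = (\<integral>\<omega>. indicator A \<omega> * wint k u \<omega> \<partial>M) + (\<integral>\<omega>. indicator A \<omega> * c \<partial>M)"
      by (rule Bochner_Integration.integral_add[OF i[OF Iu] i]) simp
    also have "\<dots> = (\<integral>\<omega>. indicator A \<omega> * wint k t \<omega> \<partial>M) + (\<integral>\<omega>. indicator A \<omega> * c \<partial>M)"
      using wiener_truncate[OF tu k] A by (simp add: truncated_to_def)
    also have "\<dots> = (\<integral>\<omega>. indicator A \<omega> * wint k t \<omega> + indicator A \<omega> * c \<partial>M)"
      by (rule Bochner_Integration.integral_add[OF i[OF It] i, symmetric]) simp
    finally show "(\<integral>\<omega>\<in>A. S \<omega> \<partial>M) = (\<integral>\<omega>\<in>A. wint k t \<omega> + c \<partial>M)"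
      by (simp add: set_lebesgue_integral_def distrib_left)
  next
    show "integrable M (\<lambda>\<omega>. wint k t \<omega> + c)" using It by simp
    show "(\<lambda>\<omega>. wint k t \<omega> + c) \<in> borel_measurable (\<F> t)"
      using wiener_integral_F_measurable[OF t kt] by simp
  qed (rule Si)
qed

text \<open>At a fixed time the difference of the stochastic integrals equals a constant, which vanishes since
  Wiener integrals are centred.\<close>

lemma ito_coefficients_unique:
  fixes v w :: "real \<Rightarrow> real ^ 'n"
  assumes u: "0 < u" "u \<le> T"
    and a: "set_integrable lebesgue {0..u} a" and b: "set_integrable lebesgue {0..u} b"
    and v: "\<And>i. square_integrable_on (\<lambda>s. v s $ i) {0..u}" and w: "\<And>i. square_integrable_on (\<lambda>s. w s $ i) {0..u}"
    and eq: "\<And>t. t \<in> {0..<u} \<Longrightarrow> AE \<omega> in M.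
      (LINT s:{0..t}|lebesgue. a s) + wint v t \<omega> =
      (LINT s:{0..t}|lebesgue. b s) + wint w t \<omega>"
  shows "AE s in lebesgue. s \<in> {0..u} \<longrightarrow> a s = b s \<and> v s = w s"
proof -
  have *: "(LINT s:{0..t}|lebesgue. a s) = (LINT s:{0..t}|lebesgue. b s) \<and>
      (AE s in lebesgue. s \<in> {0..t} \<longrightarrow> v s = w s)" if t: "t \<in> {0..<u}" for t
  proof -
    have tT: "t \<in> {0..T}" "t \<le> u" using t u by auto
    define c where "c = (LINT s:{0..t}|lebesgue. b s) - (LINT s:{0..t}|lebesgue. a s)"
    have vw: "wiener_limit (\<lambda>x. indicator {0..t} x *\<^sub>R v x - indicator {0..t} x *\<^sub>R w x)
        (\<lambda>\<omega>. wint v t \<omega> - wint w t \<omega>)"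
      by (intro wiener_limit_diff wiener_integral_vint tT square_integrable_on_subset[OF v tT(2)]
          square_integrable_on_subset[OF w tT(2)])
    have ae: "AE \<omega> in M. wint v t \<omega> - wint w t \<omega> = c"
      using eq[OF t] by eventually_elim (auto simp: c_def)
    have "c = (\<integral>\<omega>. c \<partial>M)" by (simp add: prob_space)
    also have "\<dots> = (\<integral>\<omega>. wint v t \<omega> - wint w t \<omega> \<partial>M)"
      by (rule integral_cong_AE) (use ae L2_measurable[OF wiener_limit_L2(2)[OF vw]] in \<open>auto elim: eventually_mono\<close>)
    also have "\<dots> = 0" by (rule wiener_limit_mean[OF vw])
    finally have c: "c = 0" .
    then have "AE x in \<Lambda>. indicator {0..t} x *\<^sub>R v x - indicator {0..t} x *\<^sub>R w x = 0"
      using wiener_limit_zero_iff[OF vw] ae by simp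
    then have "AE x in lebesgue. x \<in> {0..T} \<longrightarrow> indicator {0..t} x *\<^sub>R v x - indicator {0..t} x *\<^sub>R w x = 0"
      by (subst (asm) AE_restrict_space_iff) auto
    then have "AE s in lebesgue. s \<in> {0..t} \<longrightarrow> v s = w s"
      by eventually_elim (use tT in auto)
    then show ?thesis using c by (simp add: c_def)
  qed
  have "AE s in lebesgue. s \<in> {0..u} \<longrightarrow> a s - b s = 0"
  proof (rule AE_zero_of_integrals_zero)
    show "set_integrable lebesgue {0..u} (\<lambda>s. a s - b s)" using a b by (rule set_integral_diff(1))
    fix t assume t: "t \<in> {0..<u}"
    have "set_integrable lebesgue {0..t} a" by (rule set_integrable_subset[OF a]) (use t in auto)
    moreover have "set_integrable lebesgue {0..t} b" by (rule set_integrable_subset[OF b]) (use t in auto)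
    ultimately show "(LINT s:{0..t}|lebesgue. a s - b s) = 0" using *[OF t] by (simp add: set_integral_diff(2))
  qed
  \<comment> \<open>The equation is available only before \<open>u\<close>, so the integrands are
    compared on countably many intervals exhausting [0, u).\<close>
  moreover have "AE s in lebesgue. \<forall>n. s \<in> {0..u - u / real (Suc n)} \<longrightarrow> v s = w s"
  proof (subst AE_all_countable, intro allI)
    fix n
    have "u / real (Suc n) \<le> u" using u by (simp add: field_simps)
    then have "u - u / real (Suc n) \<in> {0..<u}" using u by simp
    then show "AE s in lebesgue. s \<in> {0..u - u / real (Suc n)} \<longrightarrow> v s = w s" using * by blast
  qed
  moreover have "AE s in lebesgue. s \<noteq> u" using AE_completion[OF AE_lborel_singleton[of u]] .
  ultimately show ?thesis
  proof eventually_elim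
    case (elim s)
    show ?case
    proof
      assume s: "s \<in> {0..u}"
      then have "0 < (u - s) / u" using elim(3) u by simp
      then obtain n where "inverse (real (Suc n)) < (u - s) / u" using reals_Archimedean by blast
      then have "u / real (Suc n) < u - s" using u by (simp add: field_simps)
      then have "s \<in> {0..u - u / real (Suc n)}" using s by simp
      then show "a s = b s \<and> v s = w s" using elim(1,2) s by auto
    qed
  qed
qed

end

section \<open>Girsanov's theorem for deterministic drifts\<close>

locale girsanov = wiener_space M \<F> T W for M :: "'a measure" and \<F> T and W :: "real \<Rightarrow> 'a \<Rightarrow> real ^ 'n" +
  fixes \<theta> :: "real \<Rightarrow> real ^ 'n"
  assumes \<theta>: "square_integrable_on \<theta> {0..T}"
begin

abbreviation "I \<equiv> wint \<theta>"
abbreviation "Z \<equiv> girsanov_density M W \<theta>"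
abbreviation "WQ \<equiv> girsanov_process W \<theta>"

text \<open>The same construction as \<open>girsanov_measure\<close>, for a general filtration. Its
  events are those of \<open>\<F> T\<close>, so measurability for it means measurability at time
  \<open>T\<close>.\<close>

definition Q :: "'a measure" where
  "Q = density (restr_to_subalg M (\<F> T)) (\<lambda>w. ennreal (Z T w))"

definition drift :: "real \<Rightarrow> real ^ 'n" where
  "drift t = (LINT s:{0..t}|lebesgue. \<theta> s)"

lemma T_mem: "T \<in> {0..T}" "0 \<in> {0..T}"
  using T_nonneg by auto

lemma \<theta>_L2: "L2 \<Lambda> \<theta>"
  using \<theta> by (simp add: L2_lebesgue_on_iff)

lemma \<theta>_integrable: "set_integrable lebesgue {0..T} \<theta>"
  using \<Lambda>.L2_integrable[OF \<theta>_L2] by (simp add: set_integrable_def integrable_restrict_space)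

lemma \<theta>_nth: "t \<in> {0..T} \<Longrightarrow> square_integrable_on (\<lambda>s. \<theta> s $ i) {0..t}"
  using square_integrable_on_nth[OF square_integrable_on_subset[OF \<theta>]] by simp

lemma Z_eq: "t \<in> {0..T} \<Longrightarrow>
    Z t w = exp (- I t w) * exp (- msq \<Lambda> (trunc t \<theta>) / 2)"
  by (simp add: girsanov_density_def set_integral_lebesgue norm_indicator_sq exp_add[symmetric] del: norm_scaleR)

lemma Z_pos: "0 < Z t w"
  by (simp add: girsanov_density_def)

lemma indicator_Z_nonneg: "0 \<le> indicator A w * Z t w"
  by (simp add: less_imp_le[OF Z_pos])

lemma I_measurable: "t \<in> {0..T} \<Longrightarrow> I t \<in> borel_measurable (\<F> t)"
  by (rule wiener_integral_F_measurable) (simp_all add: \<theta>_nth)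

lemma Z_measurable: "t \<in> {0..T} \<Longrightarrow> Z t \<in> borel_measurable (\<F> t)"
  unfolding girsanov_density_def[abs_def] using I_measurable by measurable

lemma Z_measurable_M: "t \<in> {0..T} \<Longrightarrow> Z t \<in> borel_measurable M"
  using Z_measurable F_measurable_M by blast

lemma I_vint: "t \<in> {0..T} \<Longrightarrow> wiener_limit (\<lambda>x. - (indicator {0..t} x *\<^sub>R \<theta> x)) (\<lambda>w. - I t w)"
  using wiener_limit_scaleR[OF wiener_integral_vint[of t \<theta>], of "-1"] \<theta>_nth by simp

lemma Z_integrable: "t \<in> {0..T} \<Longrightarrow> integrable M (Z t)"
  using wiener_limit_exp_integrable[OF I_vint] by (simp add: Z_eq cong: Bochner_Integration.integrable_cong)

text \<open>Up to \<open>s\<close> the integrand is \<open>- \<theta>\<close>, so the martingale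
  generated by \<open>f\<close> equals \<open>Z\<close> at time \<open>s\<close>, whatever
  \<open>f\<close> does afterwards. With \<open>f = - \<theta>\<close> this is the martingale
  property of \<open>Z\<close>; adding a constant vector on (s, t] gives the increments under
  \<open>Q\<close>.\<close>

lemma exp_martingale_Z:
  assumes s: "s \<in> {0..T}" and A: "A \<in> sets (\<F> s)" and X: "wiener_limit f X"
    and f: "\<And>x. x \<in> {0..s} \<Longrightarrow> f x = - \<theta> x"
  shows "(\<integral>w. indicator A w * exp (X w) \<partial>M) * exp (- msq \<Lambda> f / 2) = (\<integral>w. indicator A w * Z s w \<partial>M)"
proof -
  obtain Y where Y: "wiener_limit (trunc s f) Y" and tr: "truncated_to s f X Y"
    using wiener_limit_truncate[OF X s] by blast
  have fs: "indicator {0..s} x *\<^sub>R f x = - (indicator {0..s} x *\<^sub>R \<theta> x)" for x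
    using f[of x] by (auto simp: indicator_def)
  have "AE w in M. Y w = - I s w" using wiener_limit_unique[OF Y I_vint[OF s]] unfolding fs by simp
  moreover have "Y \<in> borel_measurable M" by (rule L2_measurable[OF wiener_limit_L2(2)[OF Y]])
  moreover have "I s \<in> borel_measurable M" by (rule F_measurable_M[OF I_measurable[OF s] s])
  ultimately have "(\<integral>w. indicator A w * exp (Y w) \<partial>M) = (\<integral>w. indicator A w * exp (- I s w) \<partial>M)"
    using F_sets[OF s A] by (intro integral_cong_AE) (auto elim: eventually_mono)
  then have "(\<integral>w. indicator A w * exp (X w) \<partial>M) * exp (- msq \<Lambda> f / 2)
    = (\<integral>w. indicator A w * exp (- I s w) \<partial>M) * exp (- msq \<Lambda> (trunc s \<theta>) / 2)"
    using tr A unfolding truncated_to_def fs by simp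
  also have "\<dots> = (\<integral>w. indicator A w * Z s w \<partial>M)"
    unfolding Z_eq[OF s] by (simp add: mult.assoc[symmetric])
  finally show ?thesis .
qed

lemma Z_martingale:
  assumes s: "s \<in> {0..T}" and A: "A \<in> sets (\<F> s)"
  shows "(\<integral>w. indicator A w * Z T w \<partial>M) = (\<integral>w. indicator A w * Z s w \<partial>M)"
proof -
  have "(\<integral>w. indicator A w * exp (- I T w) \<partial>M) * exp (- msq \<Lambda> (\<lambda>x. - (indicator {0..T} x *\<^sub>R \<theta> x)) / 2)
      = (\<integral>w. indicator A w * Z s w \<partial>M)"
    by (rule exp_martingale_Z[OF s A I_vint[OF T_mem(1)]]) (use s in auto)
  then show ?thesis unfolding Z_eq[OF T_mem(1)] by (simp add: mult.assoc[symmetric])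
qed

text \<open>By the martingale property the mean is that of \<open>Z 0\<close>, which is almost
  surely 1 because both integrals over the single point 0 vanish.\<close>

lemma Z_expectation: "(\<integral>w. Z T w \<partial>M) = 1"
proof -
  have sp: "space M \<in> sets (\<F> 0)" using sets.top[of "\<F> 0"] by simp
  have ind: "(\<integral>w. indicator (space M) w * f w \<partial>M) = (\<integral>w. f w \<partial>M)" for f :: "'a \<Rightarrow> real"
    by (rule Bochner_Integration.integral_cong) auto
  have "msq \<Lambda> (trunc 0 \<theta>) = 0"
    by (rule integral_eq_zero_AE) (use AE_lebesgue_on_ne[of "{0..T}" 0] in \<open>auto elim!: eventually_mono\<close>)
  then have "AE w in M. Z 0 w = 1"
    using wiener_integral_0[OF \<theta>_nth[OF T_mem(2)]] by (auto simp: Z_eq[OF T_mem(2)] elim!: eventually_mono)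
  then have "(\<integral>w. Z 0 w \<partial>M) = (\<integral>w. 1 \<partial>M)"
    by (intro integral_cong_AE Z_measurable_M T_mem) auto
  then show ?thesis using Z_martingale[OF T_mem(2) sp] unfolding ind by (simp add: prob_space)
qed

section \<open>The measure with density Z at the horizon, its null sets and its restrictions\<close>

lemma sets_Q [measurable_cong]: "sets Q = sets (\<F> T)"
  by (simp add: Q_def sets_restr_to_subalg[OF subalg[OF T_mem(1)]])

lemma space_Q [simp]: "space Q = space M"
  by (simp add: Q_def space_restr_to_subalg)

lemma measurable_Q_iff: "measurable Q N = measurable (\<F> T) N"
  by (rule measurable_cong_sets[OF sets_Q refl])

lemma Z_measurable_restr: "Z T \<in> borel_measurable (restr_to_subalg M (\<F> T))"
  by (rule measurable_in_subalg[OF subalg[OF T_mem(1)] Z_measurable[OF T_mem(1)]])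

lemma integral_Q:
  fixes h :: "'a \<Rightarrow> real"
  assumes h: "h \<in> borel_measurable (\<F> T)"
  shows "integrable Q h \<longleftrightarrow> integrable M (\<lambda>w. Z T w * h w)"
    and "(\<integral>w. h w \<partial>Q) = (\<integral>w. Z T w * h w \<partial>M)"
proof -
  note sub = subalg[OF T_mem(1)]
  have h': "h \<in> borel_measurable (restr_to_subalg M (\<F> T))" by (rule measurable_in_subalg[OF sub h])
  have m: "(\<lambda>w. Z T w * h w) \<in> borel_measurable (\<F> T)" using h Z_measurable[OF T_mem(1)] by measurable
  have "integrable Q h \<longleftrightarrow> integrable (restr_to_subalg M (\<F> T)) (\<lambda>w. Z T w * h w)"
    unfolding Q_def using Z_pos by (subst integrable_density[OF h' Z_measurable_restr]) (auto intro: less_imp_le)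
  then show "integrable Q h \<longleftrightarrow> integrable M (\<lambda>w. Z T w * h w)"
    using integrable_from_subalg[OF sub] integrable_in_subalg[OF sub m] by blast
  have "(\<integral>w. h w \<partial>Q) = (\<integral>w. Z T w * h w \<partial>restr_to_subalg M (\<F> T))"
    unfolding Q_def using Z_pos by (subst integral_density[OF h' Z_measurable_restr]) (auto intro: less_imp_le)
  then show "(\<integral>w. h w \<partial>Q) = (\<integral>w. Z T w * h w \<partial>M)" using integral_subalgebra2[OF sub m] by simp
qed

text \<open>Stated for every \<open>t\<close>, as it computes both \<open>Q\<close> itself
  (\<open>t = T\<close>) and the candidates for its restrictions.\<close>

lemma emeasure_density_Z:
  assumes t: "t \<in> {0..T}" and A: "A \<in> sets (\<F> t)"
  shows "emeasure (density (restr_to_subalg M (\<F> t)) (\<lambda>w. ennreal (Z t w))) A = ennreal (\<integral>w. indicator A w * Z t w \<partial>M)"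
proof -
  note sub = subalg[OF t]
  have m: "(\<lambda>w. ennreal (indicator A w * Z t w)) \<in> borel_measurable (\<F> t)"
    using A Z_measurable[OF t] by measurable
  have "emeasure (density (restr_to_subalg M (\<F> t)) (\<lambda>w. ennreal (Z t w))) A
     = (\<integral>\<^sup>+w. ennreal (Z t w) * indicator A w \<partial>restr_to_subalg M (\<F> t))"
    using A measurable_in_subalg[OF sub Z_measurable[OF t]]
    by (intro emeasure_density) (auto simp: sets_restr_to_subalg[OF sub])
  also have "\<dots> = (\<integral>\<^sup>+w. ennreal (indicator A w * Z t w) \<partial>restr_to_subalg M (\<F> t))"
    by (intro nn_integral_cong) (auto simp: indicator_def)
  also have "\<dots> = (\<integral>\<^sup>+w. ennreal (indicator A w * Z t w) \<partial>M)" by (rule nn_integral_subalgebra2[OF sub m])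
  also have "\<dots> = ennreal (\<integral>w. indicator A w * Z t w \<partial>M)"
    using integrable_mult_indicator[OF F_sets[OF t A] Z_integrable[OF t]]
    by (intro nn_integral_eq_integral) (simp_all add: indicator_Z_nonneg)
  finally show ?thesis .
qed

lemmas emeasure_Q = emeasure_density_Z[OF T_mem(1), folded Q_def]

lemma prob_space_Q: "prob_space Q"
proof (rule prob_spaceI)
  have "space M \<in> sets (\<F> T)" using sets.top[of "\<F> T"] by simp
  moreover have "(\<integral>w. indicator (space M) w * Z T w \<partial>M) = (\<integral>w. Z T w \<partial>M)"
    by (rule Bochner_Integration.integral_cong) auto
  ultimately show "emeasure Q (space Q) = 1" by (simp add: emeasure_Q Z_expectation)
qed

sublocale Q: prob_space Q
  by (rule prob_space_Q)

lemma measure_Q: "A \<in> sets (\<F> T) \<Longrightarrow> measure Q A = (\<integral>w. indicator A w * Z T w \<partial>M)"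
  using Z_pos by (simp add: measure_def emeasure_Q Bochner_Integration.integral_nonneg less_imp_le)

text \<open>The density is strictly positive and every null set of \<open>M\<close> already lies in
  \<open>\<F> T\<close>. So the null sets are literally the same, although the sigma-algebras may
  differ, and almost sure statements move freely between the two measures.\<close>

lemma null_sets_Q: "null_sets Q = null_sets M"
proof -
  note sub = subalg[OF T_mem(1)]
  have nz: "ennreal (Z T w) \<noteq> 0" for w
    using Z_pos[of T w] by simp
  have "A \<in> null_sets Q \<longleftrightarrow> A \<in> null_sets (restr_to_subalg M (\<F> T))" for A
  proof -
    have "A \<in> null_sets Q \<longleftrightarrow> A \<in> sets (\<F> T) \<and> (AE x in restr_to_subalg M (\<F> T). x \<notin> A)"
      unfolding Q_def using Z_measurable_restr nz
      by (subst null_sets_density_iff) (auto simp: sets_restr_to_subalg[OF sub])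
    also have "\<dots> \<longleftrightarrow> A \<in> null_sets (restr_to_subalg M (\<F> T))"
      by (metis AE_iff_null_sets null_setsD2 sets_restr_to_subalg[OF sub])
    finally show ?thesis .
  qed
  then show ?thesis using null_sets_restr_to_subalg[OF sub] null_sets_le[OF T_mem(1)] by auto
qed

lemma AE_Q_iff: "(AE w in Q. P w) \<longleftrightarrow> (AE w in M. P w)"
  by (simp add: eventually_ae_filter null_sets_Q)

lemma equivalent_Q: "equivalent_measures Q (restr_to_subalg M (\<F> T))"
  using null_sets_restr_to_subalg[OF subalg[OF T_mem(1)]] null_sets_le[OF T_mem(1)] null_sets_Q
  by (auto simp: equivalent_measures_def absolutely_continuous_def sets_Q sets_restr_to_subalg[OF subalg[OF T_mem(1)]])

lemma subalg_Q: "t \<in> {0..T} \<Longrightarrow> subalgebra Q (\<F> t)"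
  using F_mono[of t T] by (simp add: subalgebra_def sets_Q)

text \<open>On events of \<open>\<F> t\<close> the martingale property replaces the density at
  \<open>T\<close> by the density at \<open>t\<close>.\<close>

lemma restr_Q:
  assumes t: "t \<in> {0..T}"
  shows "restr_to_subalg Q (\<F> t) = density (restr_to_subalg M (\<F> t)) (\<lambda>w. ennreal (Z t w))"
proof (rule measure_eqI)
  note sub = subalg[OF t] and subQ = subalg_Q[OF t]
  show "sets (restr_to_subalg Q (\<F> t)) = sets (density (restr_to_subalg M (\<F> t)) (\<lambda>w. ennreal (Z t w)))"
    by (simp add: sets_restr_to_subalg[OF sub] sets_restr_to_subalg[OF subQ])
  fix A assume "A \<in> sets (restr_to_subalg Q (\<F> t))"
  then have A: "A \<in> sets (\<F> t)" by (simp add: sets_restr_to_subalg[OF subQ])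
  then have AT: "A \<in> sets (\<F> T)" using F_mono[of t T] t by auto
  have "emeasure (restr_to_subalg Q (\<F> t)) A = emeasure Q A" by (rule emeasure_restr_to_subalg[OF subQ A])
  then show "emeasure (restr_to_subalg Q (\<F> t)) A = emeasure (density (restr_to_subalg M (\<F> t)) (\<lambda>w. ennreal (Z t w))) A"
    by (simp add: emeasure_Q[OF AT] emeasure_density_Z[OF t A] Z_martingale[OF t A])
qed

section \<open>Gaussian increments of the shifted process\<close>

lemma drift_eq: "t \<in> {0..T} \<Longrightarrow> drift t = (\<integral>x. indicator {0..t} x *\<^sub>R \<theta> x \<partial>\<Lambda>)"
  by (simp add: drift_def set_integral_lebesgue)

lemma drift_0: "drift 0 = 0"
  unfolding drift_eq[OF T_mem(2)]
  by (rule integral_eq_zero_AE) (use AE_lebesgue_on_ne[of "{0..T}" 0] in \<open>auto elim!: eventually_mono\<close>)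

lemma integral_single_drift:
  assumes p: "p \<in> {0..T}"
  shows "(\<integral>x. (indicator {0<..p} x *\<^sub>R v) \<bullet> \<theta> x \<partial>\<Lambda>) = v \<bullet> drift p"
proof -
  have i: "integrable \<Lambda> (trunc p \<theta>)" by (rule \<Lambda>.L2_integrable[OF restrict_L2[OF \<theta>_L2]])
  have "(\<lambda>x. indicator {0<..p} x *\<^sub>R v) \<in> borel_measurable \<Lambda>" by (rule borel_lebesgue_on) measurable
  moreover have "AE x in \<Lambda>. (indicator {0<..p} x *\<^sub>R v) \<bullet> \<theta> x = v \<bullet> (indicator {0..p} x *\<^sub>R \<theta> x)"
    using AE_lebesgue_on_ne[of "{0..T}" 0] by (auto elim!: eventually_mono simp: indicator_def)
  ultimately have "(\<integral>x. (indicator {0<..p} x *\<^sub>R v) \<bullet> \<theta> x \<partial>\<Lambda>) = (\<integral>x. v \<bullet> (indicator {0..p} x *\<^sub>R \<theta> x) \<partial>\<Lambda>)"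
    by (intro integral_cong_AE borel_measurable_inner L2_measurable[OF \<theta>_L2]
        borel_measurable_const borel_measurable_integrable[OF i])
  also have "\<dots> = v \<bullet> drift p" unfolding drift_eq[OF p] by (rule integral_inner_right) (rule i)
  finally show ?thesis .
qed

text \<open>With \<open>g = u\<close> on (s, t] and zero elsewhere,
  \<open>|g - \<theta>|^2 = |\<theta>|^2 - 2 g . \<theta> + |g|^2\<close>. The cross term integrates
  to \<open>u\<close> times the drift over (s, t], which is what the shift of \<open>W\<close> adds
  to the exponent. Hence \<open>Z T\<close> times the exponential of the shifted increment is a
  constant times the exponential of one Wiener integral, to which \<open>exp_martingale_Z\<close>
  applies.\<close>

lemma exp_increment_Q:
  assumes st: "s \<in> {0..T}" "t \<in> {0..T}" "s < t" and A: "A \<in> sets (\<F> s)"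
  shows "integrable Q (\<lambda>w. indicator A w * exp (u \<bullet> (WQ t w - WQ s w)))"
    and "(\<integral>w. indicator A w * exp (u \<bullet> (WQ t w - WQ s w)) \<partial>Q) = measure Q A * exp ((norm u)\<^sup>2 * (t - s) / 2)"
proof -
  define g where "g x = indicator {0<..t} x *\<^sub>R u - indicator {0<..s} x *\<^sub>R u" for x
  have g_ind: "g x = indicator {s<..t} x *\<^sub>R u" for x using st by (auto simp: g_def indicator_def)
  define f where "f x = - (indicator {0..T} x *\<^sub>R \<theta> x) + g x" for x
  define X where "X w = - I T w + (u \<bullet> (W t w - W 0 w) - u \<bullet> (W s w - W 0 w))" for w
  have e: "elementary g (\<lambda>w. u \<bullet> (W t w - W 0 w) - u \<bullet> (W s w - W 0 w))"
    unfolding g_def[abs_def] by (intro elementary_diff elementary_single st)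
  have X: "wiener_limit f X" unfolding f_def[abs_def] X_def[abs_def] by (rule wiener_limit_add[OF I_vint[OF T_mem(1)] elementary_vint[OF e]])
  have fs: "f x = - \<theta> x" if "x \<in> {0..s}" for x using that st by (auto simp: f_def g_ind indicator_def)
  have g2: "msq \<Lambda> g = (norm u)\<^sup>2 * (t - s)"
  proof -
    have sub: "{s<..t} \<subseteq> {0..T}" "{s<..t} \<inter> {0..T} = {s<..t}" "{s<..t} \<in> sets \<Lambda>" using st by (auto simp: sets_restrict_space)
    have "measure \<Lambda> {s<..t} = t - s" using st sub by (simp add: measure_restrict_space)
    then show ?thesis using sub unfolding g_ind norm_indicator_sq by simp
  qed
  have gd: "(\<integral>x. g x \<bullet> \<theta> x \<partial>\<Lambda>) = u \<bullet> (drift t - drift s)"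
  proof -
    have L: "L2 \<Lambda> (\<lambda>x. indicator {0<..p} x *\<^sub>R u)" if "p \<in> {0..T}" for p
      by (rule elementary_L2[OF elementary_single[OF that]])
    have "(\<integral>x. g x \<bullet> \<theta> x \<partial>\<Lambda>)
        = (\<integral>x. (indicator {0<..t} x *\<^sub>R u) \<bullet> \<theta> x \<partial>\<Lambda>) - (\<integral>x. (indicator {0<..s} x *\<^sub>R u) \<bullet> \<theta> x \<partial>\<Lambda>)"
      unfolding g_def inner_diff_left
      by (intro Bochner_Integration.integral_diff L2_inner_integrable[OF _ \<theta>_L2] L st)
    then show ?thesis unfolding integral_single_drift[OF st(1)] integral_single_drift[OF st(2)] inner_diff_right .
  qed
  have V: "msq \<Lambda> f
      = msq \<Lambda> (trunc T \<theta>) - 2 * (u \<bullet> (drift t - drift s)) + (norm u)\<^sup>2 * (t - s)"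
  proof -
    have "msq \<Lambda> f = (\<integral>x. (norm (indicator {0..T} x *\<^sub>R \<theta> x))\<^sup>2 - 2 * (g x \<bullet> \<theta> x) + (norm (g x))\<^sup>2 \<partial>\<Lambda>)"
      by (intro Bochner_Integration.integral_cong refl)
        (auto simp: f_def power2_norm_eq_inner inner_diff_left inner_diff_right inner_commute)
    also have "\<dots> = msq \<Lambda> (trunc T \<theta>) - 2 * (\<integral>x. g x \<bullet> \<theta> x \<partial>\<Lambda>) + msq \<Lambda> g"
      using L2_norm_sq_integrable[OF restrict_L2[OF \<theta>_L2, of T]] L2_inner_integrable[OF elementary_L2[OF e] \<theta>_L2]
        L2_norm_sq_integrable[OF elementary_L2[OF e]] by simp
    finally show ?thesis unfolding g2 gd .
  qed
  \<comment> \<open>The normalising factor of the integrand \<open>f\<close>, corrected by the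
    Gaussian factor that is to remain.\<close>
  define c where "c = exp (- msq \<Lambda> f / 2) * exp ((norm u)\<^sup>2 * (t - s) / 2)"
  have ZX: "Z T w * (indicator A w * exp (u \<bullet> (WQ t w - WQ s w))) = c * (indicator A w * exp (X w))" for w
  proof -
    have d: "u \<bullet> (WQ t w - WQ s w) = u \<bullet> W t w - u \<bullet> W s w + (u \<bullet> drift t - u \<bullet> drift s)"
      by (simp add: girsanov_process_def drift_def inner_diff_right inner_add_right)
    have "Z T w * exp (u \<bullet> (WQ t w - WQ s w)) = c * exp (X w)"
      unfolding d Z_eq[OF T_mem(1)] c_def V X_def exp_add[symmetric]
      by (simp add: inner_diff_right field_simps)
    then show ?thesis by (simp add: algebra_simps)
  qed
  have iA: "integrable M (\<lambda>w. c * (indicator A w * exp (X w)))"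
    using integrable_mult_indicator[OF F_sets[OF st(1) A] wiener_limit_exp_integrable[OF X]] by simp
  have m: "(\<lambda>w. indicator A w * exp (u \<bullet> (WQ t w - WQ s w))) \<in> borel_measurable (\<F> T)"
  proof -
    have "A \<in> sets (\<F> T)" using A F_mono[of s T] st by auto
    moreover have "W t \<in> borel_measurable (\<F> T)" "W s \<in> borel_measurable (\<F> T)"
      using W_measurable' st by auto
    ultimately show ?thesis unfolding girsanov_process_def by measurable
  qed
  show "integrable Q (\<lambda>w. indicator A w * exp (u \<bullet> (WQ t w - WQ s w)))"
    using iA unfolding integral_Q(1)[OF m] ZX .
  have AT: "A \<in> sets (\<F> T)" using A F_mono[of s T] st by auto
  have "(\<integral>w. indicator A w * exp (u \<bullet> (WQ t w - WQ s w)) \<partial>Q) = c * (\<integral>w. indicator A w * exp (X w) \<partial>M)"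
    unfolding integral_Q(2)[OF m] ZX by simp
  also have "\<dots> = (\<integral>w. indicator A w * Z s w \<partial>M) * exp ((norm u)\<^sup>2 * (t - s) / 2)"
    using exp_martingale_Z[OF st(1) A X fs] unfolding c_def by (simp add: mult_ac)
  also have "\<dots> = measure Q A * exp ((norm u)\<^sup>2 * (t - s) / 2)"
    by (simp add: measure_Q[OF AT] Z_martingale[OF st(1) A])
  finally show "(\<integral>w. indicator A w * exp (u \<bullet> (WQ t w - WQ s w)) \<partial>Q) = measure Q A * exp ((norm u)\<^sup>2 * (t - s) / 2)" .
qed

lemma drift_continuous: "continuous_on {0..T} drift"
proof -
  have "continuous_on {0..T} (\<lambda>t. integral {0..t} \<theta>)"
    by (rule indefinite_integral_continuous_1[OF set_lebesgue_integral_eq_integral(1)[OF \<theta>_integrable]])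
  moreover have "integral {0..t} \<theta> = drift t" if "t \<in> {0..T}" for t
  proof -
    have "set_integrable lebesgue {0..t} \<theta>" by (rule set_integrable_subset[OF \<theta>_integrable]) (use that in auto)
    then show ?thesis unfolding drift_def by (rule set_lebesgue_integral_eq_integral(2)[symmetric])
  qed
  ultimately show ?thesis by (rule continuous_on_eq)
qed

lemma WQ_eq: "WQ t w = W t w + drift t"
  by (simp add: girsanov_process_def drift_def)

lemma WQ_measurable: "t \<in> {0..T} \<Longrightarrow> WQ t \<in> borel_measurable (\<F> t)"
  unfolding WQ_eq[abs_def] using W_measurable by (intro borel_measurable_add) auto

text \<open>Path properties carry over because null sets are common; law and independence of
  increments come from their exponential moments on past events.\<close>

lemma brownian_motion_Q: "brownian_motion Q \<F> {0..T} WQ"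
  unfolding brownian_motion_def
proof (intro conjI ballI impI allI)
  show "prob_space Q" by (rule prob_space_Q)
  show "filtration (space Q) \<F>" using filtration_F by simp
  show "subalgebra Q (\<F> t)" if "t \<in> {0..T}" for t by (rule subalg_Q[OF that])
  show "WQ t \<in> borel_measurable (\<F> t)" if "t \<in> {0..T}" for t by (rule WQ_measurable[OF that])
  have "AE w in M. W 0 w = 0" using bm by (simp add: brownian_motion_def)
  then show "AE w in Q. WQ 0 w = 0" unfolding AE_Q_iff by eventually_elim (simp add: WQ_eq drift_0)
  have "AE w in M. continuous_on {0..T} (\<lambda>t. W t w)" using bm by (simp add: brownian_motion_def)
  then show "AE w in Q. continuous_on {0..T} (\<lambda>t. WQ t w)"
    unfolding AE_Q_iff WQ_eq by eventually_elim (rule continuous_on_add[OF _ drift_continuous])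
  fix s t assume st: "s \<in> {0..T}" "t \<in> {0..T}" "s < t"
  have X: "(\<lambda>w. WQ t w - WQ s w) \<in> borel_measurable Q"
    unfolding measurable_Q_iff
    using F_measurable_mono[OF WQ_measurable[OF st(1)], of T] F_measurable_mono[OF WQ_measurable[OF st(2)], of T] st
    by (intro borel_measurable_diff) auto
  have pos: "0 < t - s" using st by simp
  note inc = Q.gaussian_increment[OF X subalg_Q[OF st(1)] pos exp_increment_Q[OF st]]
  show "Q.indep_set (sets (\<F> s)) {(\<lambda>w. WQ t w - WQ s w) -` B \<inter> space Q | B. B \<in> sets borel}"
    by (rule inc(1))
  show "Q.indep_vars (\<lambda>_. borel) (\<lambda>i w. WQ t w $ i - WQ s w $ i) UNIV"
    using inc(2) unfolding vector_minus_component .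
  show "distributed Q lborel (\<lambda>w. WQ t w $ i - WQ s w $ i) (\<lambda>x. ennreal (normal_density 0 (sqrt (t - s)) x))" for i
    using inc(3)[of i] unfolding vector_minus_component .
qed

sublocale Q: wiener_space Q \<F> T WQ
  by unfold_locales (use brownian_motion_Q T_nonneg null_sets_le null_sets_Q in auto)

text \<open>The two processes differ by \<open>drift\<close>, so the elementary integrals differ, at
  every sample point, by a deterministic amount.\<close>

lemma elementary_Q:
  assumes "elementary g G"
  shows "Q.elementary g (\<lambda>w. G w + (\<integral>x. g x \<bullet> \<theta> x \<partial>\<Lambda>))"
proof -
  obtain P c where P: "finite P" "P \<subseteq> {0..T}" and g: "g = past_step P c" "G = past_int P c T" using assms by (auto simp: elementary_def)
  have L: "L2 \<Lambda> (\<lambda>x. indicator {0<..p} x *\<^sub>R c p)" if "p \<in> P" for p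
    using that P by (intro elementary_L2[OF elementary_single]) auto
  have "(\<integral>x. g x \<bullet> \<theta> x \<partial>\<Lambda>) = (\<integral>x. (\<Sum>p\<in>P. (indicator {0<..p} x *\<^sub>R c p) \<bullet> \<theta> x) \<partial>\<Lambda>)"
    unfolding g past_step_def inner_sum_left ..
  also have "\<dots> = (\<Sum>p\<in>P. \<integral>x. (indicator {0<..p} x *\<^sub>R c p) \<bullet> \<theta> x \<partial>\<Lambda>)"
    by (rule Bochner_Integration.integral_sum) (rule L2_inner_integrable[OF L \<theta>_L2])
  also have "\<dots> = (\<Sum>p\<in>P. c p \<bullet> drift p)"
    using P by (intro sum.cong refl integral_single_drift) auto
  finally have d: "(\<integral>x. g x \<bullet> \<theta> x \<partial>\<Lambda>) = (\<Sum>p\<in>P. c p \<bullet> drift p)" .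
  have "(\<lambda>w. G w + (\<integral>x. g x \<bullet> \<theta> x \<partial>\<Lambda>)) = Q.past_int P c T"
  proof
    fix w
    have "G w + (\<integral>x. g x \<bullet> \<theta> x \<partial>\<Lambda>) = (\<Sum>p\<in>P. c p \<bullet> (W (min p T) w - W 0 w) + c p \<bullet> drift p)"
      unfolding d unfolding g past_int_def by (rule sum.distrib[symmetric])
    also have "\<dots> = (\<Sum>p\<in>P. c p \<bullet> (WQ (min p T) w - WQ 0 w))"
      using P by (intro sum.cong refl) (auto simp: WQ_eq drift_0 min_absorb1 inner_diff_right inner_add_right)
    finally show "G w + (\<integral>x. g x \<bullet> \<theta> x \<partial>\<Lambda>) = Q.past_int P c T w" by (simp add: Q.past_int_def)
  qed
  moreover have "g = Q.past_step P c" unfolding g past_step_def[abs_def] Q.past_step_def[abs_def] ..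
  ultimately show ?thesis using P unfolding Q.elementary_def by blast
qed

text \<open>The isometry under \<open>Q\<close> yields its own limit \<open>Y\<close> of the shifted
  elementary integrals, and \<open>Y = X + D\<close> follows along a subsequence converging almost
  surely for both measures.\<close>

lemma wiener_limit_Q:
  assumes X: "wiener_limit f X" and Xm: "X \<in> borel_measurable (\<F> T)"
  shows "Q.wiener_limit f (\<lambda>w. X w + (\<integral>x. f x \<bullet> \<theta> x \<partial>\<Lambda>))"
proof -
  obtain g G where e: "\<And>m. elementary (g m) (G m)" and g: "L2lim \<Lambda> g f" and G: "L2lim M G X" by (rule wiener_limitE[OF X]) (rule that)
  define d where "d m = (\<integral>x. g m x \<bullet> \<theta> x \<partial>\<Lambda>)" for m
  define D where "D = (\<integral>x. f x \<bullet> \<theta> x \<partial>\<Lambda>)"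
  have d: "d \<longlonglongrightarrow> D" unfolding d_def[abs_def] D_def by (rule L2lim_inner[OF g \<theta>_L2])
  have eQ: "Q.elementary (g m) (\<lambda>w. G m w + d m)" for m unfolding d_def by (rule elementary_Q[OF e])
  obtain Y where Y: "L2lim Q (\<lambda>m w. G m w + d m) Y" using Q.elementary_seq_converges[OF eQ g] .
  obtain r :: "nat \<Rightarrow> nat" where r: "strict_mono r" "AE w in M. (\<lambda>m. G (r m) w) \<longlonglongrightarrow> X w"
    using L2lim_AE_subseq[OF G] by metis
  \<comment> \<open>Extracted from the previous subsequence, so that both almost sure limits hold
    along the same indices.\<close>
  obtain q :: "nat \<Rightarrow> nat" where q: "strict_mono q" "AE w in Q. (\<lambda>m. G (r (q m)) w + d (r (q m))) \<longlonglongrightarrow> Y w"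
    by (rule Q.L2lim_AE_subseq[OF L2lim_subseq[OF Y r(1)]]) (rule that)
  have dq: "(\<lambda>m. d (r (q m))) \<longlonglongrightarrow> D"
    using LIMSEQ_subseq_LIMSEQ[OF d strict_mono_o[OF r(1) q(1)]] by (simp add: o_def)
  have "AE w in M. Y w = X w + D"
    using r(2) q(2)[unfolded AE_Q_iff]
  proof eventually_elim
    case (elim w)
    have "(\<lambda>m. G (r (q m)) w) \<longlonglongrightarrow> X w" using LIMSEQ_subseq_LIMSEQ[OF elim(1) q(1)] by (simp add: o_def)
    from tendsto_add[OF this dq] show ?case using elim(2) LIMSEQ_unique by blast
  qed
  then have "AE w in Q. Y w = X w + D" unfolding AE_Q_iff .
  moreover have "(\<lambda>w. X w + D) \<in> borel_measurable Q" unfolding measurable_Q_iff using Xm by simp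
  ultimately show ?thesis
    unfolding D_def[symmetric] by (rule Q.wiener_limitI[OF eQ g L2lim_cong_AE[OF Y]])
qed

text \<open>The version chosen under \<open>Q\<close> and the shifted version chosen under
  \<open>M\<close> are limits for the same integrand, so uniqueness under \<open>Q\<close>
  identifies them.\<close>

lemma wiener_integral_Q:
  fixes k :: "real \<Rightarrow> real ^ 'n"
  assumes t: "t \<in> {0..T}" and k: "\<And>i. square_integrable_on (\<lambda>s. k s $ i) {0..t}"
  shows "AE w in M. Q.wint k t w
    = wint k t w + (LINT s:{0..t}|lebesgue. k s \<bullet> \<theta> s)"
proof -
  have m: "wint k t \<in> borel_measurable (\<F> T)"
    by (rule F_measurable_mono[OF wiener_integral_F_measurable[OF t k]]) (use t in auto)
  have "(\<integral>x. (indicator {0..t} x *\<^sub>R k x) \<bullet> \<theta> x \<partial>\<Lambda>) = (LINT s:{0..t}|lebesgue. k s \<bullet> \<theta> s)"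
    by (simp add: set_integral_lebesgue[OF t])
  then have "Q.wiener_limit (trunc t k)
      (\<lambda>w. wint k t w + (LINT s:{0..t}|lebesgue. k s \<bullet> \<theta> s))"
    using wiener_limit_Q[OF wiener_integral_vint[OF t k] m] by simp
  from Q.wiener_limit_unique[OF Q.wiener_integral_vint[OF t k] this] show ?thesis by (simp add: AE_Q_iff)
qed

end

section \<open>Completion of the filtration\<close>

text \<open>Induction over the generated sigma-algebra: being a natural event up to a null set holds
  for generators and is stable under complements and countable unions.\<close>

lemma completed_filtration_approx:
  assumes M: "prob_space M" and past: "past_events M W t \<subseteq> sets M"
    and A: "A \<in> sets (completed_filtration M W t)"
  shows "A \<in> sets M \<and> (\<exists>B\<in>sets (natural_filtration M W t). (A - B) \<union> (B - A) \<in> null_sets M)"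
proof -
  have P: "past_events M W t \<subseteq> Pow (space M)" by (auto simp: past_events_def)
  have N: "null_sets M \<subseteq> Pow (space M)" using sets.sets_into_space by (auto simp: null_sets_def)
  have nat: "sets (natural_filtration M W t) = sigma_sets (space M) (past_events M W t)"
    unfolding natural_filtration_def by (rule sets_measure_of[OF P])
  have natM: "sets (natural_filtration M W t) \<subseteq> sets M"
    unfolding nat by (rule sets.sigma_sets_subset[OF past])
  have "A \<in> sigma_sets (space M) (past_events M W t \<union> null_sets M)"
    using A P N by (simp add: completed_filtration_def)
  then show ?thesis
  proof induction
    case (Basic a)
    then show ?case
    proof
      assume a: "a \<in> past_events M W t"
      then have "a \<in> sets (natural_filtration M W t)" unfolding nat by (rule sigma_sets.Basic)
      then show ?thesis using a past by (intro conjI bexI[of _ a]) auto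
    next
      assume "a \<in> null_sets M"
      then show ?thesis by (intro conjI bexI[of _ "{}"]) auto
    qed
  next
    case Empty
    show ?case by (intro conjI bexI[of _ "{}"]) auto
  next
    case (Compl a)
    then obtain B where a: "a \<in> sets M" and B: "B \<in> sets (natural_filtration M W t)" "(a - B) \<union> (B - a) \<in> null_sets M"
      by blast
    have "space M - B \<in> sets (natural_filtration M W t)"
      using sets.compl_sets[OF B(1)] unfolding natural_filtration_def space_measure_of[OF P] .
    moreover have "(space M - a - (space M - B)) \<union> (space M - B - (space M - a)) = (a - B) \<union> (B - a)"
      using sets.sets_into_space[OF a] sets.sets_into_space[OF subsetD[OF natM B(1)]] by auto
    ultimately show ?case using a B(2) by (intro conjI bexI[of _ "space M - B"]) auto
  next
    case (Union a)
    then have "\<forall>i. \<exists>B. B \<in> sets (natural_filtration M W t) \<and> (a i - B) \<union> (B - a i) \<in> null_sets M" by blast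
    then obtain B where B: "\<And>i. B i \<in> sets (natural_filtration M W t)" "\<And>i. (a i - B i) \<union> (B i - a i) \<in> null_sets M"
      by metis
    have aM: "(\<Union>i. a i) \<in> sets M" using Union by auto
    have BM: "(\<Union>i. B i) \<in> sets (natural_filtration M W t)" using B(1) by auto
    have "(\<Union>i. (a i - B i) \<union> (B i - a i)) \<in> null_sets M" by (rule null_sets_UN) (rule B(2))
    moreover have "((\<Union>i. a i) - (\<Union>i. B i)) \<union> ((\<Union>i. B i) - (\<Union>i. a i)) \<in> sets M"
      using aM BM natM by auto
    moreover have "((\<Union>i. a i) - (\<Union>i. B i)) \<union> ((\<Union>i. B i) - (\<Union>i. a i)) \<subseteq> (\<Union>i. (a i - B i) \<union> (B i - a i))" by auto
    ultimately have "((\<Union>i. a i) - (\<Union>i. B i)) \<union> ((\<Union>i. B i) - (\<Union>i. a i)) \<in> null_sets M"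
      by (rule null_sets_subset)
    then show ?case using aM BM by blast
  qed
qed

lemma past_events_mono:
  assumes "s \<le> t"
  shows "past_events M W s \<subseteq> past_events M W t"
proof
  fix A assume "A \<in> past_events M W s"
  then obtain r B where "A = W r -` B \<inter> space M" "0 \<le> r" "r \<le> s" "B \<in> sets borel"
    unfolding past_events_def by blast
  with assms show "A \<in> past_events M W t"
    unfolding past_events_def by (intro CollectI exI[of _ r] exI[of _ B]) auto
qed

text \<open>Augmentation changes past events only by null sets, which affects no probability, so the
  increments stay independent of the larger sigma-algebra.\<close>

lemma brownian_motion_completed:
  assumes M: "prob_space M" and bm: "brownian_motion M (natural_filtration M W) {0..} W"
  shows "brownian_motion M (completed_filtration M W) {0..T} W"
    and "null_sets M \<subseteq> sets (completed_filtration M W t)"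
proof -
  interpret prob_space M by (rule M)
  have P: "past_events M W t \<subseteq> Pow (space M)" for t by (auto simp: past_events_def)
  have N: "null_sets M \<subseteq> Pow (space M)" using sets.sets_into_space by (auto simp: null_sets_def)
  have comp: "sets (completed_filtration M W t) = sigma_sets (space M) (past_events M W t \<union> null_sets M)" for t
    unfolding completed_filtration_def using P N by (intro sets_measure_of) auto
  have nat: "sets (natural_filtration M W t) = sigma_sets (space M) (past_events M W t)" for t
    unfolding natural_filtration_def by (rule sets_measure_of[OF P])
  have sp: "space (completed_filtration M W t) = space M" for t
    unfolding completed_filtration_def using P N by (intro space_measure_of) auto
  show "null_sets M \<subseteq> sets (completed_filtration M W t)" unfolding comp by (auto intro: sigma_sets.Basic)
  have natM: "sets (natural_filtration M W t) \<subseteq> sets M" if "0 \<le> t" for t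
    using bm that by (auto simp: brownian_motion_def subalgebra_def)
  have past: "past_events M W t \<subseteq> sets M" if "0 \<le> t" for t
    using natM[OF that] unfolding nat by (auto intro: sigma_sets.Basic)
  have le: "sets (natural_filtration M W t) \<subseteq> sets (completed_filtration M W t)" for t
    unfolding nat comp by (rule sigma_sets_mono') auto
  have compM: "sets (completed_filtration M W t) \<subseteq> sets M" if "0 \<le> t" for t
    using completed_filtration_approx[OF M past[OF that]] by blast
  show "brownian_motion M (completed_filtration M W) {0..T} W"
    unfolding brownian_motion_def
  proof (intro conjI ballI impI allI)
    show "prob_space M" by (rule M)
    show "filtration (space M) (completed_filtration M W)"
    proof
      show "space (completed_filtration M W i) = space M" for i by (rule sp)
      show "sets (completed_filtration M W i) \<subseteq> sets (completed_filtration M W j)" if "i \<le> j" for i j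
        unfolding comp by (rule sigma_sets_mono', rule Un_mono[OF past_events_mono[OF that] order_refl])
    qed
    show "subalgebra M (completed_filtration M W t)" if "t \<in> {0..T}" for t
      using that compM by (simp add: subalgebra_def sp)
    show "W t \<in> borel_measurable (completed_filtration M W t)" if "t \<in> {0..T}" for t
    proof -
      have "W t \<in> borel_measurable (natural_filtration M W t)" using bm that by (auto simp: brownian_motion_def)
      moreover have "space (natural_filtration M W t) = space M"
        unfolding natural_filtration_def by (rule space_measure_of[OF P])
      ultimately show ?thesis using le[of t] by (auto simp: measurable_def sp)
    qed
    show "AE w in M. W 0 w = 0" using bm by (simp add: brownian_motion_def)
    have "AE w in M. continuous_on {0..} (\<lambda>t. W t w)" using bm by (simp add: brownian_motion_def)
    then show "AE w in M. continuous_on {0..T} (\<lambda>t. W t w)"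
      by eventually_elim (rule continuous_on_subset, auto)
    fix s t assume st: "s \<in> {0..T}" "t \<in> {0..T}" "s < t"
    then have st': "s \<in> {0..}" "t \<in> {0..}" by auto
    have inc: "indep_set (sets (natural_filtration M W s)) {(\<lambda>w. W t w - W s w) -` B \<inter> space M | B. B \<in> sets borel}"
      "indep_vars (\<lambda>_. borel) (\<lambda>i w. W t w $ i - W s w $ i) UNIV"
      "\<And>i. distributed M lborel (\<lambda>w. W t w $ i - W s w $ i) (\<lambda>x. ennreal (normal_density 0 (sqrt (t - s)) x))"
      using bm st st' unfolding brownian_motion_def by blast+
    show "indep_vars (\<lambda>_. borel) (\<lambda>i w. W t w $ i - W s w $ i) UNIV" by (rule inc(2))
    show "distributed M lborel (\<lambda>w. W t w $ i - W s w $ i) (\<lambda>x. ennreal (normal_density 0 (sqrt (t - s)) x))" for i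
      by (rule inc(3))
    show "indep_set (sets (completed_filtration M W s)) {(\<lambda>w. W t w - W s w) -` B \<inter> space M | B. B \<in> sets borel}"
    proof (rule indep_setI)
      show "sets (completed_filtration M W s) \<subseteq> events" using compM st by auto
      show ev: "{(\<lambda>w. W t w - W s w) -` B \<inter> space M | B. B \<in> sets borel} \<subseteq> events"
        by (rule indep_setD_ev2[OF inc(1)])
      fix A D assume A: "A \<in> sets (completed_filtration M W s)"
        and D: "D \<in> {(\<lambda>w. W t w - W s w) -` B \<inter> space M | B. B \<in> sets borel}"
      have s0: "0 \<le> s" using st by simp
      obtain B where AM: "A \<in> sets M" and B: "B \<in> sets (natural_filtration M W s)" "(A - B) \<union> (B - A) \<in> null_sets M"
        using completed_filtration_approx[OF M past[OF s0] A] by blast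
      have BM: "B \<in> sets M" using B natM[OF s0] by auto
      have DM: "D \<in> sets M" by (rule subsetD[OF ev D])
      have ae: "AE w in M. w \<in> A \<longleftrightarrow> w \<in> B" using AE_not_in[OF B(2)] by eventually_elim auto
      have "prob A = prob B" using ae AM BM by (intro measure_eq_AE) auto
      moreover have "prob (A \<inter> D) = prob (B \<inter> D)" using ae AM BM DM by (intro measure_eq_AE) auto
      ultimately show "prob (A \<inter> D) = prob A * prob D" using indep_setD[OF inc(1) B(1) D] by simp
    qed
  qed
qed

section \<open>Forward prices\<close>

context girsanov
begin

text \<open>For one maturity, both sides amount to \<open>f t\<close> being almost surely
  \<open>c\<close> plus the integral of \<open>k\<close> up to \<open>t\<close> against
  \<open>WQ\<close>; here \<open>k\<close> stands for the kernel at maturity \<open>u\<close> and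
  \<open>c\<close> for \<open>\<phi>Q u\<close>. Rewriting that integral as one against
  \<open>W\<close> plus a drift and comparing with the dynamics before \<open>u\<close> yields the
  coefficients.\<close>

lemma forward_no_arbitrage_iff:
  fixes k v :: "real \<Rightarrow> real ^ 'n"
  assumes u: "0 < u" "u \<le> T"
    and k: "\<And>i. square_integrable_on (\<lambda>s. k s $ i) {0..u}"
    and Su: "Su \<in> borel_measurable (\<F> u)" "AE w in M. Su w = Q.wint k u w + c"
    and b: "set_integrable lebesgue {0..u} b" and v: "square_integrable_on v {0..u}"
    and dyn: "has_dynamics M W {0..<u} f b v"
    and fin: "AE w in M. f u w = Su w"
  shows "(integrable Q Su \<and> (\<forall>t\<in>{0..u}. AE w in Q. f t w = real_cond_exp Q (\<F> t) Su w)) \<longleftrightarrow>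
      (has_dynamics Q WQ {0..u} f (\<lambda>_. 0) k
        \<and> (AE w in Q. f u w = Su w)
        \<and> has_dynamics M W {0..u} f b v
        \<and> (AE t in lebesgue. t \<in> {0..u} \<longrightarrow> b t = k t \<bullet> \<theta> t \<and> v t = k t))"
proof -
  have uT: "u \<in> {0..T}" using u by simp
  have kt: "square_integrable_on (\<lambda>s. k s $ i) {0..t}" if "t \<in> {0..u}" for t i
    using square_integrable_on_subset[OF k, of t i] that by simp
  have vi: "square_integrable_on (\<lambda>s. v s $ i) {0..u}" for i by (rule square_integrable_on_nth[OF v])
  have tT: "t \<in> {0..T}" if "t \<in> {0..u}" for t using that u by simp
  have k\<theta>: "set_integrable lebesgue {0..u} (\<lambda>s. k s \<bullet> \<theta> s)"
  proof -
    have "L2 (lebesgue_on {0..u}) k"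
      using square_integrable_on_vec[OF k] by (simp add: L2_lebesgue_on_iff)
    moreover have "L2 (lebesgue_on {0..u}) \<theta>"
      using square_integrable_on_subset[OF \<theta> u(2)] by (simp add: L2_lebesgue_on_iff)
    ultimately have "integrable (lebesgue_on {0..u}) (\<lambda>s. k s \<bullet> \<theta> s)" by (rule L2_inner_integrable)
    then show ?thesis by (simp add: set_integrable_def integrable_restrict_space)
  qed
  have SuQ: "Su \<in> borel_measurable Q"
    unfolding measurable_Q_iff by (rule F_measurable_mono[OF Su(1) u(2)])
  have SuQ': "AE w in Q. Su w = Q.wint k u w + c" unfolding AE_Q_iff by (rule Su(2))
  note ce = Q.cond_exp_wiener_integral[OF _ _ u(2) k SuQ SuQ']
  have Si: "integrable Q Su" using ce(1)[of u] u by simp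
  have cond: "AE w in M. real_cond_exp Q (\<F> t) Su w = Q.wint k t w + c" if "t \<in> {0..u}" for t
    using ce(2)[of t] that unfolding AE_Q_iff by simp
  have u0: "0 \<in> {0..u}" using u by simp
  have I0: "AE w in M. Q.wint k 0 w = 0"
    using Q.wiener_integral_0[OF kt[OF u0]] unfolding AE_Q_iff .
  have IQ: "AE w in M. Q.wint k t w
      = wint k t w + (LINT s:{0..t}|lebesgue. k s \<bullet> \<theta> s)" if "t \<in> {0..u}" for t
    by (rule wiener_integral_Q[OF tT[OF that] kt[OF that]])
  let ?mart = "\<forall>t\<in>{0..u}. AE w in M. f t w = Q.wint k t w + c"
  have lhs: "(integrable Q Su \<and> (\<forall>t\<in>{0..u}. AE w in Q. f t w = real_cond_exp Q (\<F> t) Su w)) \<longleftrightarrow> ?mart"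
  proof -
    have "(AE w in M. f t w = real_cond_exp Q (\<F> t) Su w) \<longleftrightarrow>
        (AE w in M. f t w = Q.wint k t w + c)" if "t \<in> {0..u}" for t
    proof
      assume "AE w in M. f t w = real_cond_exp Q (\<F> t) Su w"
      with cond[OF that] show "AE w in M. f t w = Q.wint k t w + c" by eventually_elim simp
    next
      assume "AE w in M. f t w = Q.wint k t w + c"
      with cond[OF that] show "AE w in M. f t w = real_cond_exp Q (\<F> t) Su w" by eventually_elim simp
    qed
    then show ?thesis using Si unfolding AE_Q_iff by simp
  qed
  show ?thesis
    unfolding lhs
  proof
    assume mart: ?mart
    have f0: "AE w in M. f 0 w = c" using bspec[OF mart u0] I0 by eventually_elim simp
    have dynQ: "has_dynamics Q WQ {0..u} f (\<lambda>_. 0) k"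
      unfolding has_dynamics_def AE_Q_iff
    proof
      fix t assume t: "t \<in> {0..u}"
      show "AE w in M. f t w = f 0 w + (LINT s:{0..t}|lebesgue. 0) + Q.wint k t w"
        using bspec[OF mart t] f0 by eventually_elim (simp add: set_lebesgue_integral_def)
    qed
    have coeff: "AE t in lebesgue. t \<in> {0..u} \<longrightarrow> b t = k t \<bullet> \<theta> t \<and> v t = k t"
    proof (rule ito_coefficients_unique[OF u b k\<theta> vi k])
      fix t assume t: "t \<in> {0..<u}"
      then have t': "t \<in> {0..u}" by simp
      have "AE w in M. f t w = f 0 w + (LINT s:{0..t}|lebesgue. b s) + wint v t w"
        using dyn t by (simp add: has_dynamics_def)
      with bspec[OF mart t'] f0 IQ[OF t']
      show "AE w in M. (LINT s:{0..t}|lebesgue. b s) + wint v t w =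
          (LINT s:{0..t}|lebesgue. k s \<bullet> \<theta> s) + wint k t w"
        by eventually_elim simp
    qed
    have "has_dynamics M W {0..u} f b v"
      unfolding has_dynamics_def
    proof
      fix t assume t: "t \<in> {0..u}"
      show "AE w in M. f t w = f 0 w + (LINT s:{0..t}|lebesgue. b s) + wint v t w"
      proof (cases "t < u")
        case True
        then show ?thesis using dyn t by (simp add: has_dynamics_def)
      next
        \<comment> \<open>The dynamics under \<open>M\<close> were given only before maturity; at
          \<open>u\<close> they follow from the martingale representation and the equality of the
          coefficients.\<close>
        case False
        then have tu: "t = u" using t by simp
        have "(LINT s:{0..u}|lebesgue. b s) = (LINT s:{0..u}|lebesgue. k s \<bullet> \<theta> s)"
          unfolding set_lebesgue_integral_def
          using b k\<theta> coeff by (intro integral_cong_AE)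
            (auto simp: set_integrable_def indicator_def elim!: eventually_mono)
        moreover have "AE w in M. wint v u w = wint k u w"
        proof -
          have "AE x in \<Lambda>. indicator {0..u} x *\<^sub>R v x = indicator {0..u} x *\<^sub>R k x"
            using coeff by (subst AE_restrict_space_iff) (auto simp: indicator_def elim!: eventually_mono)
          then show ?thesis
            using wiener_limit_unique[OF wiener_integral_vint[OF uT vi] wiener_integral_vint[OF uT k]] by blast
        qed
        ultimately show ?thesis
          using bspec[OF mart t] f0 IQ[OF t] unfolding tu by (auto elim!: eventually_elim2 eventually_rev_mp)
      qed
    qed
    moreover have "AE w in Q. f u w = Su w" unfolding AE_Q_iff by (rule fin)
    ultimately show "has_dynamics Q WQ {0..u} f (\<lambda>_. 0) k
        \<and> (AE w in Q. f u w = Su w)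
        \<and> has_dynamics M W {0..u} f b v
        \<and> (AE t in lebesgue. t \<in> {0..u} \<longrightarrow> b t = k t \<bullet> \<theta> t \<and> v t = k t)"
      using dynQ coeff by blast
  next
    assume "has_dynamics Q WQ {0..u} f (\<lambda>_. 0) k
        \<and> (AE w in Q. f u w = Su w)
        \<and> has_dynamics M W {0..u} f b v
        \<and> (AE t in lebesgue. t \<in> {0..u} \<longrightarrow> b t = k t \<bullet> \<theta> t \<and> v t = k t)"
    then have dynQ: "AE w in M. f t w = f 0 w + Q.wint k t w" if "t \<in> {0..u}" for t
      using that by (auto simp: has_dynamics_def AE_Q_iff set_lebesgue_integral_def)
    have uu: "u \<in> {0..u}" using u by simp
    \<comment> \<open>The terminal price and the spot formula at \<open>u\<close> contain the same
      integral, so the initial price must be \<open>c\<close>.\<close>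
    have f0: "AE w in M. f 0 w = c"
      using dynQ[OF uu] fin Su(2) by eventually_elim simp
    show ?mart
    proof
      fix t assume "t \<in> {0..u}"
      from dynQ[OF this] f0 show "AE w in M. f t w = Q.wint k t w + c" by eventually_elim simp
    qed
  qed
qed

end

theorem proposition1:
  fixes M :: "'a measure"
    and W :: "real \<Rightarrow> 'a \<Rightarrow> real ^ 'n"
    and \<F> :: "real \<Rightarrow> 'a measure"
    and Tbar :: real
    and K :: "real \<Rightarrow> real \<Rightarrow> real ^ 'n"
    and \<phi> \<phi>Q :: "real \<Rightarrow> real"
    and S :: "real \<Rightarrow> 'a \<Rightarrow> real"
    and m :: nat
    and T :: "nat \<Rightarrow> real"
    and \<mu> :: "real \<Rightarrow> real \<Rightarrow> real"
    and \<sigma> :: "real \<Rightarrow> real \<Rightarrow> real ^ 'n"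
    and F :: "real \<Rightarrow> real \<Rightarrow> 'a \<Rightarrow> real"
    and \<theta> :: "real \<Rightarrow> real ^ 'n"
    and Q :: "'a measure"
    and WQ :: "real \<Rightarrow> 'a \<Rightarrow> real ^ 'n"
  assumes "prob_space M"
    and "brownian_motion M (natural_filtration M W) {0..} W"
    and \<F>: "\<F> = completed_filtration M W"
    and K: "\<And>t i. t \<in> {0..Tbar} \<Longrightarrow> square_integrable_on (\<lambda>s. K t s $ i) {0..t}"
    and \<phi>: "continuous_on {0..Tbar} \<phi>"
    and S_adapted: "\<And>t. t \<in> {0..Tbar} \<Longrightarrow> S t \<in> borel_measurable (\<F> t)"
    and S: "\<And>t. t \<in> {0..Tbar} \<Longrightarrow>
              AE \<omega> in M. S t \<omega> = vector_wiener_integral M W (K t) t \<omega> + \<phi> t"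
    and "1 \<le> m" and "0 < T 1" and "strict_mono_on {1..m} T" and "T m \<le> Tbar"
    and \<mu>: "\<And>j. j \<in> {1..m} \<Longrightarrow> set_integrable lebesgue {0..T j} (\<lambda>t. \<mu> t (T j))"
    and \<sigma>: "\<And>j. j \<in> {1..m} \<Longrightarrow> square_integrable_on (\<lambda>t. \<sigma> t (T j)) {0..T j}"
    and F_adapted: "\<And>j t. j \<in> {1..m} \<Longrightarrow> t \<in> {0..T j} \<Longrightarrow> F t (T j) \<in> borel_measurable (\<F> t)"
    and F_dynamics: "\<And>j. j \<in> {1..m} \<Longrightarrow>
              has_dynamics M W {0..<T j} (\<lambda>t. F t (T j)) (\<lambda>t. \<mu> t (T j)) (\<lambda>t. \<sigma> t (T j))"
    and F_terminal: "\<And>j. j \<in> {1..m} \<Longrightarrow> AE \<omega> in M. F (T j) (T j) \<omega> = S (T j) \<omega>"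
    and \<theta>: "square_integrable_on \<theta> {0..Tbar}"
    and Q: "Q = girsanov_measure M W \<theta> Tbar"
    and WQ: "WQ = girsanov_process W \<theta>"
    and \<phi>Q: "\<phi>Q = (\<lambda>t. \<phi> t - (LINT s:{0..t}|lebesgue. K t s \<bullet> \<theta> s))"
  shows "prob_space Q
    \<and> equivalent_measures Q (restr_to_subalg M (\<F> Tbar))
    \<and> (\<forall>t\<in>{0..Tbar}. restr_to_subalg Q (\<F> t) =
          density (restr_to_subalg M (\<F> t)) (\<lambda>\<omega>. ennreal (girsanov_density M W \<theta> t \<omega>)))
    \<and> brownian_motion Q \<F> {0..Tbar} WQ
    \<and> (\<forall>t\<in>{0..Tbar}. AE \<omega> in Q. S t \<omega> = vector_wiener_integral Q WQ (K t) t \<omega> + \<phi>Q t)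
    \<and> (arbitrage_free Q \<F> S (T ` {1..m}) F \<longleftrightarrow>
        (\<forall>j\<in>{1..m}.
            has_dynamics Q WQ {0..T j} (\<lambda>t. F t (T j)) (\<lambda>_. 0) (\<lambda>t. K (T j) t)
          \<and> (AE \<omega> in Q. F (T j) (T j) \<omega> = S (T j) \<omega>)
          \<and> has_dynamics M W {0..T j} (\<lambda>t. F t (T j)) (\<lambda>t. \<mu> t (T j)) (\<lambda>t. \<sigma> t (T j))
          \<and> (AE t in lebesgue. t \<in> {0..T j} \<longrightarrow>
                \<mu> t (T j) = K (T j) t \<bullet> \<theta> t \<and> \<sigma> t (T j) = K (T j) t)))"
proof -
  interpret prob_space M by fact
  have Tpos: "0 < T j" "T j \<le> Tbar" if "j \<in> {1..m}" for j
  proof -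
    have "T 1 \<le> T j" "T j \<le> T m"
      using strict_mono_on_leD[OF \<open>strict_mono_on {1..m} T\<close>] that by auto
    then show "0 < T j" "T j \<le> Tbar" using \<open>0 < T 1\<close> \<open>T m \<le> Tbar\<close> by auto
  qed
  have Tbar: "0 \<le> Tbar" using Tpos[of 1] \<open>1 \<le> m\<close> by simp
  interpret G: girsanov M \<F> Tbar W \<theta>
    by unfold_locales
      (use brownian_motion_completed[OF assms(1,2)] Tbar \<theta> in \<open>auto simp: \<F>\<close>)
  have Qeq: "Q = G.Q" unfolding G.Q_def by (simp add: Q girsanov_measure_def \<F>)
  have SQ: "AE \<omega> in M. S t \<omega> = vector_wiener_integral Q WQ (K t) t \<omega> + \<phi>Q t" if t: "t \<in> {0..Tbar}" for t
    using S[OF t] G.wiener_integral_Q[OF t K[OF t]] unfolding Qeq WQ \<phi>Q by eventually_elim simp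
  show ?thesis
  proof (intro conjI ballI)
    show "prob_space Q" unfolding Qeq by (rule G.prob_space_Q)
    show "equivalent_measures Q (restr_to_subalg M (\<F> Tbar))" unfolding Qeq by (rule G.equivalent_Q)
    show "restr_to_subalg Q (\<F> t) = density (restr_to_subalg M (\<F> t)) (\<lambda>\<omega>. ennreal (girsanov_density M W \<theta> t \<omega>))"
      if "t \<in> {0..Tbar}" for t
      unfolding Qeq by (rule G.restr_Q[OF that])
    show "brownian_motion Q \<F> {0..Tbar} WQ" unfolding Qeq WQ by (rule G.brownian_motion_Q)
    show "AE \<omega> in Q. S t \<omega> = vector_wiener_integral Q WQ (K t) t \<omega> + \<phi>Q t" if "t \<in> {0..Tbar}" for t
      using SQ[OF that] unfolding Qeq G.AE_Q_iff .
    show "arbitrage_free Q \<F> S (T ` {1..m}) F \<longleftrightarrow>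
        (\<forall>j\<in>{1..m}.
            has_dynamics Q WQ {0..T j} (\<lambda>t. F t (T j)) (\<lambda>_. 0) (\<lambda>t. K (T j) t)
          \<and> (AE \<omega> in Q. F (T j) (T j) \<omega> = S (T j) \<omega>)
          \<and> has_dynamics M W {0..T j} (\<lambda>t. F t (T j)) (\<lambda>t. \<mu> t (T j)) (\<lambda>t. \<sigma> t (T j))
          \<and> (AE t in lebesgue. t \<in> {0..T j} \<longrightarrow>
                \<mu> t (T j) = K (T j) t \<bullet> \<theta> t \<and> \<sigma> t (T j) = K (T j) t))"
      \<comment> \<open>The quantifier over the set of maturities becomes one over indices, and the
        equivalence is proved for each separately.\<close>
      unfolding arbitrage_free_def Set.ball_simps(9)
    proof (rule ball_cong[OF refl], goal_cases)
      case (1 j)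
      then have u: "T j \<in> {0..Tbar}" using Tpos[of j] by simp
      show ?case unfolding Qeq WQ
        by (rule G.forward_no_arbitrage_iff[OF Tpos[OF 1] K[OF u] S_adapted[OF u] SQ[OF u, unfolded Qeq WQ]
              \<mu>[OF 1] \<sigma>[OF 1] F_dynamics[OF 1] F_terminal[OF 1]])
    qed
  qed
qed

end
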